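(* Let $\Omega\subseteq\mathbb{C}$ be a simply connected domain, let $z_0\in\Omega$, and let $\Omega^*:=\Omega\setminus\{z_0\}$. Then for any $\psi\in\mathrm{Aut}(\Omega^* )$ and $\omega\in H(\Omega^* )$, the composition operator $C_{\omega,\psi}:H(\Omega^* )\to H(\Omega^* )$ is supercyclic if and only if it satisfies the Frequent Hypercyclicity Criterion.
   Context: $\mathrm{Aut}(\Omega^* )$ is the group of bijective holomorphic self-maps of $\Omega^*$. A domain $\Omega\subseteq\mathbb{C}$ is simply connected if $\mathbb{C}\setminus\Omega$ has no bounded components. $H(\Omega^* )$ is the space of holomorphic functions on $\Omega^*$ with the compact-open topology (a separable Fréchet space). The weighted composition operator $C_{\omega,\psi}$ is $C_{\omega,\psi}(f)(z)=\omega(z)\,f(\psi(z))$. An operator means a continuous linear self-map. An operator $T$ on a separable Fréchet space $X$ is supercyclic if for some $f\in X$ the set $\{\lambda T^nf:\lambda\in\mathbb{C},\ n=0,1,\dots\}$ is dense in $X$. $T$ satisfies the Frequent Hypercyclicity Criterion if there exist a dense subset $X_0$ of $X$ and a map $S:X_0\to X_0$ such that, for each $f\in X_0$: (i) $\sum_{n=1}^\infty T^n f$ converges unconditionally; (ii) $\sum_{n=1}^\infty S^n f$ converges unconditionally; (iii) $TSf=f$. *)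

theory Defs
  imports "HOL-Complex_Analysis.Complex_Analysis" "HOL-Library.Function_Algebras"
begin

text \<open>
  The underlying space is a topology \<open>X\<close> on a subset of an abelian group, with scalar
  multiplication \<open>smul\<close>. The notions below are meant for the case that \<open>topspace X\<close> is closed
  under addition and \<open>smul\<close>, that these make it a separable Frechet space, and that \<open>T\<close> is a
  continuous linear self-map of it.
\<close>

definition supercyclic ::
    "'a topology \<Rightarrow> (complex \<Rightarrow> 'a \<Rightarrow> 'a) \<Rightarrow> ('a \<Rightarrow> 'a) \<Rightarrow> bool" where
  "supercyclic X smul T \<longleftrightarrow>
    (\<exists>f\<in>topspace X. X closure_of {smul c ((T ^^ n) f) |c n. True} = topspace X)"

text \<open>A series converges unconditionally if all its rearrangements converge.\<close>

definition unconditionally_convergent_in ::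
    "'a::comm_monoid_add topology \<Rightarrow> (nat \<Rightarrow> 'a) \<Rightarrow> bool" where
  "unconditionally_convergent_in X x \<longleftrightarrow>
    (\<forall>p. bij p \<longrightarrow> (\<exists>s. limitin X (\<lambda>N. \<Sum>n<N. x (p n)) s sequentially))"

text \<open>The iterates in the two series start with the first one, whence the \<open>Suc n\<close>.\<close>

definition frequent_hypercyclicity_criterion ::
    "'a::comm_monoid_add topology \<Rightarrow> ('a \<Rightarrow> 'a) \<Rightarrow> bool" where
  "frequent_hypercyclicity_criterion X T \<longleftrightarrow>
    (\<exists>X\<^sub>0 S. X\<^sub>0 \<subseteq> topspace X \<and> X closure_of X\<^sub>0 = topspace X \<and> S \<in> X\<^sub>0 \<rightarrow> X\<^sub>0 \<and>
      (\<forall>f\<in>X\<^sub>0.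
        unconditionally_convergent_in X (\<lambda>n. (T ^^ Suc n) f) \<and>
        unconditionally_convergent_in X (\<lambda>n. (S ^^ Suc n) f) \<and>
        T (S f) = f))"

text \<open>
  Functions on \<open>U\<close> are represented by total functions vanishing off \<open>U\<close>, so that two elements of
  \<open>holo U\<close> are equal iff they agree on \<open>U\<close>. The linear structure is the pointwise one.
\<close>

definition holo :: "complex set \<Rightarrow> (complex \<Rightarrow> complex) set" where
  "holo U = {f. f holomorphic_on U \<and> (\<forall>z. z \<notin> U \<longrightarrow> f z = 0)}"

definition holo_topology :: "complex set \<Rightarrow> (complex \<Rightarrow> complex) topology" where
  "holo_topology U =
    subtopology
      (topology_generated_by {{f. f ` K \<subseteq> V} |K V. compact K \<and> K \<subseteq> U \<and> open V}) (holo U)"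

definition fscale :: "complex \<Rightarrow> (complex \<Rightarrow> complex) \<Rightarrow> complex \<Rightarrow> complex" where
  "fscale c f = (\<lambda>z. c * f z)"

definition holo_Aut :: "complex set \<Rightarrow> (complex \<Rightarrow> complex) set" where
  "holo_Aut U = {\<psi>. \<psi> holomorphic_on U \<and> bij_betw \<psi> U U}"

definition weighted_comp ::
    "complex set \<Rightarrow> (complex \<Rightarrow> complex) \<Rightarrow> (complex \<Rightarrow> complex) \<Rightarrow>
      (complex \<Rightarrow> complex) \<Rightarrow> complex \<Rightarrow> complex" where
  "weighted_comp U \<omega> \<psi> f = (\<lambda>z. if z \<in> U then \<omega> z * f (\<psi> z) else 0)"

lemma topspace_holo_topology [simp]: "topspace (holo_topology U) = holo U"
proof -
  have "UNIV \<in> {{f::complex \<Rightarrow> complex. f ` K \<subseteq> V} |K V. compact K \<and> K \<subseteq> U \<and> open V}"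
    by (rule CollectI, rule exI[of _ "{}"], rule exI[of _ "{}"]) auto
  then show ?thesis
    unfolding holo_topology_def by (auto simp: topspace_subtopology)
qed

text \<open>The weighted composition operators are continuous linear self-maps.\<close>

lemma weighted_comp_holo:
  assumes "\<omega> holomorphic_on U" "\<psi> \<in> holo_Aut U" "f \<in> holo U"
  shows "weighted_comp U \<omega> \<psi> f \<in> holo U"
proof -
  have "\<psi> holomorphic_on U" "\<psi> ` U = U" "f holomorphic_on U"
    using assms by (auto simp: holo_Aut_def holo_def bij_betw_def)
  then have "(f \<circ> \<psi>) holomorphic_on U"
    by (auto intro: holomorphic_on_compose)
  then have "(\<lambda>z. \<omega> z * f (\<psi> z)) holomorphic_on U"
    using assms(1) by (auto intro: holomorphic_on_mult simp: o_def)
  then have "weighted_comp U \<omega> \<psi> f holomorphic_on U"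
    by (rule holomorphic_transform) (simp add: weighted_comp_def)
  then show ?thesis
    by (simp add: holo_def weighted_comp_def)
qed

lemma weighted_comp_add: "weighted_comp U \<omega> \<psi> (f + g) = weighted_comp U \<omega> \<psi> f + weighted_comp U \<omega> \<psi> g"
  by (auto simp: weighted_comp_def algebra_simps)

lemma weighted_comp_fscale: "weighted_comp U \<omega> \<psi> (fscale c f) = fscale c (weighted_comp U \<omega> \<psi> f)"
  by (auto simp: weighted_comp_def fscale_def)

lemma continuous_map_weighted_comp:
  assumes \<omega>: "\<omega> holomorphic_on U" and \<psi>: "\<psi> \<in> holo_Aut U"
  shows "continuous_map (holo_topology U) (holo_topology U) (weighted_comp U \<omega> \<psi>)"
proof -
  let ?B = "{{f::complex \<Rightarrow> complex. f ` K \<subseteq> V} |K V. compact K \<and> K \<subseteq> U \<and> open V}"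
  let ?C = "weighted_comp U \<omega> \<psi>"
  have \<psi>U: "\<psi> ` U = U" and c\<psi>: "continuous_on U \<psi>" and c\<omega>: "continuous_on U \<omega>"
    using \<psi> \<omega> by (auto simp: holo_Aut_def bij_betw_def intro: holomorphic_on_imp_continuous_on)
  have "UNIV \<in> ?B"
    by (rule CollectI, rule exI[of _ "{}"], rule exI[of _ "{}"]) auto
  then have UB: "\<Union>?B = UNIV" by blast
  have "continuous_map (holo_topology U) (topology_generated_by ?B) ?C"
  proof (rule continuous_on_generated_topo)
    show "?C ` topspace (holo_topology U) \<subseteq> \<Union> ?B" 
      unfolding UB by simp
  next
    fix W assume "W \<in> ?B"
    then obtain K V where W: "W = {f. f ` K \<subseteq> V}" and K: "compact K" "K \<subseteq> U" and V: "open V"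
      by auto
    have "\<exists>T. openin (holo_topology U) T \<and> f \<in> T \<and> T \<subseteq> ?C -` W \<inter> topspace (holo_topology U)"
      if f: "f \<in> ?C -` W \<inter> topspace (holo_topology U)" for f
    proof -
      have fU: "f \<in> holo U" using f by simp
      then have cf: "continuous_on U f"
        by (auto simp: holo_def intro: holomorphic_on_imp_continuous_on)
      have cf\<psi>: "continuous_on K (\<lambda>z. f (\<psi> z))"
        by (rule continuous_on_subset[OF _ K(2)], rule continuous_on_compose2[OF cf c\<psi>])
          (use \<psi>U in auto)
      have c\<omega>K: "continuous_on K \<omega>" using c\<omega> K(2) continuous_on_subset by blast
      have "\<exists>e B. 0 < e \<and> open B \<and> (\<forall>w\<in>K \<inter> cball z e. f (\<psi> w) \<in> B \<and> (\<forall>b\<in>B. \<omega> w * b \<in> V))"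
        if z: "z \<in> K" for z
      proof -
        have inV: "\<omega> z * f (\<psi> z) \<in> V"
          using f z K(2) by (auto simp: W weighted_comp_def)
        have "open ((\<lambda>p. fst p * snd p :: complex) -` V)"
          by (rule open_vimage[OF V]) (intro continuous_intros)
        then obtain A B where AB: "open A" "open B" "\<omega> z \<in> A" "f (\<psi> z) \<in> B"
            "A \<times> B \<subseteq> (\<lambda>p. fst p * snd p) -` V"
          using inV by (elim open_prod_elim[where x = "(\<omega> z, f (\<psi> z))"]) auto
        have "\<forall>\<^sub>F w in at z within K. \<omega> w \<in> A \<and> f (\<psi> w) \<in> B"
          using c\<omega>K cf\<psi> z AB unfolding continuous_on_def
          by (intro eventually_conj) (auto dest!: topological_tendstoD)
        then obtain d where d: "d > 0" "\<And>w. w \<in> K \<Longrightarrow> w \<noteq> z \<Longrightarrow> dist w z < d \<Longrightarrow> \<omega> w \<in> A \<and> f (\<psi> w) \<in> B"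
          unfolding eventually_at by auto
        have *: "\<omega> w \<in> A \<and> f (\<psi> w) \<in> B" if "w \<in> K \<inter> cball z (d/2)" for w
          using d AB that by (cases "w = z") (auto simp: dist_commute)
        show ?thesis
          using * d(1) AB by (intro exI[of _ "d/2"] exI[of _ B]) force
      qed
      then obtain e B where eB: "\<And>z. z \<in> K \<Longrightarrow> 0 < e z" "\<And>z. z \<in> K \<Longrightarrow> open (B z)"
        "\<And>z w. z \<in> K \<Longrightarrow> w \<in> K \<inter> cball z (e z) \<Longrightarrow> f (\<psi> w) \<in> B z \<and> (\<forall>b\<in>B z. \<omega> w * b \<in> V)"
        by metis
      obtain F where F: "F \<subseteq> K" "finite F" "K \<subseteq> (\<Union>z\<in>F. ball z (e z))"
        using compactE_image[OF K(1), of K "\<lambda>z. ball z (e z)"] eB(1)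
        by (metis (no_types, lifting) UN_iff centre_in_ball open_ball subsetI)
      define N where "N z = {g. g ` (\<psi> ` (K \<inter> cball z (e z))) \<subseteq> B z}" for z
      have NB: "N z \<in> ?B" if "z \<in> F" for z
      proof -
        have "compact (\<psi> ` (K \<inter> cball z (e z)))"
          using K c\<psi> by (intro compact_continuous_image compact_Int_closed)
            (auto intro: continuous_on_subset)
        moreover have "\<psi> ` (K \<inter> cball z (e z)) \<subseteq> U" using \<psi>U K(2) by blast
        moreover have "open (B z)" using eB F that by blast
        ultimately show ?thesis unfolding N_def by blast
      qed
      define T where "T = (\<Inter>z\<in>F. holo U \<inter> N z) \<inter> topspace (holo_topology U)"
      have op: "openin (holo_topology U) (holo U \<inter> N z)" if "z \<in> F" for z
        unfolding holo_topology_def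
        by (rule openin_subtopology_Int2, rule topology_generated_by_Basis, rule NB[OF that])
      have "openin (holo_topology U) T"
        unfolding T_def
        by (rule openin_INT[OF F(2) op])
      moreover have "f \<in> T"
        using fU eB F(1) by (auto simp: T_def N_def)
      moreover have "g \<in> ?C -` W" if "g \<in> T" for g
      proof -
        have "?C g w \<in> V" if w: "w \<in> K" for w
        proof -
          obtain z where z: "z \<in> F" "w \<in> ball z (e z)" using F w by blast
          moreover have "g \<in> N z" using \<open>g \<in> T\<close> z(1) unfolding T_def by blast
          ultimately have "g (\<psi> w) \<in> B z"
            using w by (force simp: N_def)
          then show ?thesis
            using eB(3)[of z w] z w F(1) K(2) by (auto simp: weighted_comp_def)
        qed
        then show ?thesis by (auto simp: W)
      qed
      ultimately show ?thesis
        by (intro exI[of _ T]) (auto simp: T_def)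
    qed
    then show "openin (holo_topology U) (?C -` W \<inter> topspace (holo_topology U))"
      by (subst openin_subopen) blast
  qed
  then have "continuous_map (holo_topology U) (subtopology (topology_generated_by ?B) (holo U)) ?C"
    using weighted_comp_holo[OF \<omega> \<psi>] by (intro continuous_map_into_subtopology) auto
  then show ?thesis
    by (simp only: holo_topology_def[symmetric])
qed

end

theory Submission
  imports Defs
begin

text \<open>
  That the Frequent Hypercyclicity Criterion implies supercyclicity holds over every open set and
  for the usual reason: a dense orbit is built from the inverse branch \<open>S\<close>
  (\<open>frequent_hypercyclicity_criterion_imp_supercyclic\<close>). The content lies in the converse, where there are
  so few automorphisms that every supercyclic operator can be brought to an explicit form.

  If \<open>\<Omega>\<close> is not the plane, the Riemann map carries \<open>\<Omega> - {z\<^sub>0}\<close> to the punctured disc, whose automorphisms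
  preserve the modulus by the Schwarz lemma. If \<open>\<Omega>\<close> is the plane, an automorphism of \<open>\<Omega> - {z\<^sub>0}\<close> becomes, after
  a translation, \<open>z \<mapsto> a / z\<close> or \<open>z \<mapsto> a * z\<close>. In all cases except \<open>z \<mapsto> a * z\<close> with \<open>\<bar>a\<bar> \<noteq> 1\<close> the automorphism
  preserves a real function with suitable compact preimages of intervals. Then no operator is
  supercyclic: its weight would have no zeros (\<open>supercyclic_weight_nonzero\<close>), so all functions in the orbit
  of \<open>f\<close> would have their zeros on the same level sets as the zeros of \<open>f\<close>, and finitely many levels in a
  compact range cannot serve to approximate functions with zeros at arbitrary places
  (\<open>not_supercyclic_if_invariant\<close>).

  In the remaining case the weight is \<open>\<omega> z = z powi k * exp (h z)\<close>. Since \<open>\<bar>a\<bar> \<noteq> 1\<close>, the equation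
  \<open>v (a * z) - v z = h\<^sub>0 - h z\<close>, where \<open>h\<^sub>0\<close> is the constant Laurent coefficient of \<open>h\<close>, can be solved on the punctured plane, and
  multiplication by \<open>exp v\<close> makes the operator similar to the model \<open>f \<mapsto> c * z powi k * f (a * z)\<close>
  (\<open>punctured_plane_weight_normal_form\<close>). For the model both properties are equivalent to
  \<open>\<bar>a\<bar> powi k < 1\<close>. Under this condition the iterates of the model and of its inverse decay
  superexponentially on Laurent polynomials, which gives the criterion
  (\<open>monomial_weight_frequent_hypercyclicity_criterion\<close>). Conversely, if the model is supercyclic, let the
  \<open>N p\<close>-th iterate of the vector be, up to a scalar, close to \<open>z powi p\<close>, for each integer \<open>p\<close>. Comparing
  Laurent coefficients shows that \<open>\<bar>a\<bar> powi k \<ge> 1\<close> would make \<open>N\<close> strictly monotone from the integers to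
  the naturals (\<open>supercyclic_monomial_weight_imp\<close>).
\<close>

text \<open>
  Closeness to \<open>f\<close> on \<open>K\<close> is implied by finitely many conditions \<open>g ` closure A \<subseteq> B\<close> in which \<open>A\<close>
  and \<open>B\<close> come from one base of the plane. Taken with an arbitrary base this compares the
  compact-open topology with uniform convergence on compact sets; taken with a countable base it
  leaves only countably many conditions, which is what separability needs.
\<close>

section \<open>The compact-open topology as uniform convergence on compact sets\<close>

lemma basic_sets_cover:
  fixes f :: "complex \<Rightarrow> complex"
  assumes "topological_basis \<B>" "open U" "continuous_on U f" "compact K" "K \<subseteq> U" "0 < e"
  obtains F where "finite F" "F \<subseteq> \<B> \<times> \<B>"
    "\<forall>(A, B)\<in>F. compact (closure A) \<and> closure A \<subseteq> U \<and> f ` closure A \<subseteq> B"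
    "\<forall>g. (\<forall>(A, B)\<in>F. g ` closure A \<subseteq> B) \<longrightarrow> (\<forall>z\<in>K. norm (g z - f z) < (e::real))"
proof -
  have "\<exists>A B. A \<in> \<B> \<and> B \<in> \<B> \<and> x \<in> A \<and> compact (closure A) \<and> closure A \<subseteq> U \<and> f ` closure A \<subseteq> B
      \<and> B \<subseteq> ball (f x) (e/2)" if "x \<in> K" for x
  proof -
    obtain B where B: "B \<in> \<B>" "f x \<in> B" "B \<subseteq> ball (f x) (e/2)"
      using topological_basisE[OF assms(1), of "ball (f x) (e/2)" "f x"] assms(6) by auto
    have "open B" using B(1) assms(1) topological_basis_open by blast
    then have "open (U \<inter> f -` B)"
      using assms(2,3) continuous_open_preimage by blast
    moreover have "x \<in> U \<inter> f -` B" using that assms(5) B(2) by auto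
    ultimately obtain r where r: "r > 0" "cball x r \<subseteq> U \<inter> f -` B"
      by (meson open_contains_cball)
    obtain A where A: "A \<in> \<B>" "x \<in> A" "A \<subseteq> ball x r"
      using topological_basisE[OF assms(1), of "ball x r" x] r(1) by auto
    have cl: "closure A \<subseteq> cball x r"
      by (rule closure_minimal) (use A in force)+
    then have "compact (closure A)"
      by (meson bounded_cball bounded_subset closed_closure compact_eq_bounded_closed)
    then show ?thesis using A B cl r(2) by blast
  qed
  then obtain A B where AB: "\<And>x. x \<in> K \<Longrightarrow> A x \<in> \<B> \<and> B x \<in> \<B> \<and> x \<in> A x \<and> compact (closure (A x))
      \<and> closure (A x) \<subseteq> U \<and> f ` closure (A x) \<subseteq> B x \<and> B x \<subseteq> ball (f x) (e/2)"
    by metis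
  obtain D where D: "D \<subseteq> K" "finite D" "K \<subseteq> (\<Union>x\<in>D. A x)"
  proof (rule compactE_image[OF assms(4), of K A])
    show "open (A x)" if "x \<in> K" for x
      using AB[OF that] assms(1) topological_basis_open by blast
    show "K \<subseteq> (\<Union>x\<in>K. A x)" using AB by blast
  qed blast
  show thesis
  proof (rule that[of "(\<lambda>x. (A x, B x)) ` D"])
    show "finite ((\<lambda>x. (A x, B x)) ` D)" using D by simp
    show "(\<lambda>x. (A x, B x)) ` D \<subseteq> \<B> \<times> \<B>" using D AB by blast
    show "\<forall>(A, B)\<in>(\<lambda>x. (A x, B x)) ` D. compact (closure A) \<and> closure A \<subseteq> U \<and> f ` closure A \<subseteq> B"
      using D(1) AB by blast
    show "\<forall>g. (\<forall>(A, B)\<in>(\<lambda>x. (A x, B x)) ` D. g ` closure A \<subseteq> B) \<longrightarrow> (\<forall>z\<in>K. norm (g z - f z) < e)"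
    proof (intro allI impI ballI)
      fix g z assume g: "\<forall>(A, B)\<in>(\<lambda>x. (A x, B x)) ` D. g ` closure A \<subseteq> B" and z: "z \<in> K"
      obtain x where x: "x \<in> D" "z \<in> A x" using D z by blast
      have "z \<in> closure (A x)" using x closure_subset by blast
      then have "g z \<in> B x" "f z \<in> B x"
        using g x AB[of x] D(1) by (auto simp: image_subset_iff)
      moreover have "B x \<subseteq> ball (f x) (e/2)" using AB D(1) x(1) by blast
      ultimately have "dist (f x) (g z) < e/2" "dist (f x) (f z) < e/2"
        by (meson mem_ball subsetD)+
      then have "dist (g z) (f z) < e"
        by (metis dist_commute dist_triangle_half_l)
      then show "norm (g z - f z) < e" by (simp add: dist_norm)
    qed
  qed
qed

lemma openin_holo_tube:
  assumes "finite F"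
    "\<And>A B. (A, B) \<in> F \<Longrightarrow> compact (closure A) \<and> closure A \<subseteq> U \<and> open B"
  shows "openin (holo_topology U) {g\<in>holo U. \<forall>(A, B)\<in>F. g ` closure A \<subseteq> B}"
proof -
  have "openin (holo_topology U) (holo U \<inter> {g. g ` closure A \<subseteq> B})" if "(A, B) \<in> F" for A B
    unfolding holo_topology_def
    by (rule openin_subtopology_Int2, rule topology_generated_by_Basis) (use assms that in blast)
  then have "openin (holo_topology U)
      ((\<Inter>p\<in>F. holo U \<inter> {g. g ` closure (fst p) \<subseteq> snd p}) \<inter> topspace (holo_topology U))"
    by (intro openin_INT assms(1)) auto
  also have "(\<Inter>p\<in>F. holo U \<inter> {g. g ` closure (fst p) \<subseteq> snd p}) \<inter> topspace (holo_topology U)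
      = {g\<in>holo U. \<forall>(A, B)\<in>F. g ` closure A \<subseteq> B}"
    by (auto simp: split_beta)
  finally show ?thesis .
qed

text \<open>
  Together with its converse below, this says that the neighbourhoods of \<open>f\<close> in the compact-open
  topology are those of uniform convergence on compact sets. Every later topological argument goes
  through these two lemmas.
\<close>

lemma holo_topology_nhd_exists:
  assumes "open U" "f \<in> holo U" "compact K" "K \<subseteq> U" "0 < e"
  obtains W where "openin (holo_topology U) W" "f \<in> W"
    "\<forall>g\<in>W. \<forall>z\<in>K. norm (g z - f z) < e"
proof -
  obtain \<B> :: "complex set set" where \<B>: "topological_basis \<B>"
    using ex_countable_basis by blast
  have "continuous_on U f"
    using assms(2) by (simp add: holo_def holomorphic_on_imp_continuous_on)
  then obtain F where
    F: "finite F" "F \<subseteq> \<B> \<times> \<B>"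
    "\<forall>(A, B)\<in>F. compact (closure A) \<and> closure A \<subseteq> U \<and> f ` closure A \<subseteq> B"
    "\<forall>g. (\<forall>(A, B)\<in>F. g ` closure A \<subseteq> B) \<longrightarrow> (\<forall>z\<in>K. norm (g z - f z) < e)"
    by (rule basic_sets_cover[OF \<B> assms(1) _ assms(3-5)])
  show thesis
  proof (rule that)
    show "openin (holo_topology U) {g\<in>holo U. \<forall>(A, B)\<in>F. g ` closure A \<subseteq> B}"
      using F(2,3) topological_basis_open[OF \<B>] by (intro openin_holo_tube F(1)) blast
    show "f \<in> {g\<in>holo U. \<forall>(A, B)\<in>F. g ` closure A \<subseteq> B}"
      using F(3) assms(2) by blast
  qed (use F(4) in blast)
qed

lemma holo_topology_nhd_contains:
  assumes "open U" "openin (holo_topology U) W" "f \<in> W"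
  obtains K e where "compact K" "K \<subseteq> U" "0 < (e::real)"
    "\<forall>g\<in>holo U. (\<forall>z\<in>K. norm (g z - f z) < e) \<longrightarrow> g \<in> W"
proof -
  let ?B = "{{f::complex \<Rightarrow> complex. f ` K \<subseteq> V} |K V. compact K \<and> K \<subseteq> U \<and> open V}"
  obtain W' where W': "openin (topology_generated_by ?B) W'" "W = W' \<inter> holo U"
    using assms(2) unfolding holo_topology_def openin_subtopology by blast
  have fW: "f \<in> W'" and fU: "f \<in> holo U" using assms(3) W'(2) by auto
  have "\<exists>K e. compact K \<and> K \<subseteq> U \<and> 0 < (e::real) \<and>
      (\<forall>g\<in>holo U. (\<forall>z\<in>K. norm (g z - f z) < e) \<longrightarrow> g \<in> V)"
    if "generate_topology_on ?B V" "f \<in> V" for V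
    using that
  proof induction
    case Empty then show ?case by simp
  next
    case (Int a b)
    have "f \<in> a" "f \<in> b" using Int.prems by auto
    from Int.IH(1)[OF this(1)] Int.IH(2)[OF this(2)] obtain K e K' e' where
      "compact K" "K \<subseteq> U" "0 < (e::real)" "\<forall>g\<in>holo U. (\<forall>z\<in>K. norm (g z - f z) < e) \<longrightarrow> g \<in> a"
      "compact K'" "K' \<subseteq> U" "0 < (e'::real)" "\<forall>g\<in>holo U. (\<forall>z\<in>K'. norm (g z - f z) < e') \<longrightarrow> g \<in> b"
      by blast
    then show ?case
      by (intro exI[of _ "K \<union> K'"] exI[of _ "min e e'"]) (auto intro: compact_Un)
  next
    case (UN \<K>)
    then obtain k where k: "k \<in> \<K>" "f \<in> k" by blast
    from UN.IH[OF this] show ?case using k(1) by blast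
  next
    case (Basis s)
    then obtain K V where s: "s = {f. f ` K \<subseteq> V}" "compact K" "K \<subseteq> U" "open V" by blast
    have "f holomorphic_on U" using fU by (simp add: holo_def)
    then have "continuous_on K f"
      using s(3) by (meson holomorphic_on_imp_continuous_on holomorphic_on_subset)
    then have cK: "compact (f ` K)" using s(2) compact_continuous_image by blast
    have "f ` K \<subseteq> V" using Basis.prems unfolding s(1) by simp
    then have "f ` K \<inter> - V = {}" by blast
    moreover have "closed (- V)" using s(4) by (simp add: closed_Compl)
    ultimately obtain e where e: "e > 0" "\<forall>x\<in>f ` K. \<forall>y\<in>- V. e \<le> dist x y"
      using separate_compact_closed[OF cK] by metis
    have "g \<in> s" if "\<forall>z\<in>K. norm (g z - f z) < e" for g
    proof -
      have "g z \<in> V" if "z \<in> K" for z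
      proof (rule ccontr)
        assume "g z \<notin> V"
        then have "e \<le> dist (f z) (g z)" using e(2) that by blast
        moreover have "norm (g z - f z) < e"
          using \<open>\<forall>z\<in>K. norm (g z - f z) < e\<close> that by blast
        ultimately show False by (simp add: dist_norm norm_minus_commute)
      qed
      then show ?thesis using s(1) by blast
    qed
    then show ?case using s e(1) by blast
  qed
  from this[of W'] fW W'(1) obtain K e where
    "compact K" "K \<subseteq> U" "0 < (e::real)" "\<forall>g\<in>holo U. (\<forall>z\<in>K. norm (g z - f z) < e) \<longrightarrow> g \<in> W'"
    unfolding openin_topology_generated_by_iff by blast
  then show thesis using that W'(2) by blast
qed

lemma holo_dense_iff:
  assumes "open U" "S \<subseteq> holo U"
  shows "holo_topology U closure_of S = holo U \<longleftrightarrow>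
    (\<forall>g\<in>holo U. \<forall>K e. compact K \<and> K \<subseteq> U \<and> 0 < (e::real) \<longrightarrow> (\<exists>s\<in>S. \<forall>z\<in>K. norm (s z - g z) < e))"
proof
  assume L: "holo_topology U closure_of S = holo U"
  show "\<forall>g\<in>holo U. \<forall>K e. compact K \<and> K \<subseteq> U \<and> 0 < (e::real) \<longrightarrow> (\<exists>s\<in>S. \<forall>z\<in>K. norm (s z - g z) < e)"
  proof (intro ballI allI impI, elim conjE)
    fix g K and e :: real
    assume g: "g \<in> holo U" and K: "compact K" "K \<subseteq> U" "0 < e"
    obtain W where
      W: "openin (holo_topology U) W" "g \<in> W" "\<forall>h\<in>W. \<forall>z\<in>K. norm (h z - g z) < e"
      by (rule holo_topology_nhd_exists[OF assms(1) g K])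
    have "g \<in> holo_topology U closure_of S" using L g by simp
    then obtain s where "s \<in> S" "s \<in> W" using W(1,2) unfolding in_closure_of by blast
    then show "\<exists>s\<in>S. \<forall>z\<in>K. norm (s z - g z) < e" using W(3) by blast
  qed
next
  assume R: "\<forall>g\<in>holo U. \<forall>K e. compact K \<and> K \<subseteq> U \<and> 0 < (e::real) \<longrightarrow> (\<exists>s\<in>S. \<forall>z\<in>K. norm (s z - g z) < e)"
  have "g \<in> holo_topology U closure_of S" if g: "g \<in> holo U" for g
    unfolding in_closure_of
  proof (intro conjI allI impI)
    show "g \<in> topspace (holo_topology U)" using g by simp
    fix W assume "g \<in> W \<and> openin (holo_topology U) W"
    then have W: "openin (holo_topology U) W" "g \<in> W" by auto
    obtain K e where K: "compact K" "K \<subseteq> U" "0 < (e::real)"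
      "\<forall>h\<in>holo U. (\<forall>z\<in>K. norm (h z - g z) < e) \<longrightarrow> h \<in> W"
      by (rule holo_topology_nhd_contains[OF assms(1) W])
    then obtain s where "s \<in> S" "\<forall>z\<in>K. norm (s z - g z) < e" using R g by blast
    then show "\<exists>y. y \<in> S \<and> y \<in> W" using K(4) assms(2) by blast
  qed
  then show "holo_topology U closure_of S = holo U"
    using closure_of_subset_topspace[of "holo_topology U" S] by auto
qed

lemma limitin_holo_topology:
  assumes "open U" "\<And>n. s n \<in> holo U"
  shows "limitin (holo_topology U) s f sequentially \<longleftrightarrow>
    f \<in> holo U \<and> (\<forall>K. compact K \<and> K \<subseteq> U \<longrightarrow> uniform_limit K s f sequentially)"
proof
  assume L: "limitin (holo_topology U) s f sequentially"
  then have f: "f \<in> holo U" using limitin_topspace[OF L] by simp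
  show "f \<in> holo U \<and> (\<forall>K. compact K \<and> K \<subseteq> U \<longrightarrow> uniform_limit K s f sequentially)"
  proof (intro conjI f allI impI, elim conjE)
    fix K assume K: "compact K" "K \<subseteq> U"
    show "uniform_limit K s f sequentially"
    proof (rule uniform_limitI)
      fix e :: real assume e: "0 < e"
      obtain W where
        W: "openin (holo_topology U) W" "f \<in> W" "\<forall>h\<in>W. \<forall>z\<in>K. norm (h z - f z) < e"
        by (rule holo_topology_nhd_exists[OF assms(1) f K e])
      have "\<forall>\<^sub>F n in sequentially. s n \<in> W" using L W(1,2) unfolding limitin_def by simp
      then show "\<forall>\<^sub>F n in sequentially. \<forall>x\<in>K. dist (s n x) (f x) < e"
        by eventually_elim (simp add: W(3) dist_norm)
    qed
  qed
next
  assume R: "f \<in> holo U \<and> (\<forall>K. compact K \<and> K \<subseteq> U \<longrightarrow> uniform_limit K s f sequentially)"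
  show "limitin (holo_topology U) s f sequentially"
    unfolding limitin_def
  proof (intro conjI allI impI)
    show "f \<in> topspace (holo_topology U)" using R by simp
    fix W assume "openin (holo_topology U) W \<and> f \<in> W"
    then have W: "openin (holo_topology U) W" "f \<in> W" by auto
    obtain K e where K: "compact K" "K \<subseteq> U" "0 < (e::real)"
      "\<forall>h\<in>holo U. (\<forall>z\<in>K. norm (h z - f z) < e) \<longrightarrow> h \<in> W"
      by (rule holo_topology_nhd_contains[OF assms(1) W])
    have "uniform_limit K s f sequentially" using R K(1,2) by simp
    then have "\<forall>\<^sub>F n in sequentially. \<forall>x\<in>K. dist (s n x) (f x) < e"
      using K(3) by (rule uniform_limitD)
    then show "\<forall>\<^sub>F n in sequentially. s n \<in> W"
    proof eventually_elim
      case (elim n)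
      then show ?case using K(4) assms(2) by (simp add: dist_norm)
    qed
  qed
qed

text \<open>
  The space of holomorphic functions is separable and metrizable, so each of its dense subsets has
  a countable dense subset. Here this follows by choosing one element of \<open>S\<close> in each of countably
  many basic open sets that meet \<open>S\<close>.
\<close>

lemma holo_dense_countable_subset:
  assumes "open U" "S \<subseteq> holo U" "holo_topology U closure_of S = holo U"
  obtains D where "countable D" "D \<subseteq> S" "holo_topology U closure_of D = holo U"
proof -
  obtain \<B> :: "complex set set" where \<B>: "countable \<B>" "topological_basis \<B>"
    using ex_countable_basis by blast
  define N where "N F = {g. \<forall>(A, B)\<in>F. g ` closure A \<subseteq> B}" for F :: "(complex set \<times> complex set) set"
  define \<F> where "\<F> = {F. finite F \<and> F \<subseteq> \<B> \<times> \<B>}"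
  have c: "countable \<F>"
    unfolding \<F>_def by (rule countable_Collect_finite_subset) (simp add: \<B>(1))
  define D where "D = (\<lambda>F. SOME s. s \<in> S \<inter> N F) ` {F\<in>\<F>. S \<inter> N F \<noteq> {}}"
  have pick: "(SOME s. s \<in> S \<inter> N F) \<in> S \<inter> N F" if "S \<inter> N F \<noteq> {}" for F
    unfolding some_in_eq by (rule that)
  show thesis
  proof (rule that)
    show "countable D" unfolding D_def using c by (intro countable_image) auto
    show DS: "D \<subseteq> S" unfolding D_def
    proof (rule image_subsetI)
      fix F assume "F \<in> {F\<in>\<F>. S \<inter> N F \<noteq> {}}"
      then have "S \<inter> N F \<noteq> {}" by simp
      from pick[OF this] show "(SOME s. s \<in> S \<inter> N F) \<in> S" by (rule IntD1)
    qed
    show "holo_topology U closure_of D = holo U"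
      unfolding holo_dense_iff[OF assms(1) order_trans[OF DS assms(2)]]
    proof (intro ballI allI impI, elim conjE)
      fix g K and e :: real
      assume g: "g \<in> holo U" and K: "compact K" "K \<subseteq> U" "0 < e"
      have "continuous_on U g" using g by (simp add: holo_def holomorphic_on_imp_continuous_on)
      then obtain F where
        F: "finite F" "F \<subseteq> \<B> \<times> \<B>"
        "\<forall>(A, B)\<in>F. compact (closure A) \<and> closure A \<subseteq> U \<and> g ` closure A \<subseteq> B"
        "\<forall>h. (\<forall>(A, B)\<in>F. h ` closure A \<subseteq> B) \<longrightarrow> (\<forall>z\<in>K. norm (h z - g z) < e)"
        by (rule basic_sets_cover[OF \<B>(2) assms(1) _ K])
      define W where "W = {g\<in>holo U. \<forall>(A, B)\<in>F. g ` closure A \<subseteq> B}"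
      have W: "openin (holo_topology U) W"
        unfolding W_def
        using F(2,3) topological_basis_open[OF \<B>(2)] by (intro openin_holo_tube F(1)) blast
      have gW: "g \<in> W" unfolding W_def using F(3) g by blast
      have "g \<in> holo_topology U closure_of S" using g assms(3) by simp
      then have "\<forall>W. g \<in> W \<and> openin (holo_topology U) W \<longrightarrow> (\<exists>h. h \<in> S \<and> h \<in> W)"
        unfolding in_closure_of by simp
      then obtain h where "h \<in> S" "h \<in> W" using W gW by blast
      then have "S \<inter> N F \<noteq> {}" unfolding N_def W_def by blast
      with F(1,2) have "(SOME s. s \<in> S \<inter> N F) \<in> D" unfolding D_def \<F>_def by (intro imageI) simp
      moreover have "(SOME s. s \<in> S \<inter> N F) \<in> N F" using pick[OF \<open>S \<inter> N F \<noteq> {}\<close>] by (rule IntD2)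
      then have "\<forall>z\<in>K. norm ((SOME s. s \<in> S \<inter> N F) z - g z) < e"
        using F(4) unfolding N_def mem_Collect_eq by (elim allE impE) assumption
      ultimately show "\<exists>s\<in>D. \<forall>z\<in>K. norm (s z - g z) < e" by (intro bexI[of _ "SOME s. s \<in> S \<inter> N F"])
    qed
  qed
qed

lemma continuous_map_weighted_comp_between:
  assumes "open U" "open V" "u holomorphic_on V" "\<phi> holomorphic_on V" "\<phi> ` V \<subseteq> U"
  shows "continuous_map (holo_topology U) (holo_topology V) (weighted_comp V u \<phi>)"
proof -
  have maps: "weighted_comp V u \<phi> f \<in> holo V" if "f \<in> holo U" for f
  proof -
    have "(f \<circ> \<phi>) holomorphic_on V"
      using that by (intro holomorphic_on_compose_gen[OF assms(4) _ assms(5)]) (simp add: holo_def)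
    then have "(\<lambda>z. u z * f (\<phi> z)) holomorphic_on V"
      using assms(3) by (auto intro: holomorphic_on_mult simp: o_def)
    then have "weighted_comp V u \<phi> f holomorphic_on V"
      by (rule holomorphic_transform) (simp add: weighted_comp_def)
    then show ?thesis by (simp add: holo_def weighted_comp_def)
  qed
  show ?thesis
    unfolding continuous_map_def
  proof (intro conjI allI impI)
    show "weighted_comp V u \<phi> \<in> topspace (holo_topology U) \<rightarrow> topspace (holo_topology V)"
      using maps by auto
    fix W assume W: "openin (holo_topology V) W"
    show "openin (holo_topology U) {f \<in> topspace (holo_topology U). weighted_comp V u \<phi> f \<in> W}"
    proof (subst openin_subopen, intro ballI)
      fix f assume "f \<in> {f \<in> topspace (holo_topology U). weighted_comp V u \<phi> f \<in> W}"
      then have f: "f \<in> holo U" "weighted_comp V u \<phi> f \<in> W" by auto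
      obtain K e where K: "compact K" "K \<subseteq> V" "0 < (e::real)"
        "\<forall>h\<in>holo V. (\<forall>z\<in>K. norm (h z - weighted_comp V u \<phi> f z) < e) \<longrightarrow> h \<in> W"
        by (rule holo_topology_nhd_contains[OF assms(2) W f(2)])
      have "continuous_on K u" "continuous_on K \<phi>"
        using continuous_on_subset[OF holomorphic_on_imp_continuous_on[OF assms(3)] K(2)]
          continuous_on_subset[OF holomorphic_on_imp_continuous_on[OF assms(4)] K(2)] by auto
      then have cu: "compact (u ` K)" and c\<phi>: "compact (\<phi> ` K)"
        using K(1) compact_continuous_image by auto
      obtain M where M: "M > 0" "\<And>z. z \<in> K \<Longrightarrow> norm (u z) \<le> M"
        using cu compact_imp_bounded bounded_pos by (metis image_eqI)
      have \<phi>K: "\<phi> ` K \<subseteq> U" using K(2) assms(5) by blast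
      have eM: "0 < e / M" using M(1) K(3) by simp
      obtain W' where
        W': "openin (holo_topology U) W'" "f \<in> W'"
          "\<forall>g\<in>W'. \<forall>z\<in>\<phi> ` K. norm (g z - f z) < e / M"
        by (rule holo_topology_nhd_exists[OF assms(1) f(1) c\<phi> \<phi>K eM])
      have "weighted_comp V u \<phi> g \<in> W" if g: "g \<in> W'" for g
      proof (rule K(4)[rule_format])
        have "g \<in> holo U" using openin_subset[OF W'(1)] g by auto
        then show "weighted_comp V u \<phi> g \<in> holo V" by (rule maps)
        fix z assume z: "z \<in> K"
          have "norm (u z) * norm (g (\<phi> z) - f (\<phi> z)) \<le> M * norm (g (\<phi> z) - f (\<phi> z))"
            using M(2) z by (intro mult_right_mono) auto
          also have "\<dots> < e"
            using W'(3) g z M(1) by (simp add: field_simps)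
          finally show "norm (weighted_comp V u \<phi> g z - weighted_comp V u \<phi> f z) < e"
            using z K(2) by (auto simp: weighted_comp_def norm_mult[symmetric] right_diff_distrib)
      qed
      moreover have "W' \<subseteq> holo U" using openin_subset[OF W'(1)] by simp
      ultimately show "\<exists>T. openin (holo_topology U) T \<and> f \<in> T \<and>
          T \<subseteq> {f \<in> topspace (holo_topology U). weighted_comp V u \<phi> f \<in> W}"
        using W'(1,2) by (intro exI[of _ W']) auto
    qed
  qed
qed

section \<open>Series of holomorphic functions and iterates of the operator\<close>

lemma sum_fun_at: "(\<Sum>i\<in>A. x i) z = (\<Sum>i\<in>A. x i z)"
  for x :: "'i \<Rightarrow> 'a \<Rightarrow> 'b::comm_monoid_add"
  by (induction A rule: infinite_finite_induct) simp_all

lemma holo_sum: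
  assumes "\<And>i. i \<in> A \<Longrightarrow> x i \<in> holo U"
  shows "(\<Sum>i\<in>A. x i) \<in> holo U"
proof -
  have "(\<Sum>i\<in>A. x i) = (\<lambda>z. \<Sum>i\<in>A. x i z)" by (rule ext) (rule sum_fun_at)
  moreover have "(\<lambda>z. \<Sum>i\<in>A. x i z) holomorphic_on U"
    using assms by (intro holomorphic_on_sum) (simp add: holo_def)
  moreover have "(\<Sum>i\<in>A. x i z) = 0" if "z \<notin> U" for z
    using assms that by (intro sum.neutral) (simp add: holo_def)
  ultimately show ?thesis by (simp add: holo_def)
qed

lemma funpow_weighted_comp_holo:
  assumes "\<omega> holomorphic_on U" "\<psi> \<in> holo_Aut U" "f \<in> holo U"
  shows "(weighted_comp U \<omega> \<psi> ^^ n) f \<in> holo U"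
  by (induction n) (use assms weighted_comp_holo in auto)

text \<open>
  Weighted composition acts on pointwise sums termwise, so applying iterates of the operator to an
  infinite series requires no continuity argument.
\<close>

lemma funpow_weighted_comp_sums:
  assumes "\<psi> ` U \<subseteq> U" "\<And>z. z \<in> U \<Longrightarrow> (\<lambda>i. x i z) sums f z"
  shows "z \<in> U \<Longrightarrow> (\<lambda>i. (weighted_comp U \<omega> \<psi> ^^ n) (x i) z) sums (weighted_comp U \<omega> \<psi> ^^ n) f z"
proof (induction n arbitrary: z)
  case (Suc n)
  have "\<psi> z \<in> U" using Suc.prems assms(1) by blast
  from sums_mult[OF Suc.IH[OF this], of "\<omega> z"] Suc.prems show ?case
    by (simp add: weighted_comp_def)
qed (use assms in auto)

text \<open>
  The majorant is only required eventually, because for a series built along an exhaustion of \<open>U\<close>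
  the bounds on a given compact set start at an index that depends on the set.
\<close>

lemma holo_series:
  assumes "open U" "\<And>n. x n \<in> holo U"
    and M: "\<And>K. compact K \<Longrightarrow> K \<subseteq> U \<Longrightarrow>
      \<exists>M. summable M \<and> (\<forall>\<^sub>F n in sequentially. \<forall>z\<in>K. norm (x n z) \<le> M n)"
  shows "(\<lambda>z. \<Sum>n. x n z) \<in> holo U"
    and "compact K \<Longrightarrow> K \<subseteq> U \<Longrightarrow>
      uniform_limit K (\<lambda>N z. \<Sum>n<N. x n z) (\<lambda>z. \<Sum>n. x n z) sequentially"
    and "z \<in> U \<Longrightarrow> (\<lambda>n. x n z) sums (\<Sum>n. x n z)"
proof -
  show ul: "uniform_limit K (\<lambda>N z. \<Sum>n<N. x n z) (\<lambda>z. \<Sum>n. x n z) sequentially"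
    if K: "compact K" "K \<subseteq> U" for K
  proof -
    obtain M where "summable M" "\<forall>\<^sub>F n in sequentially. \<forall>z\<in>K. norm (x n z) \<le> M n"
      using M[OF K] by auto
    then show ?thesis by (intro Weierstrass_m_test_ev)
  qed
  have "(\<lambda>z. \<Sum>n. x n z) holomorphic_on U"
  proof (rule holomorphic_uniform_sequence[OF assms(1)])
    show "(\<lambda>z. \<Sum>n<N. x n z) holomorphic_on U" for N
      using assms(2) by (intro holomorphic_on_sum) (simp add: holo_def)
    fix z assume "z \<in> U"
    then obtain d where d: "d > 0" "cball z d \<subseteq> U"
      using assms(1) open_contains_cball by blast
    then show "\<exists>d>0. cball z d \<subseteq> U \<and>
        uniform_limit (cball z d) (\<lambda>N z. \<Sum>n<N. x n z) (\<lambda>z. \<Sum>n. x n z) sequentially"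
      using ul[OF compact_cball d(2)] by auto
  qed
  then show "(\<lambda>z. \<Sum>n. x n z) \<in> holo U"
    using assms(2) by (simp add: holo_def)
  show "(\<lambda>n. x n z) sums (\<Sum>n. x n z)" if "z \<in> U"
    unfolding sums_def by (rule tendsto_uniform_limitI[OF ul[of "{z}"]]) (use that in auto)
qed

text \<open>
  A summable majorant stays summable under every rearrangement.
\<close>

lemma holo_unconditionally_convergent:
  assumes "open U" "\<And>n. x n \<in> holo U"
    and M: "\<And>K. compact K \<Longrightarrow> K \<subseteq> U \<Longrightarrow> \<exists>M. summable M \<and> (\<forall>n. \<forall>z\<in>K. norm (x n z) \<le> M n)"
  shows "unconditionally_convergent_in (holo_topology U) x"
  unfolding unconditionally_convergent_in_def
proof (intro allI impI)
  fix p :: "nat \<Rightarrow> nat" assume p: "bij p"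
  have Mp: "\<exists>M. summable M \<and> (\<forall>\<^sub>F n in sequentially. \<forall>z\<in>K. norm (x (p n) z) \<le> M n)"
    if K: "compact K" "K \<subseteq> U" for K
  proof -
    obtain M where M: "summable M" "\<forall>n. \<forall>z\<in>K. norm (x n z) \<le> M n"
      using assms(3)[OF K] by auto
    show ?thesis
    proof (cases "K = {}")
      case True
      then show ?thesis by (intro exI[of _ "\<lambda>_. 0"]) simp
    next
      case False
      then obtain w where "w \<in> K" by blast
      then have "0 \<le> M n" for n
        using M(2) norm_ge_zero order_trans by blast
      then have "summable (M \<circ> p)"
        using M(1) bij_is_inj[OF p] by (intro summable_reindex)
      then show ?thesis using M(2) by (intro exI[of _ "M \<circ> p"]) simp
    qed
  qed
  note series = holo_series[of U "\<lambda>n. x (p n)", OF assms(1,2) Mp]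
  have "limitin (holo_topology U) (\<lambda>N. \<Sum>n<N. x (p n)) (\<lambda>z. \<Sum>n. x (p n) z) sequentially"
    unfolding limitin_holo_topology[OF assms(1) holo_sum[OF assms(2)]] sum_fun_at
    using series(1,2) by blast
  then show "\<exists>s. limitin (holo_topology U) (\<lambda>N. \<Sum>n<N. x (p n)) s sequentially" by blast
qed

text \<open>
  The only consequence of unconditional convergence that hypercyclicity requires: the terms of a
  convergent series tend to zero.
\<close>

lemma unconditionally_convergent_in_holo_tendsto_0:
  assumes "open U" "\<And>n. x n \<in> holo U" "unconditionally_convergent_in (holo_topology U) x"
    and "compact K" "K \<subseteq> U"
  shows "uniform_limit K x (\<lambda>_. 0) sequentially"
proof -
  have "bij (id::nat \<Rightarrow> nat)" by (rule bij_id)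
  then obtain s where "limitin (holo_topology U) (\<lambda>N. \<Sum>n<N. x (id n)) s sequentially"
    using assms(3) unfolding unconditionally_convergent_in_def by blast
  then have "limitin (holo_topology U) (\<lambda>N. \<Sum>n<N. x n) s sequentially" by simp
  then have ul: "uniform_limit K (\<lambda>N. \<Sum>n<N. x n) s sequentially"
    using limitin_holo_topology[OF assms(1), of "\<lambda>N. \<Sum>n<N. x n" s, OF holo_sum[OF assms(2)]] assms(4,5)
    by blast
  then have "uniform_limit K (\<lambda>N. \<Sum>n<Suc N. x n) s sequentially"
    using filterlim_compose[OF ul filterlim_Suc] by simp
  from uniform_limit_minus[OF this ul] show ?thesis by simp
qed

lemma supercyclic_holo_iff:
  assumes "open U" "\<And>f. f \<in> holo U \<Longrightarrow> T f \<in> holo U"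
  shows "supercyclic (holo_topology U) fscale T \<longleftrightarrow>
    (\<exists>f\<in>holo U. \<forall>g\<in>holo U. \<forall>K e. compact K \<and> K \<subseteq> U \<and> 0 < (e::real) \<longrightarrow>
      (\<exists>c n. \<forall>z\<in>K. norm (c * (T ^^ n) f z - g z) < e))"
proof -
  have "holo_topology U closure_of {fscale c ((T ^^ n) f) |c n. True} = holo U \<longleftrightarrow>
      (\<forall>g\<in>holo U. \<forall>K e. compact K \<and> K \<subseteq> U \<and> 0 < (e::real) \<longrightarrow>
      (\<exists>c n. \<forall>z\<in>K. norm (c * (T ^^ n) f z - g z) < e))" if f: "f \<in> holo U" for f
  proof -
    have "(T ^^ n) f \<in> holo U" for n
      by (induction n) (use f assms(2) in auto)
    then have "fscale c ((T ^^ n) f) \<in> holo U" for c n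
      by (simp add: holo_def fscale_def holomorphic_on_mult holomorphic_on_const)
    then have sub: "{fscale c ((T ^^ n) f) |c n. True} \<subseteq> holo U" by blast
    have ex: "(\<exists>s\<in>{fscale c ((T ^^ n) f) |c n. True}. P s) \<longleftrightarrow> (\<exists>c n. P (\<lambda>z. c * (T ^^ n) f z))" for P
      unfolding fscale_def by blast
    show ?thesis unfolding holo_dense_iff[OF assms(1) sub] ex ..
  qed
  then show ?thesis unfolding supercyclic_def by simp
qed

text \<open>
  The vector is written down directly as \<open>f = (\<Sum>j. S ^^ n j (y j))\<close>, where \<open>y\<close> runs through a countable
  dense subset of \<open>X\<^sub>0\<close>, each element being repeated infinitely often, and the exponents \<open>n j\<close> increase
  fast. Applying \<open>T ^^ n j\<close> turns the \<open>j\<close>-th summand into \<open>y j\<close>, the earlier ones into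
  \<open>T ^^ (n j - n i) (y i)\<close> and the later ones into \<open>S ^^ (n i - n j) (y i)\<close>; both kinds are small
  because the terms of the two series of the criterion tend to zero. So \<open>T ^^ n j f\<close> is close to \<open>y j\<close>,
  and already the orbit of \<open>f\<close>, without scalar multiples, is dense.
\<close>

section \<open>The Frequent Hypercyclicity Criterion implies supercyclicity\<close>

lemma frequent_hypercyclicity_criterion_imp_supercyclic:
  assumes "open U" "\<omega> holomorphic_on U" "\<psi> \<in> holo_Aut U"
    and "frequent_hypercyclicity_criterion (holo_topology U) (weighted_comp U \<omega> \<psi>)"
  shows "supercyclic (holo_topology U) fscale (weighted_comp U \<omega> \<psi>)"
proof -
  define T where "T = weighted_comp U \<omega> \<psi>"
  obtain X\<^sub>0 S where X0: "X\<^sub>0 \<subseteq> holo U" "holo_topology U closure_of X\<^sub>0 = holo U" "S \<in> X\<^sub>0 \<rightarrow> X\<^sub>0"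
    and all: "\<forall>f\<in>X\<^sub>0. unconditionally_convergent_in (holo_topology U) (\<lambda>n. (T ^^ Suc n) f) \<and>
      unconditionally_convergent_in (holo_topology U) (\<lambda>n. (S ^^ Suc n) f) \<and> T (S f) = f"
    using assms(4) unfolding frequent_hypercyclicity_criterion_def T_def[symmetric] topspace_holo_topology
    by (elim exE conjE) (rule that)
  have crit: "unconditionally_convergent_in (holo_topology U) (\<lambda>n. (T ^^ Suc n) f)"
      "unconditionally_convergent_in (holo_topology U) (\<lambda>n. (S ^^ Suc n) f)"
      "T (S f) = f" if "f \<in> X\<^sub>0" for f
    using all that by auto
  have Sn: "(S ^^ n) f \<in> X\<^sub>0" if "f \<in> X\<^sub>0" for f n
    by (induction n) (use that X0(3) in auto)
  have Tn: "(T ^^ n) f \<in> holo U" if "f \<in> holo U" for f n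
    unfolding T_def by (rule funpow_weighted_comp_holo[OF assms(2,3) that])
  have TS: "(T ^^ n) ((S ^^ n) f) = f" if f: "f \<in> X\<^sub>0" for n f
  proof (induction n)
    case (Suc n)
    have "(T ^^ Suc n) ((S ^^ Suc n) f) = (T ^^ n) (T (S ((S ^^ n) f)))"
      by (simp add: funpow_swap1)
    then show ?case using crit(3)[OF Sn[OF f]] Suc.IH by simp
  qed simp
  have small: "\<forall>\<^sub>F r in sequentially. \<forall>z\<in>K. norm ((T ^^ (r - m)) f z) < e"
    "\<forall>\<^sub>F r in sequentially. \<forall>z\<in>K. norm ((S ^^ (r - m)) f z) < e"
    if f: "f \<in> X\<^sub>0" and K: "compact K" "K \<subseteq> U" and e: "0 < e" for f K m and e :: real
  proof -
    have "uniform_limit K (\<lambda>n. (T ^^ Suc n) f) (\<lambda>_. 0) sequentially"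
      using f X0(1) by (intro unconditionally_convergent_in_holo_tendsto_0[OF assms(1) Tn crit(1) K]) auto
    then have "uniform_limit K (\<lambda>n. (T ^^ n) f) (\<lambda>_. 0) sequentially"
      by (rule filterlim_sequentially_Suc[THEN iffD1])
    from uniform_limitD[OF this e]
    have "\<forall>\<^sub>F n in sequentially. \<forall>z\<in>K. norm ((T ^^ n) f z) < e" by simp
    then show "\<forall>\<^sub>F r in sequentially. \<forall>z\<in>K. norm ((T ^^ (r - m)) f z) < e"
      by (rule eventually_compose_filterlim) (rule filterlim_minus_const_nat_at_top)
    have "uniform_limit K (\<lambda>n. (S ^^ Suc n) f) (\<lambda>_. 0) sequentially"
      using f X0(1) Sn
      by (intro unconditionally_convergent_in_holo_tendsto_0[OF assms(1) _ crit(2) K]) blast+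
    then have "uniform_limit K (\<lambda>n. (S ^^ n) f) (\<lambda>_. 0) sequentially"
      by (rule filterlim_sequentially_Suc[THEN iffD1])
    from uniform_limitD[OF this e]
    have "\<forall>\<^sub>F n in sequentially. \<forall>z\<in>K. norm ((S ^^ n) f z) < e" by simp
    then show "\<forall>\<^sub>F r in sequentially. \<forall>z\<in>K. norm ((S ^^ (r - m)) f z) < e"
      by (rule eventually_compose_filterlim) (rule filterlim_minus_const_nat_at_top)
  qed
  obtain D where D: "countable D" "D \<subseteq> X\<^sub>0" "holo_topology U closure_of D = holo U"
    by (rule holo_dense_countable_subset[OF assms(1) X0(1,2)])
  have dense: "\<exists>s\<in>D. \<forall>z\<in>K. norm (s z - g z) < e"
    if "g \<in> holo U" "compact K" "K \<subseteq> U" "0 < e" for g K and e :: real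
    using D(3)[unfolded holo_dense_iff[OF assms(1) order_trans[OF D(2) X0(1)]]] that by blast
  have "(\<lambda>_. 0) \<in> holo U" by (simp add: holo_def)
  from dense[OF this compact_empty] have "D \<noteq> {}" by (metis empty_iff empty_subsetI zero_less_one)
  \<comment> \<open>decoding pairs makes every element of D occur at arbitrarily large indices\<close>
  define y where "y j = from_nat_into D (fst (prod_decode j))" for j
  have y: "y j \<in> X\<^sub>0" for j
    using from_nat_into[OF \<open>D \<noteq> {}\<close>] D(2) by (auto simp: y_def)
  obtain C where C: "\<And>j. compact (C j)" "\<And>j. C j \<subseteq> U" "\<And>j. C j \<subseteq> interior (C (Suc j))"
      "\<Union> (range C) = U" "\<And>K. compact K \<Longrightarrow> K \<subseteq> U \<Longrightarrow> \<exists>N. \<forall>j\<ge>N. K \<subseteq> C j"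
    by (rule open_Union_compact_subsets[OF assms(1)], rule that) assumption+
  have Cmono: "C i \<subseteq> C j" if "i \<le> j" for i j
    using that by (rule lift_Suc_mono_le[rotated]) (use C(3) interior_subset in blast)
  \<comment> \<open>r is admissible as the j-th exponent after n 0, ..., n (j - 1); the clause with r - 0
    makes the series for f converge\<close>
  define P where "P n j r \<longleftrightarrow> (\<forall>z\<in>C j. norm ((S ^^ (r - 0)) (y j) z) < (1/2) ^ j) \<and>
      (\<forall>i<j. n i < r \<and> (\<forall>z\<in>C j. norm ((T ^^ (r - n i)) (y i) z) < (1/2) ^ j) \<and>
        (\<forall>z\<in>C j. norm ((S ^^ (r - n i)) (y j) z) < (1/2) ^ j))" for n :: "nat \<Rightarrow> nat" and j r
  have "\<exists>n. \<forall>j. P n j (n j)"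
  proof (rule dependent_wellorder_choice)
    show "P f x r = P g x r" if "\<And>y. y < x \<Longrightarrow> f y = g y" for r f g x
      unfolding P_def using that by simp
    fix j n
    have "\<forall>\<^sub>F r in sequentially. P n j r"
      unfolding P_def
    proof (intro eventually_conj)
      show "\<forall>\<^sub>F r in sequentially. \<forall>z\<in>C j. norm ((S ^^ (r - 0)) (y j) z) < (1/2) ^ j"
        by (rule small(2)[OF y C(1,2)]) simp
      have "\<forall>\<^sub>F r in sequentially. \<forall>i\<in>{..<j}. n i < r \<and> (\<forall>z\<in>C j. norm ((T ^^ (r - n i)) (y i) z) < (1/2) ^ j) \<and>
          (\<forall>z\<in>C j. norm ((S ^^ (r - n i)) (y j) z) < (1/2) ^ j)"
        by (intro eventually_ball_finite ballI eventually_conj small y C(1,2) eventually_gt_at_top) simp_all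
      then show "\<forall>\<^sub>F r in sequentially. \<forall>i<j. n i < r \<and> (\<forall>z\<in>C j. norm ((T ^^ (r - n i)) (y i) z) < (1/2) ^ j) \<and>
          (\<forall>z\<in>C j. norm ((S ^^ (r - n i)) (y j) z) < (1/2) ^ j)"
        by (rule eventually_mono) simp
    qed
    then show "\<exists>r. P n j r" by (rule eventually_happens'[OF sequentially_bot])
  qed
  then obtain n where n: "\<And>j. P n j (n j)" by blast
  have n1: "norm ((S ^^ n j) (y j) z) < (1/2) ^ j" if "z \<in> C j" for j z
    using n[of j] that by (simp add: P_def)
  have n2: "n i < n j" if "i < j" for i j
    using n[of j] that by (simp add: P_def)
  have n3: "norm ((T ^^ (n j - n i)) (y i) z) < (1/2) ^ j" if "i < j" "z \<in> C j" for i j z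
    using n[of j] that by (simp add: P_def)
  have n4: "norm ((S ^^ (n j - n i)) (y j) z) < (1/2) ^ j" if "i < j" "z \<in> C j" for i j z
    using n[of j] that by (simp add: P_def)
  define x where "x j = (S ^^ n j) (y j)" for j
  have xU: "x j \<in> holo U" for j using Sn[OF y] X0(1) by (auto simp: x_def)
  have half: "summable (\<lambda>j. (1/2) ^ j :: real)" by (rule summable_geometric) simp
  have M: "\<exists>M. summable M \<and> (\<forall>\<^sub>F j in sequentially. \<forall>z\<in>K. norm (x j z) \<le> M j)"
    if K: "compact K" "K \<subseteq> U" for K
  proof -
    obtain N where "\<forall>j\<ge>N. K \<subseteq> C j" using C(5)[OF K] by blast
    then have "norm (x j z) \<le> (1/2) ^ j" if "N \<le> j" "z \<in> K" for j z
      using n1[of z j] that unfolding x_def by force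
    then have "\<forall>\<^sub>F j in sequentially. \<forall>z\<in>K. norm (x j z) \<le> (1/2) ^ j"
      unfolding eventually_sequentially by blast
    then show ?thesis using half by blast
  qed
  define f where "f z = (\<Sum>j. x j z)" for z
  have fU: "f \<in> holo U" and f: "\<And>z. z \<in> U \<Longrightarrow> (\<lambda>j. x j z) sums f z"
    using holo_series(1,3)[OF assms(1) xU M] unfolding f_def by auto
  have close: "norm ((T ^^ n j) f z - y j z) \<le> (real j + 1) * (1/2) ^ j" if z: "z \<in> C j" for j z
  proof -
    define a where "a i = (T ^^ n j) (x i) z" for i
    have "z \<in> U" using z C(2) by blast
    moreover have "\<psi> ` U \<subseteq> U" using assms(3) by (auto simp: holo_Aut_def bij_betw_def)
    ultimately have "a sums (T ^^ n j) f z"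
      unfolding a_def T_def using f by (intro funpow_weighted_comp_sums)
    from sums_split_initial_segment[OF this, of "Suc j"]
    have tail: "(\<lambda>i. a (i + Suc j)) sums ((T ^^ n j) f z - (\<Sum>i<j. a i) - a j)"
      by (simp add: algebra_simps)
    have aj: "a j = y j z" unfolding a_def x_def by (simp add: TS y)
    have "norm (a i) \<le> (1/2) ^ j" if "i < j" for i
    proof -
      have "n j = (n j - n i) + n i" using n2[OF that] by simp
      then have "(T ^^ n j) (x i) = (T ^^ (n j - n i)) ((T ^^ n i) (x i))"
        by (metis funpow_add comp_apply)
      also have "\<dots> = (T ^^ (n j - n i)) (y i)" by (simp add: x_def TS y)
      finally show ?thesis using n3[OF that z] by (simp add: a_def)
    qed
    then have "norm (\<Sum>i<j. a i) \<le> real (card {..<j}) * (1/2) ^ j"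
      by (intro sum_norm_bound) simp
    then have head: "norm (\<Sum>i<j. a i) \<le> real j * (1/2) ^ j" by simp
    have a_tail: "norm (a (i + Suc j)) \<le> (1/2) ^ (i + Suc j)" for i
    proof -
      define k where "k = i + Suc j"
      have jk: "j < k" by (simp add: k_def)
      have "n k = n j + (n k - n j)" using n2[OF jk] by simp
      then have "x k = (S ^^ n j) ((S ^^ (n k - n j)) (y k))"
        unfolding x_def by (metis funpow_add comp_apply)
      then have "(T ^^ n j) (x k) = (S ^^ (n k - n j)) (y k)"
        using TS[OF Sn[OF y]] by simp
      moreover have "z \<in> C k" using Cmono[of j k] jk z by auto
      ultimately have "norm (a k) < (1/2) ^ k" unfolding a_def using n4[OF jk] by simp
      then show ?thesis by (simp add: k_def)
    qed
    have "(\<lambda>i. (1/2) ^ Suc j * (1/2) ^ i :: real) sums ((1/2) ^ Suc j * (1 / (1 - 1/2)))"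
      by (intro sums_mult geometric_sums) simp
    then have geo: "(\<lambda>i. (1/2) ^ (i + Suc j) :: real) sums ((1/2) ^ j)"
      by (simp add: power_add mult.commute)
    have "norm ((T ^^ n j) f z - (\<Sum>i<j. a i) - a j) \<le> (1/2) ^ j"
      using norm_sums_le[OF tail geo a_tail] .
    moreover have "norm ((T ^^ n j) f z - y j z)
        \<le> norm ((T ^^ n j) f z - (\<Sum>i<j. a i) - a j) + norm (\<Sum>i<j. a i)"
      using norm_triangle_ineq[of "(T ^^ n j) f z - (\<Sum>i<j. a i) - a j" "\<Sum>i<j. a i"]
      by (simp add: aj algebra_simps)
    ultimately show ?thesis using head by (simp add: algebra_simps)
  qed
  have "(\<lambda>j. (real j + 1) * (1/2) ^ j) \<longlonglongrightarrow> 0"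
    using tendsto_add[OF powser_times_n_limit_0[of "1/2::real"] LIMSEQ_power_zero[of "1/2::real"]]
    by (simp add: algebra_simps)
  show ?thesis
    unfolding T_def[symmetric]
  proof (subst supercyclic_holo_iff[OF assms(1)])
    show "T g \<in> holo U" if "g \<in> holo U" for g using Tn[OF that, of 1] by simp
    show "\<exists>f\<in>holo U. \<forall>g\<in>holo U. \<forall>K e. compact K \<and> K \<subseteq> U \<and> 0 < e \<longrightarrow>
        (\<exists>c n. \<forall>z\<in>K. norm (c * (T ^^ n) f z - g z) < e)"
    proof (intro bexI[OF _ fU] ballI allI impI, elim conjE)
      fix g K and e :: real
      assume g: "g \<in> holo U" and K: "compact K" "K \<subseteq> U" "0 < e"
      have "0 < e/2" using K(3) by simp
      with \<open>_ \<longlonglongrightarrow> 0\<close> have "\<forall>\<^sub>F j in sequentially. (real j + 1) * (1/2) ^ j < e/2"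
        by (rule order_tendstoD(2))
      then obtain N1 where N1: "\<And>j. j \<ge> N1 \<Longrightarrow> (real j + 1) * (1/2) ^ j < e/2"
        unfolding eventually_sequentially by blast
      obtain N2 where N2: "\<forall>j\<ge>N2. K \<subseteq> C j" using C(5)[OF K(1,2)] by blast
      obtain s where s: "s \<in> D" "\<forall>z\<in>K. norm (s z - g z) < e/2"
        using dense[OF g K(1,2) \<open>0 < e/2\<close>] by blast
      obtain a where a: "s = from_nat_into D a"
        using from_nat_into_surj[OF D(1) s(1)] by auto
      define j where "j = prod_encode (a, max N1 N2)"
      have "max N1 N2 \<le> j" unfolding j_def by (rule le_prod_encode_2)
      then have j: "N1 \<le> j" "N2 \<le> j" by auto
      have yj: "y j = s" by (simp add: y_def j_def a)
      have "norm (1 * (T ^^ n j) f z - g z) < e" if z: "z \<in> K" for z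
      proof -
        have "norm ((T ^^ n j) f z - s z) < e/2"
          using close[of z j] N1[OF j(1)] N2 j(2) z unfolding yj by force
        moreover have "norm (s z - g z) < e/2" using s(2) z by blast
        ultimately show ?thesis using norm_diff_triangle_less by fastforce
      qed
      then show "\<exists>c n. \<forall>z\<in>K. norm (c * (T ^^ n) f z - g z) < e" by blast
    qed
  qed
qed

section \<open>Two necessary conditions for supercyclicity\<close>

lemma weighted_comp_at: "z \<in> U \<Longrightarrow> weighted_comp U \<omega> \<psi> f z = \<omega> z * f (\<psi> z)"
  by (simp add: weighted_comp_def)

lemma supercyclic_vector_approximates:
  assumes "open U" "\<omega> holomorphic_on U" "\<psi> \<in> holo_Aut U"
    and super: "supercyclic (holo_topology U) fscale (weighted_comp U \<omega> \<psi>)"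
  shows "\<exists>f\<in>holo U. \<forall>g\<in>holo U. \<forall>K e. compact K \<and> K \<subseteq> U \<and> 0 < (e::real) \<longrightarrow>
      (\<exists>c n. \<forall>z\<in>K. norm (c * (weighted_comp U \<omega> \<psi> ^^ n) f z - g z) < e)"
  by (rule supercyclic_holo_iff[OF assms(1), THEN iffD1, OF _ super])
    (rule weighted_comp_holo[OF assms(2,3)])

text \<open>
  At a zero \<open>w\<close> of the weight all iterates but the zeroth vanish, so a target that is 1 at \<open>w\<close> can only
  be approximated by multiples of \<open>f\<close> itself. The ratio of the values at \<open>w\<close> and at a second point is
  the same for all these multiples, whereas the targets can prescribe it: 1 and 5 are incompatible.
\<close>

lemma supercyclic_weight_nonzero:
  assumes "open U" "\<omega> holomorphic_on U" "\<psi> \<in> holo_Aut U"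
    and super: "supercyclic (holo_topology U) fscale (weighted_comp U \<omega> \<psi>)"
    and w: "w \<in> U"
  shows "\<omega> w \<noteq> 0"
proof
  assume \<omega>0: "\<omega> w = 0"
  let ?T = "weighted_comp U \<omega> \<psi>"
  obtain f where f1: "f \<in> holo U" and f2: "\<forall>g\<in>holo U. \<forall>K e. compact K \<and> K \<subseteq> U \<and> 0 < (e::real) \<longrightarrow>
      (\<exists>c n. \<forall>z\<in>K. norm (c * (?T ^^ n) f z - g z) < e)"
    by (rule bexE[OF supercyclic_vector_approximates[OF assms(1,2,3) super]])
  obtain r where r: "r > 0" "cball w r \<subseteq> U" using assms(1) w open_contains_cball by blast
  define x where "x = w + of_real r"
  have x: "x \<in> U" "x \<noteq> w" using r by (auto simp: x_def dist_norm subset_iff)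
  have target: "\<exists>c. norm (c * f w - 1) < 1/3 \<and> norm (c * f x - b) < 1/3" for b
  proof -
    define g where "g z = (if z \<in> U then 1 + (b - 1) * ((z - w) / (x - w)) else 0)" for z
    have "(\<lambda>z. 1 + (b - 1) * ((z - w) / (x - w))) holomorphic_on U"
      using x(2) by (intro holomorphic_intros) auto
    then have "g holomorphic_on U" by (rule holomorphic_transform) (simp add: g_def)
    then have gU: "g \<in> holo U" by (simp add: holo_def g_def)
    have gwx: "g w = 1" "g x = b" using w x by (auto simp: g_def)
    have wx: "compact {w, x}" "{w, x} \<subseteq> U" using w x by auto
    have "\<exists>c n. \<forall>z\<in>{w, x}. norm (c * (?T ^^ n) f z - g z) < 1/3"
      using gU wx by (intro f2[rule_format]) simp_all
    then obtain c n where c: "norm (c * (?T ^^ n) f w - 1) < 1/3" "norm (c * (?T ^^ n) f x - b) < 1/3"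
      using gwx by auto
    have "n = 0"
    proof (cases n)
      case (Suc m)
      then have "(?T ^^ n) f w = 0" using \<omega>0 by (simp add: weighted_comp_def)
      then show ?thesis using c(1) by simp
    qed
    then show ?thesis using c by auto
  qed
  obtain c where c: "norm (c * f w - 1) < 1/3" "norm (c * f x - 1) < 1/3" using target by blast
  obtain d where d: "norm (d * f w - 1) < 1/3" "norm (d * f x - 5) < 1/3" using target by blast
  have c1: "norm (c * f w) > 2/3" "norm (c * f x) < 4/3"
    using c norm_triangle_ineq2[of 1 "c * f w"] norm_triangle_ineq2[of "c * f x" 1]
    by (simp_all add: norm_minus_commute)
  have d1: "norm (d * f w) < 4/3" "norm (d * f x) > 14/3"
    using d norm_triangle_ineq2[of "d * f w" 1] norm_triangle_ineq2[of 5 "d * f x"]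
    by (simp_all add: norm_minus_commute)
  have "norm (c * f w) * norm (d * f x) = norm (d * f w) * norm (c * f x)"
    by (simp add: norm_mult mult_ac)
  moreover have "norm (d * f w) * norm (c * f x) \<le> 4/3 * (4/3)"
    using c1 d1 by (intro mult_mono) auto
  moreover have "2/3 * (14/3) \<le> norm (c * f w) * norm (d * f x)"
    using c1 d1 by (intro mult_mono) auto
  ultimately show False by simp
qed

text \<open>
  The obstruction for rotations and inversions. The weight has no zeros, so the zeros of an iterate
  are preimages under an iterate of \<open>\<psi>\<close> of zeros of \<open>f\<close>, and therefore lie on the same level sets of
  \<open>\<rho>\<close> as zeros of \<open>f\<close>. By density, the iterates must have zeros near every point. So the levels of
  the zeros of \<open>f\<close> are dense in an interval whose preimage is compact, although \<open>f\<close> has only finitely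
  many zeros there.
\<close>

lemma not_supercyclic_if_invariant:
  assumes "open U" "connected U" "\<omega> holomorphic_on U" "\<psi> \<in> holo_Aut U"
    and \<rho>: "continuous_on U \<rho>" "\<And>z. z \<in> U \<Longrightarrow> \<rho> (\<psi> z) = \<rho> z"
    and st: "s < t" "compact {z\<in>U. s \<le> \<rho> z \<and> \<rho> z \<le> t}" "{s<..<t::real} \<subseteq> \<rho> ` U"
  shows "\<not> supercyclic (holo_topology U) fscale (weighted_comp U \<omega> \<psi>)"
proof
  assume super: "supercyclic (holo_topology U) fscale (weighted_comp U \<omega> \<psi>)"
  let ?T = "weighted_comp U \<omega> \<psi>"
  note \<omega>0 = supercyclic_weight_nonzero[OF assms(1,3,4) super]
  obtain f where f1: "f \<in> holo U" and f2: "\<forall>g\<in>holo U. \<forall>K e. compact K \<and> K \<subseteq> U \<and> 0 < (e::real) \<longrightarrow>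
      (\<exists>c n. \<forall>z\<in>K. norm (c * (?T ^^ n) f z - g z) < e)"
    by (rule bexE[OF supercyclic_vector_approximates[OF assms(1,3,4) super]])
  have zero: "\<exists>w\<in>U. f w = 0 \<and> \<rho> w = \<rho> z" if "z \<in> U" "(?T ^^ n) f z = 0" for n z
    using that
  proof (induction n arbitrary: z)
    case (Suc n)
    have \<psi>z: "\<psi> z \<in> U" using assms(4) Suc.prems(1) by (auto simp: holo_Aut_def bij_betw_def)
    have "(?T ^^ n) f (\<psi> z) = 0"
      using Suc.prems \<omega>0[OF Suc.prems(1)] by (simp add: weighted_comp_at)
    from Suc.IH[OF \<psi>z this] \<rho>(2)[OF Suc.prems(1)] show ?case by simp
  qed auto
  define L where "L = {z\<in>U. s \<le> \<rho> z \<and> \<rho> z \<le> t}"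
  \<comment> \<open>a multiple of an iterate that is close to z - a on a disc about a has a zero in the disc\<close>
  have hit: "\<exists>w\<in>U. f w = 0 \<and> \<rho> w \<in> {s'<..<t'}" if "s \<le> s'" "s' < t'" "t' \<le> t" for s' t'
  proof -
    have "(s' + t') / 2 \<in> {s<..<t}" using that by auto
    then obtain a where a: "a \<in> U" "\<rho> a = (s' + t') / 2" using st(3) by (metis imageE subsetD)
    have "open (U \<inter> \<rho> -` {s'<..<t'})"
      by (rule continuous_open_preimage[OF \<rho>(1) assms(1)]) simp
    moreover have "a \<in> U \<inter> \<rho> -` {s'<..<t'}" using a that by auto
    ultimately obtain r where r: "r > 0" "cball a r \<subseteq> U \<inter> \<rho> -` {s'<..<t'}"
      by (meson open_contains_cball)
    define g where "g z = (if z \<in> U then z - a else 0)" for z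
    have "(\<lambda>z. z - a) holomorphic_on U" by (intro holomorphic_intros)
    then have "g holomorphic_on U" by (rule holomorphic_transform) (simp add: g_def)
    then have gU: "g \<in> holo U" by (simp add: holo_def g_def)
    have "\<exists>c n. \<forall>z\<in>cball a r. norm (c * (?T ^^ n) f z - g z) < r/2"
      using r by (intro f2[rule_format] gU) auto
    then obtain c n where cn: "\<And>z. z \<in> cball a r \<Longrightarrow> norm (c * (?T ^^ n) f z - g z) < r/2"
      by blast
    define F where "F z = c * (?T ^^ n) f z" for z
    have "(?T ^^ n) f holomorphic_on U"
      using funpow_weighted_comp_holo[OF assms(3,4) f1] by (simp add: holo_def)
    then have "F holomorphic_on U" unfolding F_def by (intro holomorphic_intros)
    then have FU: "F holomorphic_on cball a r" using r(2) by (meson holomorphic_on_subset le_inf_iff)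
    have F: "norm (F z - (z - a)) < r/2" if "z \<in> cball a r" for z
      using cn[OF that] that r(2) by (auto simp: g_def F_def)
    obtain z where z: "z \<in> ball a r" "F z = 0"
    proof (rule holomorphic_contract_to_zero)
      show "continuous_on (cball a r) F" using FU by (rule holomorphic_on_imp_continuous_on)
      show "F holomorphic_on ball a r" using FU ball_subset_cball by (rule holomorphic_on_subset)
      fix z assume z: "norm (a - z) = r"
      have "norm (F a) < r/2" using F[of a] r(1) by simp
      moreover have "norm (F z - (z - a)) < r/2" using z by (intro F) (simp add: dist_norm)
      moreover have "norm (z - a) \<le> norm (F z - (z - a)) + norm (F z)"
        using norm_triangle_ineq4[of "F z" "F z - (z - a)"] by simp
      ultimately show "norm (F a) < norm (F z)" using z by (simp add: norm_minus_commute)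
    qed (use r in auto)
    have "z \<in> U \<inter> \<rho> -` {s'<..<t'}" using z(1) r(2) ball_subset_cball by blast
    then have zU: "z \<in> U" "\<rho> z \<in> {s'<..<t'}" by auto
    have "c \<noteq> 0"
    proof
      assume "c = 0"
      then have "norm (a + of_real r - a) < r/2"
        using F[of "a + of_real r"] r(1) by (simp add: F_def dist_norm)
      then show False using r(1) by simp
    qed
    then have "(?T ^^ n) f z = 0" using z(2) by (simp add: F_def)
    from zero[OF zU(1) this] zU(2) show ?thesis by auto
  qed
  have "\<not> f constant_on U"
  proof
    assume "f constant_on U"
    then obtain b where b: "\<And>z. z \<in> U \<Longrightarrow> f z = b" unfolding constant_on_def by blast
    obtain w where "w \<in> U" "f w = 0" using hit[of s t] st(1) by auto
    then have f0: "f z = 0" if "z \<in> U" for z using b that by metis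
    have T0: "(?T ^^ n) f z = 0" if "z \<in> U" for n z
      using that
    proof (induction n arbitrary: z)
      case (Suc n)
      have "\<psi> z \<in> U" using assms(4) Suc.prems(1) by (auto simp: holo_Aut_def bij_betw_def)
      then show ?case using Suc by (simp add: weighted_comp_at)
    qed (use f0 in auto)
    define g where "g z = (if z \<in> U then 1 else 0 :: complex)" for z
    have "g holomorphic_on U"
      by (rule holomorphic_transform[OF holomorphic_on_const[of 1]]) (simp add: g_def)
    then have "g \<in> holo U" by (simp add: holo_def g_def)
    then have "\<exists>c n. \<forall>z\<in>{w}. norm (c * (?T ^^ n) f z - g z) < 1"
      using \<open>w \<in> U\<close> by (intro f2[rule_format]) auto
    then show False using \<open>w \<in> U\<close> T0 by (simp add: g_def)
  qed
  then have fin: "finite {z\<in>L. f z = 0}"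
    using f1 st(2) assms(1,2) unfolding L_def
    by (intro holomorphic_compact_finite_zeros[of f U]) (auto simp: holo_def)
  define R where "R = \<rho> ` {z\<in>L. f z = 0}"
  have "finite R" unfolding R_def using fin by simp
  \<comment> \<open>between s and the smallest element of R above s there is a gap without zero levels\<close>
  define t' where "t' = Min (insert t (R \<inter> {s<..}))"
  have "s < t'" "t' \<le> t" using \<open>finite R\<close> st(1) by (auto simp: t'_def)
  from hit[OF order_refl this] obtain w where w: "w \<in> U" "f w = 0" "\<rho> w \<in> {s<..<t'}" by blast
  then have "\<rho> w \<in> R \<inter> {s<..}" using \<open>t' \<le> t\<close> by (auto simp: R_def L_def)
  then have "t' \<le> \<rho> w" using \<open>finite R\<close> by (auto simp: t'_def)
  then show False using w(3) by simp
qed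

text \<open>
  A continuous linear map \<open>J\<close> that intertwines two operators carries orbits to orbits and, being onto,
  dense sets to dense sets.
\<close>

section \<open>Intertwining operators\<close>

lemma supercyclic_transfer:
  assumes "continuous_map X Y J" "J ` topspace X = topspace Y"
    and "\<And>f. f \<in> topspace X \<Longrightarrow> T f \<in> topspace X"
    and "\<And>f. f \<in> topspace X \<Longrightarrow> J (T f) = T' (J f)"
    and "\<And>c f. J (smul c f) = smul c (J f)"
    and "supercyclic X smul T"
  shows "supercyclic Y smul T'"
proof -
  obtain f where f: "f \<in> topspace X" "X closure_of {smul c ((T ^^ n) f) |c n. True} = topspace X"
    using assms(6) unfolding supercyclic_def by (rule bexE)
  have it: "(T ^^ n) f \<in> topspace X \<and> J ((T ^^ n) f) = (T' ^^ n) (J f)" for n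
    by (induction n) (use f(1) assms(3,4) in auto)
  have "topspace Y = J ` (X closure_of {smul c ((T ^^ n) f) |c n. True})"
    using f(2) assms(2) by simp
  also have "\<dots> \<subseteq> Y closure_of (J ` {smul c ((T ^^ n) f) |c n. True})"
    by (rule continuous_map_image_closure_subset[OF assms(1)])
  also have "J ` {smul c ((T ^^ n) f) |c n. True} = {smul c ((T' ^^ n) (J f)) |c n. True}"
  proof -
    have "J (smul c ((T ^^ n) f)) = smul c ((T' ^^ n) (J f))" for c n using it assms(5) by simp
    then show ?thesis by (auto simp: image_iff) metis
  qed
  finally have "Y closure_of {smul c ((T' ^^ n) (J f)) |c n. True} = topspace Y"
    using closure_of_subset_topspace by (intro subset_antisym)
  moreover have "J f \<in> topspace Y" using f(1) assms(2) by blast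
  ultimately show ?thesis unfolding supercyclic_def by (rule bexI)
qed

lemma unconditionally_convergent_in_transfer:
  assumes "continuous_map X Y J" "J 0 = 0" "\<And>f g. J (f + g) = J f + J g"
    and "unconditionally_convergent_in X x"
  shows "unconditionally_convergent_in Y (\<lambda>n. J (x n))"
  unfolding unconditionally_convergent_in_def
proof (intro allI impI)
  fix p :: "nat \<Rightarrow> nat" assume "bij p"
  then obtain s where "limitin X (\<lambda>N. \<Sum>n<N. x (p n)) s sequentially"
    using assms(4) unfolding unconditionally_convergent_in_def by blast
  then have "limitin Y (J \<circ> (\<lambda>N. \<Sum>n<N. x (p n))) (J s) sequentially"
    by (rule continuous_map_limit[OF assms(1)])
  moreover have "J (\<Sum>n<N. x (p n)) = (\<Sum>n<N. J (x (p n)))" for N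
    by (induction N) (simp_all add: assms(2,3))
  ultimately show "\<exists>s. limitin Y (\<lambda>N. \<Sum>n<N. J (x (p n))) s sequentially"
    by (auto simp: o_def)
qed

lemma frequent_hypercyclicity_criterion_transfer:
  assumes "continuous_map X Y J" "J ` topspace X = topspace Y" "inj_on J (topspace X)"
    and "J 0 = 0" "\<And>f g. J (f + g) = J f + J g"
    and "\<And>f. f \<in> topspace X \<Longrightarrow> T f \<in> topspace X"
    and "\<And>f. f \<in> topspace X \<Longrightarrow> J (T f) = T' (J f)"
    and "frequent_hypercyclicity_criterion X T"
  shows "frequent_hypercyclicity_criterion Y T'"
proof -
  obtain X\<^sub>0 S where X0: "X\<^sub>0 \<subseteq> topspace X" "X closure_of X\<^sub>0 = topspace X" "S \<in> X\<^sub>0 \<rightarrow> X\<^sub>0"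
    and crit: "\<forall>f\<in>X\<^sub>0. unconditionally_convergent_in X (\<lambda>n. (T ^^ Suc n) f) \<and>
        unconditionally_convergent_in X (\<lambda>n. (S ^^ Suc n) f) \<and> T (S f) = f"
    using assms(8) unfolding frequent_hypercyclicity_criterion_def by (elim exE conjE) (rule that)
  define S' where "S' g = J (S (inv_into (topspace X) J g))" for g
  have S': "S' (J f) = J (S f)" if "f \<in> X\<^sub>0" for f
    using that X0(1) assms(3) by (simp add: S'_def inv_into_f_f subsetD)
  have Tn: "(T ^^ n) f \<in> topspace X \<and> J ((T ^^ n) f) = (T' ^^ n) (J f)" if "f \<in> X\<^sub>0" for n f
    by (induction n) (use that X0(1) assms(6,7) in auto)
  have Sn: "(S ^^ n) f \<in> X\<^sub>0 \<and> J ((S ^^ n) f) = (S' ^^ n) (J f)" if "f \<in> X\<^sub>0" for n f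
  proof (induction n)
    case (Suc n)
    then have n: "(S ^^ n) f \<in> X\<^sub>0" "J ((S ^^ n) f) = (S' ^^ n) (J f)" by auto
    show ?case using X0(3) n S'[OF n(1)] by auto
  qed (use that in auto)
  have "topspace Y = J ` (X closure_of X\<^sub>0)" using X0(2) assms(2) by simp
  also have "\<dots> \<subseteq> Y closure_of (J ` X\<^sub>0)"
    by (rule continuous_map_image_closure_subset[OF assms(1)])
  finally have dense: "Y closure_of (J ` X\<^sub>0) = topspace Y"
    using closure_of_subset_topspace by (intro subset_antisym)
  show ?thesis
    unfolding frequent_hypercyclicity_criterion_def
  proof (intro exI[of _ "J ` X\<^sub>0"] exI[of _ S'] conjI dense ballI)
    show "J ` X\<^sub>0 \<subseteq> topspace Y" using X0(1) assms(2) by blast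
    show "S' \<in> J ` X\<^sub>0 \<rightarrow> J ` X\<^sub>0" using S' X0(3) by auto
    fix g assume "g \<in> J ` X\<^sub>0"
    then obtain f where f: "f \<in> X\<^sub>0" "g = J f" by blast
    have "unconditionally_convergent_in Y (\<lambda>n. J ((T ^^ Suc n) f))"
      using crit f(1) by (intro unconditionally_convergent_in_transfer[OF assms(1,4,5)]) auto
    moreover have "J ((T ^^ Suc n) f) = (T' ^^ Suc n) g" for n using Tn[OF f(1), of "Suc n"] f(2) by (simp only:)
    ultimately show "unconditionally_convergent_in Y (\<lambda>n. (T' ^^ Suc n) g)" by (simp only:)
    have "unconditionally_convergent_in Y (\<lambda>n. J ((S ^^ Suc n) f))"
      using crit f(1) by (intro unconditionally_convergent_in_transfer[OF assms(1,4,5)]) auto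
    moreover have "J ((S ^^ Suc n) f) = (S' ^^ Suc n) g" for n using Sn[OF f(1), of "Suc n"] f(2) by (simp only:)
    ultimately show "unconditionally_convergent_in Y (\<lambda>n. (S' ^^ Suc n) g)" by (simp only:)
    have "S f \<in> topspace X" using f(1) X0(1,3) by auto
    then have "T' (S' g) = J (T (S f))" using S'[OF f(1)] assms(7) f(2) by simp
    then show "T' (S' g) = g" using crit f by simp
  qed
qed

text \<open>
  The intertwining operator is \<open>f \<mapsto> u * (f \<circ> \<phi>)\<close>. It serves twice: with \<open>u = 1\<close> to move the problem along a
  biholomorphic map, and with \<open>\<phi>\<close> the identity to change the weight by a multiplicative coboundary.
\<close>

section \<open>Weighted composition operators under change of variable and weight\<close>

lemma weighted_comp_transfer:
  assumes U: "open U" "\<omega> holomorphic_on U" "\<psi> \<in> holo_Aut U"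
    and V: "open V"
    and \<phi>: "\<phi> holomorphic_on V" "\<phi>' holomorphic_on U" "\<And>z. z \<in> V \<Longrightarrow> \<phi> z \<in> U \<and> \<phi>' (\<phi> z) = z"
      "\<And>z. z \<in> U \<Longrightarrow> \<phi>' z \<in> V \<and> \<phi> (\<phi>' z) = z"
    and u: "u holomorphic_on V" "\<And>z. z \<in> V \<Longrightarrow> u z \<noteq> 0"
    and comm: "\<And>z. z \<in> V \<Longrightarrow> \<psi>' z \<in> V \<and> \<phi> (\<psi>' z) = \<psi> (\<phi> z) \<and> u z * \<omega> (\<phi> z) = \<omega>' z * u (\<psi>' z)"
  shows "supercyclic (holo_topology U) fscale (weighted_comp U \<omega> \<psi>) \<Longrightarrow>
      supercyclic (holo_topology V) fscale (weighted_comp V \<omega>' \<psi>')"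
    and "frequent_hypercyclicity_criterion (holo_topology U) (weighted_comp U \<omega> \<psi>) \<Longrightarrow>
      frequent_hypercyclicity_criterion (holo_topology V) (weighted_comp V \<omega>' \<psi>')"
proof -
  let ?J = "weighted_comp V u \<phi>"
  have cont: "continuous_map (holo_topology U) (holo_topology V) ?J"
    using U(1) V u(1) \<phi>(1,3) by (intro continuous_map_weighted_comp_between) auto
  have "g \<in> ?J ` holo U" if g: "g \<in> holo V" for g
  proof -
    define v where "v z = inverse (u (\<phi>' z))" for z
    have "v holomorphic_on U"
      unfolding v_def using u \<phi>(2,4)
      by (intro holomorphic_on_inverse holomorphic_on_compose_gen[of \<phi>' U u V, unfolded o_def]) auto
    then have "continuous_map (holo_topology V) (holo_topology U) (weighted_comp U v \<phi>')"
      using U(1) V \<phi>(2,4) by (intro continuous_map_weighted_comp_between) auto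
    then have "weighted_comp U v \<phi>' g \<in> holo U"
      using g by (metis continuous_map_funspace funcset_mem topspace_holo_topology)
    moreover have "?J (weighted_comp U v \<phi>' g) = g"
      using g \<phi>(3) u(2) by (auto simp: weighted_comp_def v_def holo_def)
    ultimately show ?thesis by (metis imageI)
  qed
  moreover have "?J ` holo U \<subseteq> holo V"
    using continuous_map_image_subset_topspace[OF cont] by simp
  ultimately have surj: "?J ` topspace (holo_topology U) = topspace (holo_topology V)" by auto
  have inj: "inj_on ?J (topspace (holo_topology U))"
  proof (rule inj_onI, rule ext)
    fix f g z assume fg: "f \<in> topspace (holo_topology U)" "g \<in> topspace (holo_topology U)" "?J f = ?J g"
    show "f z = g z"
    proof (cases "z \<in> U")
      case True
      have "?J f (\<phi>' z) = ?J g (\<phi>' z)" using fg(3) by simp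
      then show ?thesis using \<phi>(4)[OF True] u(2) by (simp add: weighted_comp_at)
    qed (use fg in \<open>auto simp: holo_def\<close>)
  qed
  have com: "?J (weighted_comp U \<omega> \<psi> f) = weighted_comp V \<omega>' \<psi>' (?J f)" for f
  proof
    fix z
    show "?J (weighted_comp U \<omega> \<psi> f) z = weighted_comp V \<omega>' \<psi>' (?J f) z"
    proof (cases "z \<in> V")
      case True
      have "?J (weighted_comp U \<omega> \<psi> f) z = (u z * \<omega> (\<phi> z)) * f (\<psi> (\<phi> z))"
        using True \<phi>(3) by (simp add: weighted_comp_at)
      also have "\<dots> = weighted_comp V \<omega>' \<psi>' (?J f) z"
        using comm[OF True] True by (simp add: weighted_comp_at)
      finally show ?thesis .
    qed (simp add: weighted_comp_def)
  qed
  have inv: "weighted_comp U \<omega> \<psi> f \<in> topspace (holo_topology U)"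
    if "f \<in> topspace (holo_topology U)" for f
    using weighted_comp_holo[OF U(2,3)] that by simp
  have J0: "?J 0 = 0" by (auto simp: weighted_comp_def)
  show "supercyclic (holo_topology V) fscale (weighted_comp V \<omega>' \<psi>')"
    if "supercyclic (holo_topology U) fscale (weighted_comp U \<omega> \<psi>)"
    by (rule supercyclic_transfer[OF cont surj inv com weighted_comp_fscale that])
  show "frequent_hypercyclicity_criterion (holo_topology V) (weighted_comp V \<omega>' \<psi>')"
    if "frequent_hypercyclicity_criterion (holo_topology U) (weighted_comp U \<omega> \<psi>)"
    by (rule frequent_hypercyclicity_criterion_transfer[OF cont surj inj J0 weighted_comp_add inv com that])
qed

section \<open>Automorphisms of the punctured disc and the punctured plane\<close>

lemma holo_Aut_inverse:
  assumes "open U" "\<psi> \<in> holo_Aut U"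
  obtains \<eta> where "\<eta> \<in> holo_Aut U" "\<forall>z\<in>U. \<eta> (\<psi> z) = z" "\<forall>z\<in>U. \<psi> (\<eta> z) = z"
proof -
  have \<psi>: "\<psi> holomorphic_on U" "inj_on \<psi> U" "\<psi> ` U = U"
    using assms(2) by (auto simp: holo_Aut_def bij_betw_def)
  obtain \<eta> where \<eta>: "\<eta> holomorphic_on (\<psi> ` U)" "\<And>z. z \<in> U \<Longrightarrow> \<eta> (\<psi> z) = z"
    using holomorphic_has_inverse[OF \<psi>(1) assms(1) \<psi>(2)] by metis
  have r: "\<psi> (\<eta> z) = z" if "z \<in> U" for z using \<eta>(2) \<psi>(3) that by (metis imageE)
  have "bij_betw \<eta> U U"
    by (rule bij_betw_byWitness[where f' = \<psi>]) (use \<eta>(2) r \<psi>(3) in \<open>auto, metis imageE\<close>)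
  then have "\<eta> \<in> holo_Aut U" using \<eta>(1) \<psi>(3) by (simp add: holo_Aut_def)
  then show thesis using \<eta>(2) r by (intro that) auto
qed

text \<open>
  If \<open>b\<close> were in \<open>U\<close>, continuity of the inverse automorphism at \<open>b\<close> would force its value there to be
  the puncture \<open>x\<close>.
\<close>

lemma holo_Aut_limit_at_puncture:
  assumes "open U" "\<psi> \<in> holo_Aut U" "x \<notin> U" "\<forall>\<^sub>F z in at x. z \<in> U" "(\<psi> \<longlongrightarrow> b) (at x)"
  shows "b \<notin> U"
proof
  assume b: "b \<in> U"
  obtain \<eta> where \<eta>: "\<eta> \<in> holo_Aut U" "\<forall>z\<in>U. \<eta> (\<psi> z) = z" "\<forall>z\<in>U. \<psi> (\<eta> z) = z"
    by (rule holo_Aut_inverse[OF assms(1,2)])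
  have "continuous_on U \<eta>" "\<eta> ` U = U"
    using \<eta>(1) by (auto simp: holo_Aut_def bij_betw_def intro: holomorphic_on_imp_continuous_on)
  then have "isCont \<eta> b" using assms(1) b continuous_on_eq_continuous_at by blast
  then have "((\<lambda>z. \<eta> (\<psi> z)) \<longlongrightarrow> \<eta> b) (at x)" using assms(5) by (rule isCont_tendsto_compose)
  moreover have "\<forall>\<^sub>F z in at x. \<eta> (\<psi> z) = z"
    using assms(4) by (rule eventually_mono) (use \<eta>(2) in blast)
  ultimately have "((\<lambda>z. z) \<longlongrightarrow> \<eta> b) (at x)" by (rule Lim_transform_eventually)
  from LIM_unique[OF this tendsto_ident_at] have "\<eta> b = x" .
  moreover have "\<eta> b \<in> U" using b \<open>\<eta> ` U = U\<close> by auto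
  ultimately show False using assms(3) by simp
qed

text \<open>
  The map is bounded, so it extends over the puncture. The extension can only fix \<open>0\<close>: a value in
  the punctured disc is excluded by the preceding lemma and one on the unit circle by the maximum
  principle. The Schwarz lemma applies to the extension.
\<close>

lemma punctured_disc_Aut_norm_le:
  assumes "\<psi> \<in> holo_Aut (ball 0 1 - {0})" "z \<in> ball 0 1 - {0}"
  shows "norm (\<psi> z) \<le> norm z"
proof -
  have \<psi>: "\<psi> holomorphic_on (ball 0 1 - {0})" "inj_on \<psi> (ball 0 1 - {0})"
      "\<psi> ` (ball 0 1 - {0}) = ball 0 1 - {0}"
    using assms(1) by (auto simp: holo_Aut_def bij_betw_def)
  have lt: "norm (\<psi> w) < 1" if "w \<in> ball 0 1 - {0}" for w using \<psi>(3) that by auto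
  have ev: "\<forall>\<^sub>F w in at 0. w \<in> ball 0 1 - {0::complex}"
    using eventually_at_in_open[of "ball 0 1" "0::complex"] by simp
  then have "\<forall>\<^sub>F w in at 0. norm (\<psi> w) \<le> 1"
    by (rule eventually_mono) (use lt in force)
  then obtain g where g: "g holomorphic_on ball 0 1" "\<forall>w\<in>ball 0 1 - {0}. g w = \<psi> w"
    using holomorphic_on_extend_bounded[OF \<psi>(1)] by (auto simp: interior_open)
  have "isCont g 0"
    using g(1) by (meson centre_in_ball continuous_on_eq_continuous_at holomorphic_on_imp_continuous_on open_ball zero_less_one)
  then have "(g \<longlongrightarrow> g 0) (at 0)" by (simp add: isCont_def)
  then have lim: "(\<psi> \<longlongrightarrow> g 0) (at 0)"
    by (rule Lim_transform_eventually) (use ev g(2) in \<open>auto elim: eventually_mono\<close>)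
  have le: "norm (g 0) \<le> 1"
    using tendsto_upperbound[OF tendsto_norm[OF lim] \<open>\<forall>\<^sub>F w in at 0. norm (\<psi> w) \<le> 1\<close>] by simp
  have "norm (g 0) \<noteq> 1"
  proof
    assume 1: "norm (g 0) = 1"
    have "g constant_on ball 0 1"
    proof (rule maximum_modulus_principle[OF g(1)])
      show "norm (g w) \<le> norm (g 0)" if "w \<in> ball 0 1" for w
        using lt[of w] g(2) that 1 by (cases "w = 0") auto
    qed auto
    then have "g (1/2) = g (1/3)" unfolding constant_on_def by force
    then have "\<psi> (1/2) = \<psi> (1/3)" using g(2) by simp
    from inj_onD[OF \<psi>(2) this] have "(1/2::complex) = 1/3" by simp
    then show False by simp
  qed
  moreover have "g 0 \<notin> ball 0 1 - {0}"
    by (rule holo_Aut_limit_at_puncture[OF _ assms(1) _ ev lim]) auto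
  ultimately have g0: "g 0 = 0" using le by auto
  have "norm (g z) \<le> norm z"
  proof (rule Schwarz_Lemma(1)[OF g(1) g0])
    show "norm (g w) < 1" if "norm w < 1" for w
      using lt[of w] g(2) g0 that by (cases "w = 0") auto
    show "norm z < 1" using assms(2) by simp
  qed
  moreover have "g z = \<psi> z" using g(2) assms(2) by (rule bspec)
  ultimately show ?thesis by simp
qed

lemma punctured_disc_Aut_norm:
  assumes "\<psi> \<in> holo_Aut (ball 0 1 - {0})" "z \<in> ball 0 1 - {0}"
  shows "norm (\<psi> z) = norm z"
proof (rule antisym)
  show "norm (\<psi> z) \<le> norm z" by (rule punctured_disc_Aut_norm_le[OF assms])
  have "open (ball 0 1 - {0::complex})" by auto
  then obtain \<eta> where \<eta>: "\<eta> \<in> holo_Aut (ball 0 1 - {0})" "\<forall>z\<in>ball 0 1 - {0}. \<eta> (\<psi> z) = z"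
      "\<forall>z\<in>ball 0 1 - {0}. \<psi> (\<eta> z) = z"
    by (rule holo_Aut_inverse[OF _ assms(1)])
  have "\<psi> z \<in> ball 0 1 - {0}" using assms by (auto simp: holo_Aut_def bij_betw_def)
  from punctured_disc_Aut_norm_le[OF \<eta>(1) this] show "norm z \<le> norm (\<psi> z)"
    using \<eta>(2) assms(2) by simp
qed

text \<open>
  The extension over the puncture is an entire bijection, hence proper, hence a polynomial. Its only
  zero is the simple one at the origin, so the fundamental theorem of algebra leaves nothing but
  the linear term.
\<close>

lemma punctured_plane_Aut_linear:
  assumes \<psi>A: "\<psi> \<in> holo_Aut (- {0})" and lim: "(\<psi> \<longlongrightarrow> b) (at 0)"
  shows "\<exists>a. a \<noteq> 0 \<and> (\<forall>z. z \<noteq> 0 \<longrightarrow> \<psi> z = a * z)"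
proof -
  have \<psi>: "\<psi> holomorphic_on - {0}" "inj_on \<psi> (- {0})" "\<psi> ` (- {0}) = - {0}"
    using \<psi>A by (auto simp: holo_Aut_def bij_betw_def)
  have "\<forall>\<^sub>F w in at 0. w \<in> - {0::complex}"
    using eventually_at_in_open[of UNIV "0::complex"] by (simp add: Compl_eq_Diff_UNIV)
  then have "b \<notin> - {0}"
    by (intro holo_Aut_limit_at_puncture[OF _ \<psi>A _ _ lim]) auto
  then have b0: "b = 0" by simp
  define g where "g z = (if z = 0 then 0 else \<psi> z)" for z
  have g: "g holomorphic_on UNIV"
    unfolding g_def using \<psi>(1) lim b0 by (intro removable_singularity) (auto simp: Compl_eq_Diff_UNIV)
  have inj: "inj g"
  proof (rule injI)
    fix x y assume "g x = g y"
    then show "x = y"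
      using \<psi>(2,3) by (cases "x = 0"; cases "y = 0") (auto simp: g_def inj_on_def)
  qed
  have surj: "range g = UNIV"
  proof -
    have "w \<in> range g" for w
    proof (cases "w = 0")
      case True then show ?thesis by (intro image_eqI[of _ _ 0]) (auto simp: g_def)
    next
      case False
      then obtain z where "z \<noteq> 0" "\<psi> z = w" using \<psi>(3) by (metis ComplD ComplI imageE singletonD singletonI)
      then show ?thesis by (intro image_eqI[of _ _ z]) (auto simp: g_def)
    qed
    then show ?thesis by blast
  qed
  obtain h where h: "h holomorphic_on range g" "\<And>z. z \<in> UNIV \<Longrightarrow> h (g z) = z"
    using holomorphic_has_inverse[OF g open_UNIV inj] by metis
  \<comment> \<open>as g is a homeomorphism of the plane, it is proper\<close>
  have "filterlim g at_infinity at_infinity"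
    unfolding filterlim_at_infinity[OF order_refl]
  proof (intro allI impI)
    fix r :: real assume "r > 0"
    have "continuous_on (cball 0 r) h"
      using h(1) surj by (metis continuous_on_subset holomorphic_on_imp_continuous_on subset_UNIV)
    then have "bounded (h ` cball 0 r)"
      by (intro compact_imp_bounded compact_continuous_image) auto
    then obtain B where B: "\<And>w. norm w \<le> r \<Longrightarrow> norm (h w) \<le> B"
      unfolding bounded_iff by (metis image_eqI mem_cball_0)
    have "r \<le> norm (g z)" if "B + 1 \<le> norm z" for z
      using B[of "g z"] h(2)[of z] that by force
    then show "\<forall>\<^sub>F z in at_infinity. r \<le> norm (g z)"
      unfolding eventually_at_infinity by blast
  qed
  then have "((inverse \<circ> g) \<longlongrightarrow> 0) at_infinity"
    unfolding o_def by (rule filterlim_compose[OF tendsto_inverse_0])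
  then obtain a n where an: "\<And>z. g z = (\<Sum>i\<le>n. a i * z ^ i)"
    using pole_at_infinity[OF g] by metis
  have a0: "a 0 = 0" using an[of 0] by (simp add: g_def sum.atMost_shift)
  have n: "n \<noteq> 0"
  proof
    assume "n = 0"
    then have "g 1 = g 0" using an by simp
    then show False using inj by (metis injD zero_neq_one)
  qed
  then obtain m where m: "n = Suc m" by (cases n) auto
  define q where "q z = (\<Sum>i\<le>m. a (Suc i) * z ^ i)" for z
  have gq: "g z = z * q z" for z
    unfolding an m sum.atMost_Suc_shift q_def by (simp add: a0 sum_distrib_left mult_ac)
  have qn: "q z \<noteq> 0" if "z \<noteq> 0" for z
  proof
    assume "q z = 0"
    then have "g z = g 0" using gq by simp
    then show False using inj that by (metis injD)
  qed
  have "deriv g 0 \<noteq> 0" by (rule holomorphic_injective_imp_regular[OF g open_UNIV inj]) simp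
  moreover have "(g has_field_derivative q 0) (at 0)"
  proof -
    have "q holomorphic_on UNIV" unfolding q_def by (intro holomorphic_intros)
    then have "(q has_field_derivative deriv q 0) (at 0)"
      by (rule holomorphic_derivI) auto
    then have "((\<lambda>z. z * q z) has_field_derivative (1 * q 0 + deriv q 0 * 0)) (at 0)"
      by (intro DERIV_mult DERIV_ident)
    then show ?thesis using gq by (simp add: ext[of g "\<lambda>z. z * q z"])
  qed
  ultimately have q0: "q 0 \<noteq> 0" by (simp add: DERIV_imp_deriv)
  have "\<not> (\<exists>i\<in>{1..m}. a (Suc i) \<noteq> 0)"
  proof
    assume "\<exists>i\<in>{1..m}. a (Suc i) \<noteq> 0"
    then obtain z where "(\<Sum>i\<le>m. a (Suc i) * z ^ i) = 0"
      using Cauchy_Integral_Formula.fundamental_theorem_of_algebra[of "\<lambda>i. a (Suc i)" m] by blast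
    then show False using qn[of z] q0 by (cases "z = 0") (auto simp: q_def)
  qed
  then have az: "a (Suc i) = 0" if "i \<in> {1..m}" for i using that by blast
  have q: "q z = a 1" for z
  proof -
    have "q z = (\<Sum>i\<in>{0}. a (Suc i) * z ^ i)"
      unfolding q_def by (rule sum.mono_neutral_right) (use az in auto)
    then show ?thesis by simp
  qed
  show ?thesis
  proof (intro exI[of _ "a 1"] conjI allI impI)
    show "a 1 \<noteq> 0" using q0 q by simp
    show "\<psi> z = a 1 * z" if "z \<noteq> 0" for z using gq[of z] that q by (simp add: g_def mult.commute)
  qed
qed

text \<open>
  The origin is not an essential singularity: the image of the exterior of a disc is open and is not
  met by the values near \<open>0\<close>, so \<open>1 / (\<psi> - p)\<close> is bounded there for a suitable \<open>p\<close>. If \<open>\<psi>\<close> has a pole,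
  \<open>1 / \<psi>\<close> falls under the preceding lemma.
\<close>

lemma punctured_plane_Aut:
  assumes \<psi>A: "\<psi> \<in> holo_Aut (- {0})"
  shows "\<exists>a. a \<noteq> 0 \<and> ((\<forall>z. z \<noteq> 0 \<longrightarrow> \<psi> z = a * z) \<or> (\<forall>z. z \<noteq> 0 \<longrightarrow> \<psi> z = a / z))"
proof -
  have \<psi>: "\<psi> holomorphic_on - {0}" "inj_on \<psi> (- {0})" "\<psi> ` (- {0}) = - {0}"
    using \<psi>A by (auto simp: holo_Aut_def bij_betw_def)
  define p where "p = \<psi> 1"
  define A where "A = - cball (0::complex) (1/2)"
  have A: "A \<subseteq> - {0}" "open A" "1 \<in> A" by (auto simp: A_def)
  have "open (\<psi> ` A)"
    using \<psi>(1,2) A by (meson holomorphic_on_subset inj_on_subset open_mapping_thm3)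
  moreover have "p \<in> \<psi> ` A" using A by (auto simp: p_def)
  ultimately obtain e where e: "e > 0" "ball p e \<subseteq> \<psi> ` A" by (meson openE)
  have far: "norm (\<psi> w - p) \<ge> e" if "w \<in> ball 0 (1/2) - {0}" for w
  proof (rule ccontr)
    assume "\<not> norm (\<psi> w - p) \<ge> e"
    then have "\<psi> w \<in> \<psi> ` A" using e(2) by (auto simp: dist_norm norm_minus_commute)
    then obtain w' where "w' \<in> A" "\<psi> w = \<psi> w'" by blast
    then have "w = w'" using inj_onD[OF \<psi>(2), of w w'] that A(1) by blast
    then show False using that \<open>w' \<in> A\<close> by (auto simp: A_def)
  qed
  define F where "F w = inverse (\<psi> w - p)" for w
  have ne: "\<psi> w - p \<noteq> 0" if "w \<in> ball 0 (1/2) - {0}" for w using far[OF that] e(1) by auto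
  have sub: "ball 0 (1/2) - {0} \<subseteq> - {0::complex}" by auto
  have F: "F holomorphic_on (ball 0 (1/2) - {0})"
    unfolding F_def using ne holomorphic_on_subset[OF \<psi>(1) sub]
    by (intro holomorphic_on_inverse holomorphic_on_diff holomorphic_on_const) auto
  have ev: "\<forall>\<^sub>F w in at 0. w \<in> ball 0 (1/2) - {0::complex}"
    using eventually_at_in_open[of "ball 0 (1/2)" "0::complex"] by simp
  have "norm (F w) \<le> inverse e" if "w \<in> ball 0 (1/2) - {0}" for w
    unfolding F_def norm_inverse using far[OF that] e(1) by (intro le_imp_inverse_le)
  then have "\<forall>\<^sub>F w in at 0. norm (F w) \<le> inverse e"
    by (intro eventually_mono[OF ev])
  then obtain g where g: "g holomorphic_on ball 0 (1/2)" "\<forall>w\<in>ball 0 (1/2) - {0}. g w = F w"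
    using holomorphic_on_extend_bounded[OF F] by (auto simp: interior_open)
  have "continuous_on (ball 0 (1/2)) g" using g(1) by (rule holomorphic_on_imp_continuous_on)
  then have "isCont g 0" by (simp add: continuous_on_eq_continuous_at)
  then have "(g \<longlongrightarrow> g 0) (at 0)" by (simp add: isCont_def)
  then have lim: "(F \<longlongrightarrow> g 0) (at 0)"
    by (rule Lim_transform_eventually) (use ev g(2) in \<open>auto elim: eventually_mono\<close>)
  show ?thesis
  proof (cases "g 0 = 0")
    case False
    have "((\<lambda>w. p + inverse (F w)) \<longlongrightarrow> p + inverse (g 0)) (at 0)"
      using lim False by (intro tendsto_intros)
    then have "(\<psi> \<longlongrightarrow> p + inverse (g 0)) (at 0)" by (simp add: F_def)
    from punctured_plane_Aut_linear[OF \<psi>A this] show ?thesis by blast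
  next
    case True
    define \<tau> where "\<tau> w = inverse (\<psi> w)" for w
    have ne0: "\<psi> w \<noteq> 0" if "w \<noteq> 0" for w using \<psi>(3) that by auto
    have "bij_betw \<tau> (- {0}) (- {0})"
      unfolding bij_betw_def
    proof
      show "inj_on \<tau> (- {0})" using \<psi>(2) by (auto simp: \<tau>_def inj_on_def)
      have "\<tau> ` (- {0}) = inverse ` (\<psi> ` (- {0}))" unfolding \<tau>_def by (simp add: image_image)
      also have "\<dots> = - {0}" unfolding \<psi>(3)
      proof (intro equalityI subsetI)
        fix x :: complex assume "x \<in> - {0}"
        then show "x \<in> inverse ` (- {0})" by (intro image_eqI[of _ _ "inverse x"]) auto
      qed auto
      finally show "\<tau> ` (- {0}) = - {0}" .
    qed
    moreover have "\<tau> holomorphic_on - {0}"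
      unfolding \<tau>_def using ne0 by (intro holomorphic_on_inverse \<psi>(1)) auto
    ultimately have \<tau>A: "\<tau> \<in> holo_Aut (- {0})" by (simp add: holo_Aut_def)
    have "((\<lambda>w. F w / (1 + p * F w)) \<longlongrightarrow> g 0 / (1 + p * g 0)) (at 0)"
      using lim True by (intro tendsto_intros) auto
    moreover have "\<forall>\<^sub>F w in at 0. F w / (1 + p * F w) = \<tau> w"
    proof (rule eventually_mono[OF ev])
      fix w :: complex assume w: "w \<in> ball 0 (1/2) - {0}"
      have "\<psi> w - p \<noteq> 0" "\<psi> w \<noteq> 0" using ne[OF w] ne0 w by auto
      then have "1 + p * F w = \<psi> w * F w" by (simp add: F_def field_simps)
      then show "F w / (1 + p * F w) = \<tau> w" using ne[OF w] by (simp add: F_def \<tau>_def field_simps)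
    qed
    ultimately have "(\<tau> \<longlongrightarrow> g 0 / (1 + p * g 0)) (at 0)"
      by (rule Lim_transform_eventually)
    then obtain a where a: "a \<noteq> 0" "\<forall>z. z \<noteq> 0 \<longrightarrow> \<tau> z = a * z"
      using punctured_plane_Aut_linear[OF \<tau>A] by blast
    have "\<psi> z = inverse a / z" if "z \<noteq> 0" for z
    proof -
      have "\<psi> z = inverse (\<tau> z)" by (simp add: \<tau>_def)
      then show ?thesis using a that by (simp add: divide_inverse)
    qed
    then show ?thesis using a(1) by (intro exI[of _ "inverse a"]) auto
  qed
qed

text \<open>
  The Cauchy integral of \<open>h\<close> over a circle of radius \<open>R\<close> is holomorphic inside the circle and, away from
  the puncture, differs from \<open>h\<close> by the integral \<open>c z\<close> of the difference quotient \<open>Q z\<close>. The latter is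
  holomorphic on the punctured plane, so \<open>c z\<close> does not depend on \<open>R\<close>. Hence \<open>A = h + c\<close> is entire, and
  \<open>B (inverse z) = - c z\<close> remains.
\<close>

section \<open>Normal form of a zero-free weight on the punctured plane\<close>

lemma laurent_split:
  assumes h: "h holomorphic_on - {0}"
  obtains A B where "A holomorphic_on UNIV" "B holomorphic_on UNIV" "B 0 = 0"
    "\<forall>z. z \<noteq> 0 \<longrightarrow> h z = A z + B (inverse z)"
proof -
  define Q where "Q z w = (if w = z then deriv h z else (h w - h z) / (w - z))" for z w
  have Q: "Q z holomorphic_on - {0}" for z
    unfolding Q_def by (rule pole_lemma_open[OF h]) auto
  define c where "c z = contour_integral (circlepath 0 1) (Q z) / (2 * of_real pi * \<i>)" for z
  have Qint: "(Q z has_contour_integral 2 * of_real pi * \<i> * c z) (circlepath 0 R)" if "1 \<le> R" for z R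
  proof -
    have "Q z holomorphic_on (UNIV - {0})" using Q by (simp add: Compl_eq_Diff_UNIV)
    note * = contour_integral_circlepath_eq[OF open_UNIV this zero_less_one that subset_UNIV]
    show ?thesis using has_contour_integral_integral[OF *(2)] *(3) by (simp add: c_def)
  qed
  have hc: "continuous_on (path_image (circlepath 0 R)) h" if "1 \<le> R" for R
    using that by (intro continuous_on_subset[OF holomorphic_on_imp_continuous_on[OF h]]) auto
  have off: "(Q z has_contour_integral i) (circlepath 0 R) \<Longrightarrow>
      ((\<lambda>w. 1 / (w - z)) has_contour_integral j) (circlepath 0 R) \<Longrightarrow>
      ((\<lambda>w. h w / (w - z)) has_contour_integral i + h z * j) (circlepath 0 R)"
    if "norm z \<noteq> R" "1 \<le> R" for z i j R
  proof -
    assume "(Q z has_contour_integral i) (circlepath 0 R)"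
      "((\<lambda>w. 1 / (w - z)) has_contour_integral j) (circlepath 0 R)"
    then have "((\<lambda>w. Q z w + h z * (1 / (w - z))) has_contour_integral i + h z * j) (circlepath 0 R)"
      by (intro has_contour_integral_add has_contour_integral_lmul)
    then show ?thesis
    proof (rule has_contour_integral_eq)
      fix w assume "w \<in> path_image (circlepath 0 R)"
      then have "w \<noteq> z" using that by auto
      then show "Q z w + h z * (1 / (w - z)) = h w / (w - z)"
        by (simp add: Q_def diff_divide_distrib)
    qed
  qed
  have inside: "((\<lambda>w. h w / (w - z)) has_contour_integral 2 * of_real pi * \<i> * (h z + c z)) (circlepath 0 R)"
    if "1 \<le> R" "norm z < R" "z \<noteq> 0" for z R
  proof -
    have "((\<lambda>w. 1 / (w - z)) has_contour_integral 2 * of_real pi * \<i> * 1) (circlepath 0 R)"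
      using that by (intro Cauchy_integral_circlepath_simple) (auto intro: holomorphic_intros)
    from off[OF _ that(1) Qint[OF that(1)] this] that(2) show ?thesis by (simp add: algebra_simps)
  qed
  define AR where "AR R z = contour_integral (circlepath 0 R) (\<lambda>w. h w / (w - z)) / (2 * of_real pi * \<i>)" for R z
  have ARint: "((\<lambda>w. h w / (w - z)) has_contour_integral 2 * of_real pi * \<i> * AR R z) (circlepath 0 R)"
    if "1 \<le> R" "norm z < R" for z R
  proof -
    have "continuous_on (path_image (circlepath 0 R)) (\<lambda>w. h w / (w - z))"
      using that by (intro continuous_on_divide hc continuous_intros) auto
    then have "(\<lambda>w. h w / (w - z)) contour_integrable_on circlepath 0 R"
      by (rule contour_integrable_continuous_circlepath)
    from has_contour_integral_integral[OF this] show ?thesis by (simp add: AR_def)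
  qed
  have AR_holo: "AR R holomorphic_on ball 0 R" if "1 \<le> R" for R
  proof -
    have "((\<lambda>z. 2 * of_real pi * \<i> * AR R z) has_field_derivative
        (of_nat 1 * contour_integral (circlepath 0 R) (\<lambda>u. h u / (u - z) ^ Suc 1))) (at z)"
      if "z \<in> ball 0 R" for z
      by (rule Cauchy_next_derivative_circlepath(2)[OF hc[OF \<open>1 \<le> R\<close>] _ _ that])
        (use ARint[OF \<open>1 \<le> R\<close>] in auto)
    then have "(\<lambda>z. 2 * of_real pi * \<i> * AR R z) holomorphic_on ball 0 R"
      unfolding holomorphic_on_open[OF open_ball] by blast
    then have "(\<lambda>z. (2 * of_real pi * \<i> * AR R z) / (2 * of_real pi * \<i>)) holomorphic_on ball 0 R"
      by (intro holomorphic_on_divide holomorphic_on_const) auto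
    then show ?thesis by simp
  qed
  have AR_eq: "AR R z = h z + c z" if "1 \<le> R" "norm z < R" "z \<noteq> 0" for R z
    using contour_integral_unique[OF inside[OF that]] by (simp add: AR_def)
  define A where "A z = (if z = 0 then AR 1 0 else h z + c z)" for z
  have AAR: "A z = AR R z" if "1 \<le> R" "norm z < R" for z R
  proof (cases "z = 0")
    case True
    have ball: "0 < R" "(0::complex) \<in> ball 0 1" using that by auto
    have cont: "isCont (AR r) 0" if "1 \<le> r" for r
      using holomorphic_on_imp_continuous_on[OF AR_holo[OF that]] that
      by (simp add: continuous_on_eq_continuous_at)
    have "\<forall>\<^sub>F w in at 0. w \<in> ball 0 1 - {0::complex}"
      using eventually_at_in_open[of "ball 0 1" "0::complex"] by simp
    then have "\<forall>\<^sub>F w in at 0. AR R w = AR 1 w"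
      by (rule eventually_mono) (use AR_eq that(1) in auto)
    moreover have "(AR R \<longlongrightarrow> AR R 0) (at 0)" "(AR 1 \<longlongrightarrow> AR 1 0) (at 0)"
      using cont[OF that(1)] cont[of 1] by (auto simp: isCont_def)
    ultimately have "AR R 0 = AR 1 0"
      using LIM_unique Lim_transform_eventually by blast
    then show ?thesis using True by (simp add: A_def)
  qed (use AR_eq that in \<open>simp add: A_def\<close>)
  have A: "A holomorphic_on UNIV"
  proof (rule holomorphic_on_subset[of A "\<Union>n. ball 0 (real (Suc n))"])
    show "A holomorphic_on (\<Union>n. ball 0 (real (Suc n)))"
    proof (rule holomorphic_on_UN_open)
      fix n
      show "A holomorphic_on ball 0 (real (Suc n))"
      proof (rule holomorphic_transform[OF AR_holo[of "real (Suc n)"]])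
        show "AR (real (Suc n)) z = A z" if "z \<in> ball 0 (real (Suc n))" for z
          by (rule AAR[symmetric]) (use that in auto)
      qed simp
    qed auto
    show "UNIV \<subseteq> (\<Union>n. ball 0 (real (Suc n)) :: complex set)"
    proof
      fix z :: complex
      obtain n where "norm z < real n" using reals_Archimedean2 by blast
      then show "z \<in> (\<Union>n. ball 0 (real (Suc n)))" by (intro UN_I[of n]) auto
    qed
  qed
  \<comment> \<open>outside the unit circle, c is the Cauchy integral of h over it and so vanishes at infinity\<close>
  have "compact (h ` sphere 0 1)"
    using h by (intro compact_continuous_image continuous_on_subset[OF holomorphic_on_imp_continuous_on[OF h]]) auto
  then have "bounded (h ` sphere 0 1)" by (rule compact_imp_bounded)
  then obtain M where M: "M > 0" "\<forall>x\<in>h ` sphere 0 1. norm x \<le> M" unfolding bounded_pos by blast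
  have c_le: "norm (c z) \<le> M / (norm z - 1)" if z: "1 < norm z" for z
  proof -
    have "((\<lambda>w. 1 / (w - z)) has_contour_integral 0) (circlepath 0 1)"
    proof (rule Cauchy_theorem_convex_simple)
      show "(\<lambda>w. 1 / (w - z)) holomorphic_on ball 0 (norm z)"
        by (intro holomorphic_intros) auto
      show "path_image (circlepath 0 1) \<subseteq> ball 0 (norm z)" using z by auto
    qed auto
    from off[OF _ order_refl Qint[OF order_refl] this] z
    have "((\<lambda>w. h w / (w - z)) has_contour_integral 2 * of_real pi * \<i> * c z) (circlepath 0 1)"
      by simp
    then have "norm (2 * of_real pi * \<i> * c z) \<le> M / (norm z - 1) * (2 * pi * 1)"
    proof (rule has_contour_integral_bound_circlepath)
      show "0 \<le> M / (norm z - 1)" using M(1) z by simp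
      fix x :: complex assume x: "norm (x - 0) = 1"
      have "norm (h x) \<le> M" using M(2) x by simp
      moreover have "norm z - 1 \<le> norm (x - z)"
        using norm_triangle_ineq2[of z x] x by (simp add: norm_minus_commute)
      ultimately show "norm (h x / (x - z)) \<le> M / (norm z - 1)"
        unfolding norm_divide using M(1) z by (intro frac_le) auto
    qed simp
    then have "2 * pi * norm (c z) \<le> 2 * pi * (M / (norm z - 1))" by (simp add: norm_mult mult_ac)
    then show ?thesis by (rule mult_left_le_imp_le) simp
  qed
  define B\<^sub>0 where "B\<^sub>0 u = h (inverse u) - A (inverse u)" for u
  have inv: "inverse holomorphic_on - {0::complex}" by (intro holomorphic_intros) auto
  have "(h \<circ> inverse) holomorphic_on - {0}"
    by (rule holomorphic_on_compose_gen[OF inv h]) auto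
  moreover have "(A \<circ> inverse) holomorphic_on - {0}"
    by (rule holomorphic_on_compose_gen[OF inv A]) auto
  ultimately have B0: "B\<^sub>0 holomorphic_on UNIV - {0}"
    unfolding B\<^sub>0_def using holomorphic_on_diff[of "h \<circ> inverse" "- {0}" "A \<circ> inverse"]
    by (simp add: o_def Compl_eq_Diff_UNIV)
  have "\<forall>\<^sub>F u in at 0. u \<in> ball 0 1 - {0::complex}"
    using eventually_at_in_open[of "ball 0 1" "0::complex"] by simp
  then have ev: "\<forall>\<^sub>F u in at 0. norm (B\<^sub>0 u) \<le> M * norm u / (1 - norm u)"
  proof (rule eventually_mono)
    fix u :: complex assume u: "u \<in> ball 0 1 - {0}"
    have 1: "1 < norm (inverse u)" using u by (simp add: norm_inverse one_less_inverse)
    have "B\<^sub>0 u = - c (inverse u)" using u by (simp add: B\<^sub>0_def A_def)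
    then have "norm (B\<^sub>0 u) \<le> M / (norm (inverse u) - 1)" using c_le[OF 1] by simp
    also have "\<dots> = M * norm u / (1 - norm u)" 
    proof -
      have "norm u \<noteq> 0" "1 - norm u \<noteq> 0" using u by auto
      then show ?thesis unfolding norm_inverse by (simp add: field_simps)
    qed
    finally show "norm (B\<^sub>0 u) \<le> M * norm u / (1 - norm u)" .
  qed
  have "((\<lambda>u::complex. M * norm u / (1 - norm u)) \<longlongrightarrow> M * norm (0::complex) / (1 - norm (0::complex))) (at 0)"
    by (intro tendsto_intros) auto
  then have "(B\<^sub>0 \<longlongrightarrow> 0) (at 0)"
    by (intro Lim_null_comparison[OF ev]) simp
  from removable_singularity[OF B0 open_UNIV this]
  have B: "(\<lambda>u. if u = 0 then 0 else B\<^sub>0 u) holomorphic_on UNIV" .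
  show thesis
    by (rule that[OF A B]) (auto simp: B\<^sub>0_def)
qed

text \<open>
  Comparing Taylor coefficients, the \<open>j\<close>-th coefficient of \<open>A\<close> has to be divided by \<open>a ^ j - 1\<close>. Off the
  unit circle these divisors stay away from zero for \<open>j > 0\<close>, so no small-divisor problem arises.
\<close>

lemma entire_cohomological_equation:
  fixes A :: "complex \<Rightarrow> complex"
  assumes A: "A holomorphic_on UNIV" "A 0 = 0" and a: "norm a \<noteq> 1"
  obtains v where "v holomorphic_on UNIV" "\<forall>z. v (a * z) - v z = A z"
proof -
  define c where "c j = (deriv ^^ j) A 0 / fact j" for j
  have sums: "(\<lambda>j. c j * z ^ j) sums A z" for z
    using holomorphic_power_series[OF holomorphic_on_subset[OF A(1) subset_UNIV], of z 0 "norm z + 1"]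
    by (simp add: c_def)
  have c0: "c 0 = 0" using A(2) by (simp add: c_def)
  define \<delta> where "\<delta> = \<bar>norm a - 1\<bar>"
  have \<delta>: "\<delta> > 0" using a by (simp add: \<delta>_def)
  have gap: "\<delta> \<le> norm (a ^ j - 1)" if "j \<noteq> 0" for j
  proof -
    have "\<delta> \<le> \<bar>norm a ^ j - 1\<bar>"
    proof (cases "norm a < 1")
      case True
      then have "norm a ^ j \<le> norm a ^ 1" using that by (intro power_decreasing) auto
      then show ?thesis using True by (simp add: \<delta>_def)
    next
      case False
      then have "norm a ^ 1 \<le> norm a ^ j" using that by (intro power_increasing) auto
      then show ?thesis using False by (simp add: \<delta>_def)
    qed
    also have "\<dots> \<le> norm (a ^ j - 1)"
      using norm_triangle_ineq3[of "a ^ j" 1] by (simp add: norm_power)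
    finally show ?thesis .
  qed
  define d where "d j = c j / (a ^ j - 1)" for j
  have dc: "d j * (a ^ j - 1) = c j" for j
    using gap[of j] \<delta> c0 by (cases "j = 0") (auto simp: d_def)
  have d_le: "norm (d j) \<le> norm (c j) / \<delta>" for j
  proof (cases "j = 0")
    case False
    then show ?thesis unfolding d_def norm_divide using gap \<delta> by (intro frac_le) auto
  qed (simp add: d_def c0)
  have dsum: "summable (\<lambda>j. d j * z ^ j)" for z
  proof (rule summable_comparison_test')
    have "norm z < norm (of_real (norm z + 1) :: complex)" by (simp del: of_real_add)
    from powser_insidea[OF sums_summable[OF sums] this]
    have "summable (\<lambda>j. norm (c j * z ^ j))" .
    then show "summable (\<lambda>j. norm (c j * z ^ j) / \<delta>)" by (rule summable_divide)
    fix j :: nat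
    show "norm (d j * z ^ j) \<le> norm (c j * z ^ j) / \<delta>"
      using mult_right_mono[OF d_le[of j], of "norm (z ^ j)"] by (simp add: norm_mult)
  qed
  define v where "v z = (\<Sum>j. d j * z ^ j)" for z
  have vs: "(\<lambda>j. d j * z ^ j) sums v z" for z
    unfolding v_def by (rule summable_sums[OF dsum])
  have "v holomorphic_on ball 0 (real (Suc n))" for n
    by (rule power_series_holomorphic[where a = d]) (simp add: vs)
  then have "v holomorphic_on (\<Union>n. ball 0 (real (Suc n)))"
    by (intro holomorphic_on_UN_open) auto
  moreover have "z \<in> (\<Union>n. ball 0 (real (Suc n)))" for z :: complex
  proof -
    obtain n where "norm z < real n" using reals_Archimedean2 by blast
    then show ?thesis by (intro UN_I[of n]) auto
  qed
  then have "(\<Union>n. ball 0 (real (Suc n))) = (UNIV :: complex set)" by blast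
  ultimately have v: "v holomorphic_on UNIV" by simp
  show thesis
  proof (rule that[OF v], rule allI)
    fix z
    have "(\<lambda>j. d j * (a * z) ^ j - d j * z ^ j) sums (v (a * z) - v z)"
      by (intro sums_diff vs)
    moreover have "d j * (a * z) ^ j - d j * z ^ j = c j * z ^ j" for j
      unfolding dc[of j, symmetric] by (simp add: power_mult_distrib algebra_simps)
    ultimately have "(\<lambda>j. c j * z ^ j) sums (v (a * z) - v z)" by simp
    then show "v (a * z) - v z = A z" using sums by (rule sums_unique2)
  qed
qed

text \<open>
  Pulled back along the exponential function, \<open>\<omega>\<close> has an entire logarithm \<open>H\<close>. Over one period \<open>H\<close> grows by
  an integer multiple of the period, and this integer \<open>k\<close>, the winding number of \<open>\<omega>\<close> about the puncture,
  does not depend on the starting point. So \<open>H s - k * s\<close> is periodic and descends to the punctured plane.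
\<close>

lemma punctured_plane_nonzero_factorization:
  assumes \<omega>: "\<omega> holomorphic_on - {0}" "\<And>z. z \<noteq> 0 \<Longrightarrow> \<omega> z \<noteq> 0"
  obtains k :: int and h where "h holomorphic_on - {0}" "\<forall>z. z \<noteq> 0 \<longrightarrow> \<omega> z = z powi k * exp (h z)"
proof -
  define \<tau> where "\<tau> = 2 * of_real pi * \<i>"
  have \<tau>: "\<tau> \<noteq> 0" by (simp add: \<tau>_def)
  have exp\<tau>: "exp (s + \<tau>) = exp s" for s by (simp add: \<tau>_def exp_add mult_ac)
  have "(\<lambda>s. \<omega> (exp s)) holomorphic_on UNIV"
    by (rule holomorphic_on_compose_gen[OF holomorphic_on_exp \<omega>(1), unfolded o_def]) auto
  then obtain H where H: "H holomorphic_on UNIV" "\<And>s. exp (H s) = \<omega> (exp s)"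
    using holomorphic_logarithm_exists[of UNIV "\<lambda>s. \<omega> (exp s)" 0] \<omega>(2) by auto
  define D where "D s = (H (s + \<tau>) - H s) / \<tau>" for s
  have Hc: "continuous_on UNIV H" using H(1) by (rule holomorphic_on_imp_continuous_on)
  have Dc: "continuous_on UNIV D"
    unfolding D_def using \<tau> by (intro continuous_intros continuous_on_compose2[OF Hc] Hc) auto
  have Dint: "\<exists>n::int. D s = of_int n" for s
  proof -
    have "exp (H (s + \<tau>)) = exp (H s)" unfolding H(2) exp\<tau> ..
    then obtain n :: int where "H (s + \<tau>) = H s + (of_int (2 * n) * pi) * \<i>" unfolding exp_eq by blast
    then have "D s = of_int n" using \<tau> by (simp add: D_def \<tau>_def field_simps)
    then show ?thesis by blast
  qed
  have "D constant_on UNIV"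
  proof (rule continuous_discrete_range_constant[OF connected_UNIV Dc])
    fix s
    have "1 \<le> norm (D y - D s)" if "D y \<noteq> D s" for y
    proof -
      obtain m n :: int where mn: "D y = of_int m" "D s = of_int n" using Dint by metis
      then have "m \<noteq> n" using that by auto
      then have "1 \<le> \<bar>real_of_int (m - n)\<bar>" by linarith
      also have "\<dots> = norm (D y - D s)" unfolding mn by (metis norm_of_int of_int_diff)
      finally show ?thesis .
    qed
    then show "\<exists>e>0. \<forall>y. y \<in> UNIV \<and> D y \<noteq> D s \<longrightarrow> e \<le> norm (D y - D s)"
      by (intro exI[of _ 1]) auto
  qed
  then obtain k :: int where k: "D s = of_int k" for s
    using Dint unfolding constant_on_def by (metis UNIV_I)
  define P where "P s = H s - of_int k * s" for s
  have Pper1: "P (s + \<tau>) = P s" for s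
    using k[of s] \<tau> by (simp add: P_def D_def field_simps)
  have Pnat: "P (s + of_nat n * \<tau>) = P s" for s n
  proof (induction n)
    case (Suc n)
    have "P (s + of_nat (Suc n) * \<tau>) = P ((s + of_nat n * \<tau>) + \<tau>)" by (simp add: algebra_simps)
    then show ?case using Pper1 Suc.IH by simp
  qed simp
  have Pper: "P s = P t" if "exp s = exp t" for s t
  proof -
    obtain n :: int where "s = t + (of_int (2 * n) * pi) * \<i>" using \<open>exp s = exp t\<close> unfolding exp_eq by blast
    then have n: "s = t + of_int n * \<tau>" by (simp add: \<tau>_def mult_ac)
    show ?thesis
    proof (cases "n \<ge> 0")
      case True
      then have "s = t + of_nat (nat n) * \<tau>" using n by simp
      then show ?thesis using Pnat by simp
    next
      case False
      then have "t = s + of_nat (nat (- n)) * \<tau>" using n by simp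
      then show ?thesis using Pnat by simp
    qed
  qed
  have P: "P holomorphic_on UNIV" unfolding P_def using H(1) by (intro holomorphic_intros)
  define h where "h z = P (Ln z)" for z
  have h: "h holomorphic_on - {0}"
  proof (rule holomorphic_on_subset[of h "\<Union>x\<in>- {0}. ball x (norm x)"])
    show "h holomorphic_on (\<Union>x\<in>- {0}. ball x (norm x))"
    proof (rule holomorphic_on_UN_open)
      fix x :: complex assume x: "x \<in> - {0}"
      have pos: "0 < Re (z / x)" if "z \<in> ball x (norm x)" for z
      proof -
        have "norm (1 - z / x) < 1"
          using that x by (simp add: dist_norm diff_divide_eq_iff norm_divide)
        then show ?thesis using complex_Re_le_cmod[of "1 - z / x"] by simp
      qed
      then have nr: "z / x \<notin> \<real>\<^sub>\<le>\<^sub>0" if "z \<in> ball x (norm x)" for z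
        using that by (metis complex_nonpos_Reals_iff not_le)
      have "(\<lambda>z. Ln (z / x) + Ln x) holomorphic_on ball x (norm x)"
        using nr x by (intro holomorphic_intros) auto
      from holomorphic_on_compose_gen[OF this P]
      have "(\<lambda>z. P (Ln (z / x) + Ln x)) holomorphic_on ball x (norm x)" by (simp add: o_def)
      then show "h holomorphic_on ball x (norm x)"
      proof (rule holomorphic_transform)
        fix z assume z: "z \<in> ball x (norm x)"
        have z0: "z \<noteq> 0" using pos[OF z] by auto
        show "P (Ln (z / x) + Ln x) = h z"
          unfolding h_def using z0 x by (intro Pper) (simp add: exp_add)
      qed
    qed auto
    show "- {0} \<subseteq> (\<Union>x\<in>- {0}. ball x (norm x) :: complex set)" by force
  qed
  show thesis
  proof (rule that[OF h], intro allI impI)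
    fix z :: complex assume z: "z \<noteq> 0"
    have "\<omega> z = exp (H (Ln z))" using H(2)[of "Ln z"] z by simp
    also have "H (Ln z) = of_int k * Ln z + h z" by (simp add: h_def P_def)
    finally show "\<omega> z = z powi k * exp (h z)"
      using z exp_power_int[of "Ln z" k] by (simp add: exp_add)
  qed
qed

text \<open>
  Up to a coboundary \<open>u (a * z) / u z\<close>, a zero-free weight is a monomial. The exponential factor of
  the weight is removed by solving the cohomological equation separately for the two entire parts of
  its logarithm; the part in \<open>inverse z\<close> sees the dilation by \<open>inverse a\<close>.
\<close>

lemma punctured_plane_weight_normal_form:
  assumes \<omega>: "\<omega> holomorphic_on - {0}" "\<And>z. z \<noteq> 0 \<Longrightarrow> \<omega> z \<noteq> 0" and a: "a \<noteq> 0" "norm a \<noteq> 1"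
  obtains k :: int and c u where "c \<noteq> 0" "u holomorphic_on - {0}" "\<forall>z. u z \<noteq> 0"
    "\<forall>z. z \<noteq> 0 \<longrightarrow> \<omega> z * u (a * z) = c * z powi k * u z"
proof -
  obtain k :: int and h where h: "h holomorphic_on - {0}" "\<forall>z. z \<noteq> 0 \<longrightarrow> \<omega> z = z powi k * exp (h z)"
    by (rule punctured_plane_nonzero_factorization[OF \<omega>])
  obtain A B where AB: "A holomorphic_on UNIV" "B holomorphic_on UNIV" "B 0 = 0"
    "\<forall>z. z \<noteq> 0 \<longrightarrow> h z = A z + B (inverse z)"
    by (rule laurent_split[OF h(1)])
  have "(\<lambda>z. A 0 - A z) holomorphic_on UNIV" using AB(1) by (intro holomorphic_intros)
  then obtain v where v: "v holomorphic_on UNIV" "\<forall>z. v (a * z) - v z = A 0 - A z"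
    by (rule entire_cohomological_equation) (use a in auto)
  have "(\<lambda>z. - B z) holomorphic_on UNIV" using AB(2) by (intro holomorphic_intros)
  then obtain w where w: "w holomorphic_on UNIV" "\<forall>z. w (inverse a * z) - w z = - B z"
    by (rule entire_cohomological_equation[where a = "inverse a"]) (use a AB(3) in \<open>auto simp: norm_inverse\<close>)
  define u where "u z = exp (v z + w (inverse z))" for z
  have "(w \<circ> inverse) holomorphic_on - {0}"
    by (rule holomorphic_on_compose_gen[OF _ w(1)]) (auto intro!: holomorphic_intros)
  then have "u holomorphic_on - {0}"
    unfolding u_def using holomorphic_on_subset[OF v(1)]
    by (intro holomorphic_intros) (auto simp: o_def)
  moreover have "\<omega> z * u (a * z) = exp (A 0) * z powi k * u z" if z: "z \<noteq> 0" for z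
  proof -
    have "v (a * z) = v z + A 0 - A z" using v(2)[rule_format, of z] by (simp add: algebra_simps eq_diff_eq)
    moreover have "w (inverse (a * z)) = w (inverse z) - B (inverse z)"
      using w(2)[rule_format, of "inverse z"] by (simp add: algebra_simps eq_diff_eq)
    moreover have "h z = A z + B (inverse z)" using AB(4) z by blast
    ultimately have "h z + (v (a * z) + w (inverse (a * z))) = A 0 + (v z + w (inverse z))" by simp
    then have "exp (h z) * u (a * z) = exp (A 0) * u z" unfolding u_def by (simp add: exp_add[symmetric])
    then show ?thesis using h(2) z by (simp add: mult_ac)
  qed
  ultimately show thesis by (intro that[of "exp (A 0)" u k]) (auto simp: u_def)
qed

text \<open>
  The usual circle integral, written in the coordinate \<open>z = exp s\<close>. There the dilation by \<open>a\<close> is a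
  translation, and its effect on the coefficients follows from periodicity alone, with no
  deformation of contours.
\<close>

section \<open>Monomial weights: the condition is necessary\<close>

definition laurent_coeff :: "int \<Rightarrow> (complex \<Rightarrow> complex) \<Rightarrow> complex" where
  "laurent_coeff i f =
    contour_integral (linepath 0 (2 * of_real pi * \<i>)) (\<lambda>s. f (exp s) * exp (- (of_int i * s))) / (2 * of_real pi * \<i>)"

lemma continuous_on_laurent_integrand:
  assumes "f holomorphic_on - {0}"
  shows "continuous_on S (\<lambda>s. f (exp s) * exp (- (of_int i * s)))"
  by (intro continuous_intros continuous_on_compose2[OF holomorphic_on_imp_continuous_on[OF assms]]) auto

lemma laurent_coeff_primitive:
  assumes "f holomorphic_on - {0}"
  obtains P where "\<forall>s. (P has_field_derivative f (exp s) * exp (- (of_int i * s))) (at s)"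
proof -
  have "(\<lambda>s. f (exp s)) holomorphic_on UNIV"
    by (rule holomorphic_on_compose_gen[OF holomorphic_on_exp assms, unfolded o_def]) auto
  then have "(\<lambda>s. f (exp s) * exp (- (of_int i * s))) holomorphic_on UNIV"
    by (intro holomorphic_intros)
  from holomorphic_convex_primitive'[OF convex_UNIV open_UNIV this] show thesis
    using that by auto
qed

lemma laurent_coeff_eq:
  assumes "\<forall>s. (P has_field_derivative f (exp s) * exp (- (of_int i * s))) (at s)"
  shows "laurent_coeff i f = (P (2 * of_real pi * \<i>) - P 0) / (2 * of_real pi * \<i>)"
proof -
  have "((\<lambda>s. f (exp s) * exp (- (of_int i * s))) has_contour_integral
      (P (pathfinish (linepath 0 (2 * of_real pi * \<i>))) - P (pathstart (linepath 0 (2 * of_real pi * \<i>)))))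
      (linepath 0 (2 * of_real pi * \<i>))"
    by (rule contour_integral_primitive[OF _ valid_path_linepath, of UNIV]) (use assms in auto)
  from contour_integral_unique[OF this] show ?thesis by (simp add: laurent_coeff_def)
qed

text \<open>
  Both sides are increments of a primitive over one period, with different starting points.
\<close>

lemma laurent_coeff_dilation:
  assumes "f holomorphic_on - {0}" "a \<noteq> 0"
  shows "laurent_coeff i (\<lambda>z. f (a * z)) = a powi i * laurent_coeff i f"
proof -
  obtain P where P: "\<forall>s. (P has_field_derivative f (exp s) * exp (- (of_int i * s))) (at s)"
    by (rule laurent_coeff_primitive[OF assms(1)])
  define \<tau> where "\<tau> = 2 * of_real pi * \<i>"
  define \<alpha> where "\<alpha> = Ln a"
  have \<alpha>: "exp \<alpha> = a" using assms(2) by (simp add: \<alpha>_def)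
  have ai: "a powi i = exp (of_int i * \<alpha>)" using exp_power_int[of \<alpha> i] \<alpha> by simp
  have shift: "((\<lambda>s. P (s + b)) has_field_derivative f (exp (s + b)) * exp (- (of_int i * (s + b)))) (at s)" for s b
    using DERIV_shift[of P "f (exp (s + b)) * exp (- (of_int i * (s + b)))" s b] P by simp
  have "((\<lambda>s. a powi i * P (s + \<alpha>)) has_field_derivative f (a * exp s) * exp (- (of_int i * s))) (at s)" for s
  proof -
    have "a powi i * (f (exp (s + \<alpha>)) * exp (- (of_int i * (s + \<alpha>)))) = f (a * exp s) * exp (- (of_int i * s))"
    proof -
      have "exp (- (of_int i * (s + \<alpha>))) = exp (- (of_int i * s)) * exp (- (of_int i * \<alpha>))"
        by (simp add: exp_add[symmetric] algebra_simps)
      moreover have "exp (of_int i * \<alpha>) * exp (- (of_int i * \<alpha>)) = 1" by (simp add: exp_add[symmetric])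
      moreover have "exp (s + \<alpha>) = a * exp s" by (simp add: exp_add \<alpha>)
      ultimately show ?thesis unfolding ai by (simp add: mult_ac)
    qed
    then show ?thesis using DERIV_cmult[OF shift[where b = \<alpha> and s = s], of "a powi i"] by (simp only:)
  qed
  then have "laurent_coeff i (\<lambda>z. f (a * z)) = (a powi i * P (\<tau> + \<alpha>) - a powi i * P (0 + \<alpha>)) / \<tau>"
    unfolding \<tau>_def by (intro laurent_coeff_eq) simp
  \<comment> \<open>the integrand is periodic, so its integral over a period does not depend on the start\<close>
  moreover have "P (\<tau> + \<alpha>) - P (0 + \<alpha>) = P \<tau> - P 0"
  proof -
    have "exp (of_int i * \<tau>) = 1" "exp \<tau> = 1"
      unfolding \<tau>_def exp_eq_1 by auto
    then have per: "f (exp (s + \<tau>)) * exp (- (of_int i * (s + \<tau>))) = f (exp s) * exp (- (of_int i * s))" for s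
      by (simp only: distrib_left minus_add_distrib exp_add) (simp add: exp_minus)
    have "((\<lambda>s. P (s + \<tau>) - P s) has_field_derivative 0) (at s)" for s
      using DERIV_diff[OF shift[where b = \<tau> and s = s] P[rule_format, of s]] unfolding per by simp
    then obtain d where "\<forall>s\<in>UNIV. P (s + \<tau>) - P s = d"
      using has_field_derivative_zero_constant[OF convex_UNIV, of "\<lambda>s. P (s + \<tau>) - P s"] by auto
    then have "P (\<alpha> + \<tau>) - P \<alpha> = d" "P (0 + \<tau>) - P 0 = d" by blast+
    then have "P (\<alpha> + \<tau>) - P \<alpha> = P (0 + \<tau>) - P 0" by simp
    then show ?thesis by (simp add: add.commute)
  qed
  moreover have "laurent_coeff i f = (P \<tau> - P 0) / \<tau>"
    unfolding \<tau>_def by (rule laurent_coeff_eq[OF P])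
  ultimately show ?thesis by (metis right_diff_distrib times_divide_eq_right)
qed

lemma laurent_coeff_cong: "(\<And>z. z \<noteq> 0 \<Longrightarrow> f z = g z) \<Longrightarrow> laurent_coeff i f = laurent_coeff i g"
  by (simp add: laurent_coeff_def)

lemma laurent_coeff_power_mult: "laurent_coeff i (\<lambda>z. z powi k * f z) = laurent_coeff (i - k) f"
proof -
  have "exp s powi k * f (exp s) * exp (- (of_int i * s)) = f (exp s) * exp (- (of_int (i - k) * s))" for s
  proof -
    have "exp s powi k * exp (- (of_int i * s)) = exp (- (of_int (i - k) * s))"
      unfolding exp_power_int by (simp add: exp_add[symmetric] algebra_simps)
    then show ?thesis by (metis mult.commute mult.left_commute)
  qed
  then show ?thesis unfolding laurent_coeff_def by (simp only:)
qed

lemma laurent_coeff_cmult: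
  assumes "f holomorphic_on - {0}"
  shows "laurent_coeff i (\<lambda>z. c * f z) = c * laurent_coeff i f"
proof -
  have "(\<lambda>s. f (exp s) * exp (- (of_int i * s))) contour_integrable_on linepath 0 (2 * of_real pi * \<i>)"
    by (intro contour_integrable_continuous_linepath continuous_on_laurent_integrand assms)
  from contour_integral_lmul[OF this, of c] show ?thesis
    by (simp add: laurent_coeff_def mult.assoc)
qed

lemma laurent_coeff_diff:
  assumes "f holomorphic_on - {0}" "g holomorphic_on - {0}"
  shows "laurent_coeff i (\<lambda>z. f z - g z) = laurent_coeff i f - laurent_coeff i g"
proof -
  have "(\<lambda>s. h (exp s) * exp (- (of_int i * s))) contour_integrable_on linepath 0 (2 * of_real pi * \<i>)"
    if "h holomorphic_on - {0}" for h
    by (intro contour_integrable_continuous_linepath continuous_on_laurent_integrand that)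
  from contour_integral_diff[OF this[OF assms(1)] this[OF assms(2)]] show ?thesis
    by (simp add: laurent_coeff_def left_diff_distrib diff_divide_distrib)
qed

lemma laurent_coeff_bound:
  assumes "f holomorphic_on - {0}" "\<And>z. norm z = 1 \<Longrightarrow> norm (f z) \<le> B"
  shows "norm (laurent_coeff i f) \<le> B"
proof -
  let ?\<tau> = "2 * of_real pi * \<i>"
  have "0 \<le> B" using order_trans[OF norm_ge_zero assms(2)[of 1]] by simp
  have "norm (contour_integral (linepath 0 ?\<tau>) (\<lambda>s. f (exp s) * exp (- (of_int i * s)))) \<le> B * norm (?\<tau> - 0)"
  proof (rule contour_integral_bound_linepath)
    show "(\<lambda>s. f (exp s) * exp (- (of_int i * s))) contour_integrable_on linepath 0 ?\<tau>"
      by (intro contour_integrable_continuous_linepath continuous_on_laurent_integrand assms(1))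
    fix s assume "s \<in> closed_segment 0 ?\<tau>"
    then have "Re s = 0" by (auto simp: in_segment)
    then have "norm (exp s) = 1" "norm (exp (- (of_int i * s))) = 1" by simp_all
    then show "norm (f (exp s) * exp (- (of_int i * s))) \<le> B"
      using assms(2) by (simp add: norm_mult)
  qed fact
  then show ?thesis by (simp add: laurent_coeff_def norm_divide norm_mult field_simps)
qed

lemma laurent_coeff_powi: "laurent_coeff i (\<lambda>z. z powi p) = (if i = p then 1 else 0)"
proof -
  have "laurent_coeff i (\<lambda>z. z powi p) = laurent_coeff (i - p) (\<lambda>_. 1)"
    using laurent_coeff_power_mult[of i p "\<lambda>_. 1"] by simp
  also have "\<dots> = (if i = p then 1 else 0)"
  proof (cases "i = p")
    case True
    have "laurent_coeff 0 (\<lambda>_. 1) = (2 * of_real pi * \<i> - 0) / (2 * of_real pi * \<i>)"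
      by (rule laurent_coeff_eq[where P = "\<lambda>s. s"]) (auto intro!: derivative_eq_intros)
    then show ?thesis using True by simp
  next
    case False
    define m where "m = i - p"
    have m: "of_int m \<noteq> (0::complex)" using False by (simp add: m_def)
    have "laurent_coeff m (\<lambda>_. 1) = (exp (- (of_int m * (2 * of_real pi * \<i>))) / - of_int m -
        exp (- (of_int m * 0)) / - of_int m) / (2 * of_real pi * \<i>)"
      by (rule laurent_coeff_eq[where P = "\<lambda>s. exp (- (of_int m * s)) / - of_int m"])
        (use m in \<open>auto intro!: derivative_eq_intros\<close>)
    moreover have "exp (- (of_int m * (2 * of_real pi * \<i>))) = 1"
      unfolding exp_eq_1 by (auto intro!: exI[of _ "- m"])
    ultimately show ?thesis using False by (simp add: m_def)
  qed
  finally show ?thesis .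
qed

lemma dilation_holo_Aut:
  assumes "a \<noteq> 0"
  shows "(\<lambda>z. a * z) \<in> holo_Aut (- {0})"
proof -
  have "bij_betw (\<lambda>z. a * z) (- {0}) (- {0})"
    by (rule bij_betw_byWitness[where f' = "\<lambda>z. z / a"]) (use assms in auto)
  then show ?thesis by (auto simp: holo_Aut_def intro!: holomorphic_intros)
qed

lemma monomial_weight_holomorphic: "(\<lambda>z. c * z powi k) holomorphic_on - {0}"
  by (intro holomorphic_intros) auto

text \<open>
  On Laurent coefficients the operator is a weighted shift by \<open>k\<close>. The constant \<open>C\<close> depends on \<open>n\<close> but
  not on \<open>i\<close>, and it disappears when two coefficients of the same function are compared; so only the
  existence of a nonzero constant is recorded.
\<close>

lemma laurent_coeff_funpow:
  assumes "a \<noteq> 0" "c \<noteq> 0" "f \<in> holo (- {0})"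
  shows "\<exists>C. C \<noteq> 0 \<and> (\<forall>i. laurent_coeff i ((weighted_comp (- {0}) (\<lambda>z. c * z powi k) (\<lambda>z. a * z) ^^ n) f)
    = C * a powi (int n * i) * laurent_coeff (i - int n * k) f)"
proof (induction n)
  case 0
  show ?case by (intro exI[of _ 1]) simp
next
  case (Suc n)
  let ?T = "weighted_comp (- {0}) (\<lambda>z. c * z powi k) (\<lambda>z. a * z)"
  define g where "g = (?T ^^ n) f"
  have "g \<in> holo (- {0})"
    unfolding g_def by (rule funpow_weighted_comp_holo[OF monomial_weight_holomorphic dilation_holo_Aut assms(3)]) fact
  then have g: "g holomorphic_on - {0}" by (simp add: holo_def)
  obtain C where C: "C \<noteq> 0" "\<And>i. laurent_coeff i g = C * a powi (int n * i) * laurent_coeff (i - int n * k) f"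
    using Suc.IH unfolding g_def by blast
  have ga: "(\<lambda>z. g (a * z)) holomorphic_on - {0}"
    by (rule holomorphic_on_compose_gen[OF _ g, unfolded o_def]) (use assms(1) in \<open>auto intro!: holomorphic_intros\<close>)
  have zga: "(\<lambda>z. z powi k * g (a * z)) holomorphic_on - {0}"
    by (intro holomorphic_on_mult ga holomorphic_intros) auto
  have "laurent_coeff i ((?T ^^ Suc n) f) =
      (c * C * a powi (- k - int n * k)) * a powi (int (Suc n) * i) * laurent_coeff (i - int (Suc n) * k) f" for i
  proof -
    have "laurent_coeff i ((?T ^^ Suc n) f) = laurent_coeff i (\<lambda>z. c * (z powi k * g (a * z)))"
      by (rule laurent_coeff_cong) (simp add: weighted_comp_at g_def mult.assoc)
    also have "\<dots> = c * laurent_coeff (i - k) (\<lambda>z. g (a * z))"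
      unfolding laurent_coeff_cmult[OF zga] laurent_coeff_power_mult ..
    also have "\<dots> = c * (a powi (i - k) * (C * a powi (int n * (i - k)) * laurent_coeff (i - k - int n * k) f))"
      unfolding laurent_coeff_dilation[OF g assms(1)] C(2) ..
    also have "\<dots> = c * C * (a powi (i - k) * a powi (int n * (i - k))) * laurent_coeff (i - k - int n * k) f"
      by (simp add: mult_ac)
    also have "a powi (i - k) * a powi (int n * (i - k)) = a powi (- k - int n * k) * a powi (int (Suc n) * i)"
      using assms(1) by (simp add: power_int_add[symmetric] algebra_simps)
    also have "i - k - int n * k = i - int (Suc n) * k" by (simp add: algebra_simps)
    finally show ?thesis by (simp add: mult_ac)
  qed
  moreover have "c * C * a powi (- k - int n * k) \<noteq> 0" using assms(1,2) C(1) by simp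
  ultimately show ?case by blast
qed

lemma power_int_gt_1:
  fixes r :: real assumes "1 < r" "0 < j" shows "1 < r powi j"
proof -
  obtain m where "j = int m" "0 < m" using assms(2) by (metis pos_int_cases)
  then show ?thesis using assms(1) by (simp add: one_less_power)
qed

lemma power_int_le_1_iff:
  fixes r :: real assumes "0 < r" "r \<noteq> 1" "r powi j \<le> 1" "j \<noteq> 0"
  shows "1 < r \<longleftrightarrow> j < 0"
proof
  assume "1 < r"
  then show "j < 0" using power_int_gt_1[of r j] assms(3,4) by linarith
next
  assume j: "j < 0"
  show "1 < r"
  proof (rule ccontr)
    assume "\<not> 1 < r"
    then have "1 < inverse r" using assms(1,2) by (simp add: one_less_inverse)
    from power_int_gt_1[OF this, of "- j"] j have "1 < r powi j"
      by (simp add: power_int_minus power_int_inverse)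
    then show False using assms(3) by simp
  qed
qed

text \<open>
  The arithmetic core of the necessity of \<open>\<bar>a\<bar> powi k < 1\<close>, with \<open>r = \<bar>a\<bar>\<close>. The hypothesis \<open>dom\<close> says that
  among the coefficients of the iterate \<open>N p\<close>, the one of index \<open>p\<close> dominates. If the iterates for \<open>p\<close>
  and \<open>q\<close> draw on different coefficients of \<open>f\<close>, multiplying the two dominance inequalities for this
  pair cancels \<open>w\<close> and leaves
  \<open>4 * r powi ((n - m) * (q - p) + k * (n - m)\<^sup>2) \<le> 1\<close> with \<open>n = N p\<close> and \<open>m = N q\<close>; if they draw on the
  same one, \<open>(n - m) * (q - p) + k * (n - m)\<^sup>2 = 0\<close>. If \<open>r powi k \<ge> 1\<close>, both cases determine the sign of
  \<open>(n - m) * (q - p)\<close>. So \<open>N\<close> is strictly monotone on all integers, which is impossible for a function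
  with natural values.
\<close>

lemma no_dominant_coefficient_assignment:
  fixes r :: real and w :: "int \<Rightarrow> real" and N :: "int \<Rightarrow> nat" and k :: int
  assumes r: "0 < r" "r \<noteq> 1" and w: "\<And>i. 0 \<le> w i"
    and pos: "\<And>p. 0 < w (p - int (N p) * k)"
    and dom: "\<And>p i. i \<noteq> p \<Longrightarrow> 2 * (r powi (int (N p) * i) * w (i - int (N p) * k))
      \<le> r powi (int (N p) * p) * w (p - int (N p) * k)"
  shows "r powi k < 1"
proof (rule ccontr)
  assume "\<not> r powi k < 1"
  then have rk: "1 \<le> r powi k" by simp
  have mono: "N p \<noteq> N q \<and> (1 < r \<longleftrightarrow> N p < N q)" if pq: "p < q" for p q
  proof -
    define n m where "n = int (N p)" and "m = int (N q)"
    have neg: "r powi (- (k * (n - m)\<^sup>2)) \<le> 1"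
    proof -
      have "1 \<le> (r powi k) ^ nat ((n - m)\<^sup>2)" using rk by (rule one_le_power)
      also have "\<dots> = r powi (k * (n - m)\<^sup>2)"
        using power_int_mult[of r k "(n - m)\<^sup>2"] by (simp add: power_int_def[of "r powi k"])
      finally show ?thesis using r(1) by (simp add: power_int_minus inverse_le_1_iff)
    qed
    have "n \<noteq> m \<and> r powi ((n - m) * (q - p)) \<le> 1"
    proof (cases "p - n * k = q - m * k")
      case True
      then have qp: "q - p = k * (m - n)" by (simp add: algebra_simps)
      have "n \<noteq> m" using True pq by auto
      moreover have "(n - m) * (q - p) = - (k * (n - m)\<^sup>2)"
        unfolding qp by (simp add: power2_eq_square algebra_simps)
      ultimately show ?thesis using neg by simp
    next
      case False
      define x y where "x = w (p - n * k)" and "y = w (q - m * k)"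
      have xy: "0 < x" "0 < y" using pos[of p] pos[of q] by (auto simp: x_def y_def n_def m_def)
      have "2 * (r powi (n * (q - m * k + n * k)) * y) \<le> r powi (n * p) * x"
        using dom[of "q - m * k + n * k" p] False by (simp add: n_def m_def x_def y_def algebra_simps)
      moreover have "2 * (r powi (m * (p - n * k + m * k)) * x) \<le> r powi (m * q) * y"
        using dom[of "p - n * k + m * k" q] False by (simp add: n_def m_def x_def y_def algebra_simps)
      ultimately have "(2 * (r powi (n * (q - m * k + n * k)) * y)) * (2 * (r powi (m * (p - n * k + m * k)) * x))
          \<le> (r powi (n * p) * x) * (r powi (m * q) * y)"
        by (rule mult_mono) (use r(1) xy in auto)
      then have "4 * (r powi (n * (q - m * k + n * k)) * r powi (m * (p - n * k + m * k))) * (x * y)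
          \<le> r powi (n * p) * r powi (m * q) * (x * y)"
        by (simp add: mult_ac)
      then have "4 * (r powi (n * (q - m * k + n * k)) * r powi (m * (p - n * k + m * k))) \<le> r powi (n * p) * r powi (m * q)"
        using xy by simp
      then have "4 * r powi (n * (q - m * k + n * k) + m * (p - n * k + m * k)) \<le> r powi (n * p + m * q)"
        using r(1) by (simp add: power_int_add)
      moreover define X Y where "X = n * p + m * q" and "Y = (n - m) * (q - p) + k * (n - m)\<^sup>2"
      moreover have "n * (q - m * k + n * k) + m * (p - n * k + m * k) = X + Y"
        by (simp add: X_def Y_def power2_eq_square algebra_simps)
      ultimately have "4 * r powi (X + Y) \<le> r powi X" by (simp only:)
      then have "r powi X * (4 * r powi Y) \<le> r powi X * 1" using r(1) by (simp add: power_int_add)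
      then have E: "4 * r powi ((n - m) * (q - p) + k * (n - m)\<^sup>2) \<le> 1"
        unfolding Y_def[symmetric] by (rule mult_left_le_imp_le) (use r(1) in simp)
      have "n \<noteq> m" using E by auto
      have "r powi ((n - m) * (q - p)) =
          r powi ((n - m) * (q - p) + k * (n - m)\<^sup>2) * r powi (- (k * (n - m)\<^sup>2))"
        using r(1) by (simp add: power_int_add[symmetric])
      also have "\<dots> \<le> 1 * 1"
        using E neg r(1) by (intro mult_mono) auto
      finally show ?thesis using \<open>n \<noteq> m\<close> by simp
    qed
    then have nm: "n \<noteq> m" and le: "r powi ((n - m) * (q - p)) \<le> 1" by auto
    from power_int_le_1_iff[OF r le] nm pq have "1 < r \<longleftrightarrow> (n - m) * (q - p) < 0" by auto
    also have "\<dots> \<longleftrightarrow> n < m" using pq by (auto simp: mult_less_0_iff)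
    finally show ?thesis using nm by (simp add: n_def m_def)
  qed
  \<comment> \<open>N would be a strictly monotone function from the integers to the naturals\<close>
  define s :: int where "s = (if 1 < r then - 1 else 1)"
  have step: "N (s * int (Suc i)) < N (s * int i)" for i
  proof (cases "1 < r")
    case True
    then have s: "s = - 1" by (simp add: s_def)
    then have "s * int (Suc i) < s * int i" by simp
    from mono[OF this] show ?thesis using True by blast
  next
    case False
    then have s: "s = 1" by (simp add: s_def)
    then have "s * int i < s * int (Suc i)" by simp
    from mono[OF this] show ?thesis using False by linarith
  qed
  have "N (s * int i) + i \<le> N 0" for i
  proof (induction i)
    case (Suc i)
    then show ?case using step[of i] by linarith
  qed simp
  from this[of "Suc (N 0)"] show False by linarith
qed

text \<open>
  For every integer \<open>p\<close>, some multiple of an iterate of the supercyclic vector is close to \<open>z powi p\<close> on the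
  unit circle, so that its coefficient of index \<open>p\<close> dominates all others.
\<close>

lemma supercyclic_monomial_weight_imp:
  assumes "a \<noteq> 0" "norm a \<noteq> 1" "c \<noteq> 0"
    and super: "supercyclic (holo_topology (- {0})) fscale (weighted_comp (- {0}) (\<lambda>z. c * z powi k) (\<lambda>z. a * z))"
  shows "norm (a powi k) < 1"
proof -
  let ?T = "weighted_comp (- {0}) (\<lambda>z. c * z powi k) (\<lambda>z. a * z)"
  have opn: "open (- {0::complex})" by auto
  note hol = monomial_weight_holomorphic dilation_holo_Aut[OF assms(1)]
  obtain f where f1: "f \<in> holo (- {0})" and f2: "\<forall>g\<in>holo (- {0}). \<forall>K e. compact K \<and> K \<subseteq> - {0} \<and> 0 < (e::real) \<longrightarrow>
      (\<exists>c n. \<forall>z\<in>K. norm (c * (?T ^^ n) f z - g z) < e)"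
    by (rule bexE[OF supercyclic_vector_approximates[OF opn hol super]])
  define w where "w i = norm (laurent_coeff i f)" for i
  define r where "r = norm a"
  have "\<exists>n. 0 < w (p - int n * k) \<and> (\<forall>i. i \<noteq> p \<longrightarrow>
      2 * (r powi (int n * i) * w (i - int n * k)) \<le> r powi (int n * p) * w (p - int n * k))" for p
  proof -
    define g where "g z = (if z = 0 then 0 else z powi p :: complex)" for z
    have "g holomorphic_on - {0}"
      by (rule holomorphic_transform[of "\<lambda>z. z powi p"]) (auto simp: g_def intro!: holomorphic_intros)
    then have g: "g \<in> holo (- {0})" by (simp add: holo_def g_def)
    have "\<exists>\<mu> n. \<forall>z\<in>sphere 0 1. norm (\<mu> * (?T ^^ n) f z - g z) < 1/3"
      using g by (intro f2[rule_format]) auto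
    then obtain \<mu> n where \<mu>0: "\<forall>z\<in>sphere 0 1. norm (\<mu> * (?T ^^ n) f z - g z) < 1/3" by blast
    have \<mu>: "norm (\<mu> * (?T ^^ n) f z - g z) < 1/3" if "norm z = 1" for z
      using \<mu>0 that by simp
    define h where "h = (?T ^^ n) f"
    have "h \<in> holo (- {0})" unfolding h_def by (rule funpow_weighted_comp_holo[OF hol f1])
    then have h: "h holomorphic_on - {0}" by (simp add: holo_def)
    then have \<mu>h: "(\<lambda>z. \<mu> * h z) holomorphic_on - {0}" by (intro holomorphic_intros)
    obtain C where C: "C \<noteq> 0" "\<And>i. laurent_coeff i h = C * a powi (int n * i) * laurent_coeff (i - int n * k) f"
      using laurent_coeff_funpow[OF assms(1,3) f1, where k = k and n = n] unfolding h_def by blast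
    define x where "x i = norm (\<mu> * C) * (r powi (int n * i) * w (i - int n * k))" for i
    have x: "x i = norm (\<mu> * laurent_coeff i h)" for i
      unfolding x_def C(2) r_def w_def by (simp add: norm_mult norm_power_int mult_ac)
    have close: "norm (\<mu> * laurent_coeff i h - (if i = p then 1 else 0)) \<le> 1/3" for i
    proof -
      have "laurent_coeff i g = (if i = p then 1 else 0)"
        unfolding laurent_coeff_powi[symmetric] by (rule laurent_coeff_cong) (simp add: g_def)
      moreover have "norm (laurent_coeff i (\<lambda>z. \<mu> * h z - g z)) \<le> 1/3"
      proof (rule laurent_coeff_bound)
        show "(\<lambda>z. \<mu> * h z - g z) holomorphic_on - {0}"
          using \<mu>h \<open>g holomorphic_on - {0}\<close> by (rule holomorphic_on_diff)
        show "norm (\<mu> * h z - g z) \<le> 1/3" if "norm z = 1" for z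
          using \<mu>[OF that] unfolding h_def by simp
      qed
      ultimately show ?thesis
        unfolding laurent_coeff_diff[OF \<mu>h \<open>g holomorphic_on - {0}\<close>] laurent_coeff_cmult[OF h] by simp
    qed
    have xp: "2/3 \<le> x p"
      using close[of p] norm_triangle_ineq2[of 1 "\<mu> * laurent_coeff p h"] unfolding x by (simp add: norm_minus_commute)
    have xi: "x i \<le> 1/3" if "i \<noteq> p" for i using close[of i] that unfolding x by simp
    have r0: "0 < r" using assms(1) by (simp add: r_def)
    have \<mu>C: "0 < norm (\<mu> * C)"
    proof (rule ccontr)
      assume "\<not> 0 < norm (\<mu> * C)"
      then have "x p = 0" unfolding x_def by simp
      then show False using xp by simp
    qed
    show ?thesis
    proof (intro exI[of _ n] conjI allI impI)
      have "w (p - int n * k) \<noteq> 0" using xp by (auto simp: x_def)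
      then show "0 < w (p - int n * k)" unfolding w_def by simp
      fix i assume "i \<noteq> p"
      then have "2 * x i \<le> x p" using xp xi by fastforce
      then have "norm (\<mu> * C) * (2 * (r powi (int n * i) * w (i - int n * k)))
          \<le> norm (\<mu> * C) * (r powi (int n * p) * w (p - int n * k))"
        unfolding x_def by (simp add: mult_ac)
      then show "2 * (r powi (int n * i) * w (i - int n * k)) \<le> r powi (int n * p) * w (p - int n * k)"
        using \<mu>C by (rule mult_left_le_imp_le)
    qed
  qed
  then obtain N where N: "\<And>p. 0 < w (p - int (N p) * k)"
    "\<And>p i. i \<noteq> p \<Longrightarrow> 2 * (r powi (int (N p) * i) * w (i - int (N p) * k))
      \<le> r powi (int (N p) * p) * w (p - int (N p) * k)"
    by metis
  have "r powi k < 1"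
    by (rule no_dominant_coefficient_assignment[where w = w and N = N])
      (use assms(1,2) N in \<open>auto simp: r_def w_def\<close>)
  then show ?thesis by (simp add: r_def norm_power_int)
qed

section \<open>Monomial weights: the condition is sufficient\<close>

definition laurent_poly :: "int set \<Rightarrow> (int \<Rightarrow> complex) \<Rightarrow> complex \<Rightarrow> complex" where
  "laurent_poly F b z = (if z = 0 then 0 else \<Sum>j\<in>F. b j * z powi j)"

lemma laurent_poly_holo: "laurent_poly F b \<in> holo (- {0})"
proof -
  have "(\<lambda>z. \<Sum>j\<in>F. b j * z powi j) holomorphic_on - {0}"
    by (intro holomorphic_intros) auto
  then have "laurent_poly F b holomorphic_on - {0}"
    by (rule holomorphic_transform) (simp add: laurent_poly_def)
  then show ?thesis by (simp add: holo_def laurent_poly_def)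
qed

lemma entire_polynomial_approximation:
  assumes A: "A holomorphic_on UNIV" and e: "0 < (e::real)"
  obtains n c where "\<forall>z. norm z \<le> R \<longrightarrow> norm ((\<Sum>j<n. c j * z ^ j) - A z) < e"
proof -
  define c where "c j = (deriv ^^ j) A 0 / fact j" for j
  have sums: "(\<lambda>j. c j * z ^ j) sums A z" for z
    using holomorphic_power_series[OF holomorphic_on_subset[OF A subset_UNIV], of z 0 "norm z + 1"]
    by (simp add: c_def)
  define R' where "R' = max R 0"
  have "norm (of_real R' :: complex) < norm (of_real (R' + 1) :: complex)"
    by (simp add: R'_def del: of_real_add)
  from powser_insidea[OF sums_summable[OF sums] this]
  have M: "summable (\<lambda>j. norm (c j * of_real R' ^ j))" .
  have "uniform_limit (cball 0 R) (\<lambda>n z. \<Sum>j<n. c j * z ^ j) (\<lambda>z. \<Sum>j. c j * z ^ j) sequentially"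
  proof (rule Weierstrass_m_test[OF _ M])
    fix n and z :: complex assume "z \<in> cball 0 R"
    then have "norm z \<le> R'" by (simp add: R'_def)
    then have "norm z ^ n \<le> R' ^ n" by (intro power_mono) auto
    then show "norm (c n * z ^ n) \<le> norm (c n * of_real R' ^ n)"
      by (simp add: norm_mult norm_power R'_def mult_left_mono)
  qed
  from uniform_limitD[OF this e]
  have "\<forall>\<^sub>F n in sequentially. \<forall>z\<in>cball 0 R. norm ((\<Sum>j<n. c j * z ^ j) - A z) < e"
    using sums_unique[OF sums, symmetric] by (simp add: dist_norm)
  then obtain n where "\<forall>z\<in>cball 0 R. norm ((\<Sum>j<n. c j * z ^ j) - A z) < e"
    using eventually_happens'[OF sequentially_bot] by blast
  then show thesis by (intro that[of c n]) auto
qed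

lemma compact_punctured_plane_bound:
  fixes K :: "complex set"
  assumes "compact K" "K \<subseteq> - {0}"
  obtains R where "1 \<le> R" "\<forall>z\<in>K. norm z \<le> R \<and> norm (inverse z) \<le> R"
proof -
  have "continuous_on K inverse" using assms(2) by (intro continuous_intros) auto
  then have "bounded (inverse ` K)" using assms(1) by (intro compact_imp_bounded compact_continuous_image)
  then obtain b where b: "\<forall>x\<in>inverse ` K. norm x \<le> b" unfolding bounded_iff by blast
  obtain d where d: "\<forall>x\<in>K. norm x \<le> d" using compact_imp_bounded[OF assms(1)] unfolding bounded_iff by blast
  show thesis
    by (rule that[of "max 1 (max b d)"]) (use b d in auto)
qed

text \<open>
  Taylor polynomials of the two entire parts of a function approximate it uniformly on compact sets.
\<close>

lemma laurent_polys_dense: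
  "holo_topology (- {0}) closure_of {laurent_poly F b |F b. finite F} = holo (- {0})"
proof (subst holo_dense_iff)
  show "{laurent_poly F b |F b. finite F} \<subseteq> holo (- {0})" using laurent_poly_holo by blast
  show "\<forall>g\<in>holo (- {0}). \<forall>K e. compact K \<and> K \<subseteq> - {0} \<and> 0 < (e::real) \<longrightarrow>
      (\<exists>s\<in>{laurent_poly F b |F b. finite F}. \<forall>z\<in>K. norm (s z - g z) < e)"
  proof (intro ballI allI impI, elim conjE)
    fix g and K :: "complex set" and e :: real
    assume g: "g \<in> holo (- {0})" and K: "compact K" "K \<subseteq> - {0}" and e: "0 < e"
    obtain R where R: "\<forall>z\<in>K. norm z \<le> R \<and> norm (inverse z) \<le> R"
      using compact_punctured_plane_bound[OF K] by metis
    have "g holomorphic_on - {0}" using g by (simp add: holo_def)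
    then obtain A B where AB: "A holomorphic_on UNIV" "B holomorphic_on UNIV" "B 0 = 0"
      "\<forall>z. z \<noteq> 0 \<longrightarrow> g z = A z + B (inverse z)"
      by (rule laurent_split)
    have e2: "0 < e / 2" using e by simp
    obtain n c where c: "\<forall>z. norm z \<le> R \<longrightarrow> norm ((\<Sum>j<n. c j * z ^ j) - A z) < e / 2"
      by (rule entire_polynomial_approximation[OF AB(1) e2])
    obtain m d where d: "\<forall>z. norm z \<le> R \<longrightarrow> norm ((\<Sum>j<m. d j * z ^ j) - B z) < e / 2"
      by (rule entire_polynomial_approximation[OF AB(2) e2])
    \<comment> \<open>the coefficient of index 0 collects the constant terms of both polynomials, and F contains 0
      even if one of them is the empty sum\<close>
    define b where "b i = (if 0 \<le> i \<and> i < int n then c (nat i) else 0) + (if i \<le> 0 \<and> - int m < i then d (nat (- i)) else 0)" for i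
    define F where "F = {- int m<..<int n} \<union> {0}"
    have finF: "finite F" by (simp add: F_def)
    have lp: "laurent_poly F b z = (\<Sum>j<n. c j * z ^ j) + (\<Sum>j<m. d j * inverse z ^ j)" if z: "z \<noteq> 0" for z
    proof -
      have "laurent_poly F b z = (\<Sum>i\<in>F. if 0 \<le> i \<and> i < int n then c (nat i) * z powi i else 0)
          + (\<Sum>i\<in>F. if i \<le> 0 \<and> - int m < i then d (nat (- i)) * z powi i else 0)"
        using z unfolding laurent_poly_def b_def by (simp add: sum.distrib[symmetric] distrib_right if_distrib[of "\<lambda>x. x * _"] cong: if_cong)
      also have "(\<Sum>i\<in>F. if 0 \<le> i \<and> i < int n then c (nat i) * z powi i else 0) = (\<Sum>j<n. c j * z ^ j)"
      proof -
        have "(\<Sum>i\<in>F. if 0 \<le> i \<and> i < int n then c (nat i) * z powi i else 0)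
            = (\<Sum>i\<in>{i\<in>F. 0 \<le> i \<and> i < int n}. c (nat i) * z powi i)"
          by (rule sum.inter_filter[OF finF, symmetric])
        also have "\<dots> = (\<Sum>j<n. c j * z ^ j)"
          by (rule sum.reindex_bij_witness[of _ int nat]) (auto simp: F_def power_int_def)
        finally show ?thesis .
      qed
      also have "(\<Sum>i\<in>F. if i \<le> 0 \<and> - int m < i then d (nat (- i)) * z powi i else 0) = (\<Sum>j<m. d j * inverse z ^ j)"
      proof -
        have "(\<Sum>i\<in>F. if i \<le> 0 \<and> - int m < i then d (nat (- i)) * z powi i else 0)
            = (\<Sum>i\<in>{i\<in>F. i \<le> 0 \<and> - int m < i}. d (nat (- i)) * z powi i)"
          by (rule sum.inter_filter[OF finF, symmetric])
        also have "\<dots> = (\<Sum>j<m. d j * inverse z ^ j)"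
          by (rule sum.reindex_bij_witness[of _ "\<lambda>j. - int j" "\<lambda>i. nat (- i)"])
            (auto simp: F_def power_int_def)
        finally show ?thesis .
      qed
      finally show ?thesis .
    qed
    have "norm (laurent_poly F b z - g z) < e" if z: "z \<in> K" for z
    proof -
      have z0: "z \<noteq> 0" using z K(2) by blast
      have "laurent_poly F b z - g z = ((\<Sum>j<n. c j * z ^ j) - A z) + ((\<Sum>j<m. d j * inverse z ^ j) - B (inverse z))"
        using lp[OF z0] AB(4) z0 by simp
      also have "norm \<dots> < e / 2 + e / 2"
      proof (rule norm_add_less)
        show "norm ((\<Sum>j<n. c j * z ^ j) - A z) < e / 2" using c R z by blast
        show "norm ((\<Sum>j<m. d j * inverse z ^ j) - B (inverse z)) < e / 2" using d R z by blast
      qed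
      finally show ?thesis by simp
    qed
    then show "\<exists>s\<in>{laurent_poly F b |F b. finite F}. \<forall>z\<in>K. norm (s z - g z) < e"
      using finF by blast
  qed
qed auto

lemma monomial_weight_laurent_poly:
  assumes "a \<noteq> 0"
  shows "weighted_comp (- {0}) (\<lambda>z. c * z powi k) (\<lambda>z. a * z) (laurent_poly F b)
    = laurent_poly ((\<lambda>j. j + k) ` F) (\<lambda>i. b (i - k) * (c * a powi (i - k)))"
proof
  fix z
  show "weighted_comp (- {0}) (\<lambda>z. c * z powi k) (\<lambda>z. a * z) (laurent_poly F b) z
    = laurent_poly ((\<lambda>j. j + k) ` F) (\<lambda>i. b (i - k) * (c * a powi (i - k))) z"
  proof (cases "z = 0")
    case False
    have "(\<Sum>i\<in>(\<lambda>j. j + k) ` F. b (i - k) * (c * a powi (i - k)) * z powi i)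
        = (\<Sum>j\<in>F. b j * (c * a powi j) * z powi (j + k))"
      by (subst sum.reindex) (auto simp: inj_on_def)
    also have "\<dots> = c * z powi k * (\<Sum>j\<in>F. b j * (a * z) powi j)"
      unfolding sum_distrib_left using False assms
      by (intro sum.cong) (simp_all add: power_int_add power_int_mult_distrib mult_ac)
    finally show ?thesis using False assms by (simp add: weighted_comp_at laurent_poly_def)
  qed (simp add: weighted_comp_def laurent_poly_def)
qed

lemma monomial_weight_funpow_laurent_poly:
  assumes "a \<noteq> 0" "z \<noteq> 0"
  shows "(weighted_comp (- {0}) (\<lambda>z. c * z powi k) (\<lambda>z. a * z) ^^ n) (laurent_poly F b) z
    = (\<Sum>j\<in>F. b j * (\<Prod>i<n. c * a powi (j + int i * k)) * z powi (j + int n * k))"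
  using assms(2)
proof (induction n arbitrary: z)
  case (Suc n)
  let ?\<kappa> = "\<lambda>j n. \<Prod>i<n. c * a powi (j + int i * k)"
  have az: "a * z \<noteq> 0" using Suc.prems assms(1) by simp
  have "(weighted_comp (- {0}) (\<lambda>z. c * z powi k) (\<lambda>z. a * z) ^^ Suc n) (laurent_poly F b) z
      = c * z powi k * (\<Sum>j\<in>F. b j * ?\<kappa> j n * (a * z) powi (j + int n * k))"
    using Suc.IH[OF az] Suc.prems by (simp add: weighted_comp_at)
  also have "\<dots> = (\<Sum>j\<in>F. b j * ?\<kappa> j (Suc n) * z powi (j + int (Suc n) * k))"
    unfolding sum_distrib_left
  proof (intro sum.cong refl)
    fix j
    have "z powi (j + int (Suc n) * k) = z powi k * z powi (j + int n * k)"
      using Suc.prems by (simp add: power_int_add[symmetric] algebra_simps)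
    then show "c * z powi k * (b j * ?\<kappa> j n * (a * z) powi (j + int n * k))
        = b j * ?\<kappa> j (Suc n) * z powi (j + int (Suc n) * k)"
      by (simp add: power_int_mult_distrib mult_ac)
  qed
  finally show ?case .
qed (simp add: laurent_poly_def)

lemma norm_power_int_le:
  fixes z :: complex
  assumes "norm z \<le> R" "norm (inverse z) \<le> R"
  shows "norm (z powi i) \<le> R ^ nat \<bar>i\<bar>"
proof (cases "0 \<le> i")
  case True
  then show ?thesis using assms(1) by (simp add: power_int_def norm_power power_mono)
next
  case False
  then show ?thesis using assms(2) by (simp add: power_int_def norm_power power_mono)
qed

text \<open>
  The \<open>n\<close>-th iterate multiplies \<open>z powi j\<close> by \<open>z powi (n * k)\<close> and by a product whose \<open>i\<close>-th factor is proportional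
  to \<open>a powi (i * k)\<close>. By the smallness of \<open>a powi k\<close> this product decays faster than any geometric sequence
  and beats the bound \<open>Q ^ n\<close> for the power of \<open>z\<close> on a compact set.
\<close>

lemma monomial_weight_unconditionally_convergent:
  assumes a: "a \<noteq> 0" and small: "norm (a powi k) < 1" and F: "finite F"
  shows "unconditionally_convergent_in (holo_topology (- {0}))
    (\<lambda>n. (weighted_comp (- {0}) (\<lambda>z. c * z powi k) (\<lambda>z. a * z) ^^ Suc n) (laurent_poly F b))"
proof (rule holo_unconditionally_convergent)
  let ?T = "weighted_comp (- {0}) (\<lambda>z. c * z powi k) (\<lambda>z. a * z)"
  show "(?T ^^ Suc n) (laurent_poly F b) \<in> holo (- {0})" for n
    by (rule funpow_weighted_comp_holo[OF monomial_weight_holomorphic dilation_holo_Aut[OF a] laurent_poly_holo])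
  fix K :: "complex set" assume K: "compact K" "K \<subseteq> - {0}"
  obtain R where R: "1 \<le> R" "\<forall>z\<in>K. norm z \<le> R \<and> norm (inverse z) \<le> R"
    by (rule compact_punctured_plane_bound[OF K])
  define Q where "Q = R ^ nat \<bar>k\<bar>"
  define \<kappa> where "\<kappa> j n = (\<Prod>i<n. c * a powi (j + int i * k))" for j n
  define M where "M n = (\<Sum>j\<in>F. norm (b j) * R ^ nat \<bar>j\<bar> * (norm (\<kappa> j n) * Q ^ n))" for n
  have Q0: "0 \<le> Q" using R(1) by (simp add: Q_def)
  have "summable (\<lambda>n. norm (\<kappa> j n) * Q ^ n)" for j
  proof -
    define q where "q = norm c * norm (a powi j) * Q"
    have step: "norm (\<kappa> j (Suc n)) * Q ^ Suc n = (q * norm (a powi k) ^ n) * (norm (\<kappa> j n) * Q ^ n)" for n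
    proof -
      have "a powi (j + int n * k) = a powi j * (a powi k) ^ n"
        using a by (simp add: power_int_add power_int_mult mult.commute[of "int n"])
      then show ?thesis by (simp add: \<kappa>_def q_def norm_mult norm_power mult_ac)
    qed
    have "(\<lambda>n. q * norm (a powi k) ^ n) \<longlonglongrightarrow> q * 0"
      using small by (intro tendsto_mult tendsto_const LIMSEQ_power_zero) simp
    then have "\<forall>\<^sub>F n in sequentially. q * norm (a powi k) ^ n < 1/2"
      by (intro order_tendstoD(2)) auto
    then obtain N where N: "\<And>n. N \<le> n \<Longrightarrow> q * norm (a powi k) ^ n < 1/2"
      unfolding eventually_sequentially by blast
    show ?thesis
    proof (rule summable_ratio_test)
      show "(1/2::real) < 1" by simp
      fix n assume "N \<le> n"
      have nn: "0 \<le> norm (\<kappa> j m) * Q ^ m" for m using Q0 by simp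
      show "norm (norm (\<kappa> j (Suc n)) * Q ^ Suc n) \<le> 1/2 * norm (norm (\<kappa> j n) * Q ^ n)"
        unfolding real_norm_def abs_of_nonneg[OF nn] unfolding step
        using N[OF \<open>N \<le> n\<close>] by (intro mult_right_mono nn) simp
    qed
  qed
  then have "summable M" unfolding M_def by (intro summable_sum summable_mult)
  then have "summable (\<lambda>n. M (Suc n))" by (simp only: summable_Suc_iff)
  moreover have "norm ((?T ^^ n) (laurent_poly F b) z) \<le> M n" if z: "z \<in> K" for n z
  proof -
    have z0: "z \<noteq> 0" using z K(2) by blast
    have "norm (b j * \<kappa> j n * z powi (j + int n * k)) \<le> norm (b j) * R ^ nat \<bar>j\<bar> * (norm (\<kappa> j n) * Q ^ n)" for j
    proof -
      have "norm (z powi (j + int n * k)) \<le> R ^ nat \<bar>j + int n * k\<bar>"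
        using R(2) z by (intro norm_power_int_le) auto
      also have "\<dots> \<le> R ^ (nat \<bar>j\<bar> + nat \<bar>k\<bar> * n)"
      proof (rule power_increasing[OF _ R(1)])
        have "\<bar>j + int n * k\<bar> \<le> \<bar>j\<bar> + int n * \<bar>k\<bar>"
          using abs_triangle_ineq[of j "int n * k"] by (simp add: abs_mult)
        then have "nat \<bar>j + int n * k\<bar> \<le> nat (\<bar>j\<bar> + int n * \<bar>k\<bar>)" by (rule nat_mono)
        also have "\<dots> = nat \<bar>j\<bar> + nat \<bar>k\<bar> * n" by (simp add: nat_add_distrib nat_mult_distrib)
        finally show "nat \<bar>j + int n * k\<bar> \<le> nat \<bar>j\<bar> + nat \<bar>k\<bar> * n" .
      qed
      also have "\<dots> = R ^ nat \<bar>j\<bar> * Q ^ n" by (simp add: Q_def power_add power_mult)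
      finally have "norm (b j) * norm (\<kappa> j n) * norm (z powi (j + int n * k))
          \<le> norm (b j) * norm (\<kappa> j n) * (R ^ nat \<bar>j\<bar> * Q ^ n)"
        by (intro mult_left_mono) auto
      then show ?thesis by (simp add: norm_mult mult_ac)
    qed
    then show ?thesis
      unfolding monomial_weight_funpow_laurent_poly[OF a z0] \<kappa>_def[symmetric] M_def
      by (intro order_trans[OF norm_sum] sum_mono)
  qed
  ultimately show "\<exists>M. summable M \<and> (\<forall>n. \<forall>z\<in>K. norm ((?T ^^ Suc n) (laurent_poly F b) z) \<le> M n)"
    by blast
qed auto

text \<open>
  The inverse operator has the same shape, with \<open>k\<close> and \<open>a\<close> replaced by \<open>- k\<close> and \<open>inverse a\<close>. The
  condition on \<open>a powi k\<close> is invariant under this replacement, so one convergence lemma settles both series.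
\<close>

lemma monomial_weight_frequent_hypercyclicity_criterion:
  assumes a: "a \<noteq> 0" and c: "c \<noteq> 0" and small: "norm (a powi k) < 1"
  shows "frequent_hypercyclicity_criterion (holo_topology (- {0}))
    (weighted_comp (- {0}) (\<lambda>z. c * z powi k) (\<lambda>z. a * z))"
proof -
  let ?T = "weighted_comp (- {0}) (\<lambda>z. c * z powi k) (\<lambda>z. a * z)"
  let ?S = "weighted_comp (- {0}) (\<lambda>z. (a powi k / c) * z powi (- k)) (\<lambda>z. inverse a * z)"
  let ?X = "{laurent_poly F b |F b. finite F}"
  have a': "inverse a \<noteq> 0" using a by simp
  have small': "norm (inverse a powi (- k)) < 1" using small by (simp add: power_int_minus power_int_inverse)
  have "?S f \<in> ?X" if "f \<in> ?X" for f
  proof -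
    obtain F b where f: "f = laurent_poly F b" "finite F" using \<open>f \<in> ?X\<close> by blast
    show ?thesis unfolding f(1) monomial_weight_laurent_poly[OF a'] using f(2) by blast
  qed
  moreover have "?T (?S f) = f" if "f \<in> ?X" for f
  proof
    fix z
    have "f \<in> holo (- {0})" using that laurent_poly_holo by blast
    then have f0: "f 0 = 0" by (simp add: holo_def)
    show "?T (?S f) z = f z"
    proof (cases "z = 0")
      case False
      have "?T (?S f) z = c * z powi k * (a powi k / c * (a * z) powi (- k)) * f (inverse a * (a * z))"
        using False a by (simp add: weighted_comp_at)
      also have "c * z powi k * (a powi k / c * (a * z) powi (- k)) = 1"
        using False a c by (simp add: power_int_minus power_int_mult_distrib field_simps)
      also have "inverse a * (a * z) = z" using a by simp
      finally show ?thesis by simp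
    qed (use f0 in \<open>simp add: weighted_comp_def\<close>)
  qed
  moreover have "?X \<subseteq> topspace (holo_topology (- {0}))" using laurent_poly_holo by auto
  moreover have "unconditionally_convergent_in (holo_topology (- {0})) (\<lambda>n. (?T ^^ Suc n) f)"
    if "f \<in> ?X" for f
  proof -
    obtain F b where f: "f = laurent_poly F b" "finite F" using \<open>f \<in> ?X\<close> by blast
    show ?thesis unfolding f(1) by (rule monomial_weight_unconditionally_convergent[OF a small f(2)])
  qed
  moreover have "unconditionally_convergent_in (holo_topology (- {0})) (\<lambda>n. (?S ^^ Suc n) f)"
    if "f \<in> ?X" for f
  proof -
    obtain F b where f: "f = laurent_poly F b" "finite F" using \<open>f \<in> ?X\<close> by blast
    show ?thesis unfolding f(1) by (rule monomial_weight_unconditionally_convergent[OF a' small' f(2)])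
  qed
  ultimately show ?thesis
    unfolding frequent_hypercyclicity_criterion_def
    by (intro exI[of _ ?X] exI[of _ ?S] conjI ballI funcsetI) (simp_all only: laurent_polys_dense topspace_holo_topology)
qed

text \<open>
  Inversions preserve \<open>max \<bar>z\<bar> (\<bar>a\<bar> / \<bar>z\<bar>)\<close> and rotations preserve \<open>\<bar>z\<bar>\<close>, so only dilations with \<open>\<bar>a\<bar> \<noteq> 1\<close>
  remain. There the weight is brought to its monomial normal form and the result is carried back.
\<close>

section \<open>Punctured simply connected domains\<close>

lemma punctured_plane_supercyclic_imp_criterion:
  assumes \<psi>: "\<psi> \<in> holo_Aut (- {0})" and \<omega>: "\<omega> holomorphic_on - {0}"
    and super: "supercyclic (holo_topology (- {0})) fscale (weighted_comp (- {0}) \<omega> \<psi>)"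
  shows "frequent_hypercyclicity_criterion (holo_topology (- {0})) (weighted_comp (- {0}) \<omega> \<psi>)"
proof -
  have U: "open (- {0::complex})" "connected (- {0::complex})"
    using connected_punctured_universe[of "0::complex"] by auto
  have \<omega>0: "\<omega> z \<noteq> 0" if "z \<noteq> 0" for z
    using supercyclic_weight_nonzero[OF U(1) \<omega> \<psi> super, of z] that by simp
  have no_invariant: False
    if "continuous_on (- {0}) \<rho>" "\<And>z. z \<in> - {0} \<Longrightarrow> \<rho> (\<psi> z) = \<rho> z" "s < t"
      "compact {z \<in> - {0}. s \<le> \<rho> z \<and> \<rho> z \<le> t}" "{s<..<t} \<subseteq> \<rho> ` (- {0})" for \<rho> :: "complex \<Rightarrow> real" and s t
    using not_supercyclic_if_invariant[OF U \<omega> \<psi> that] super by blast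
  obtain a where a: "a \<noteq> 0" "(\<forall>z. z \<noteq> 0 \<longrightarrow> \<psi> z = a * z) \<or> (\<forall>z. z \<noteq> 0 \<longrightarrow> \<psi> z = a / z)"
    using punctured_plane_Aut[OF \<psi>] by blast
  show ?thesis
  proof (cases "\<forall>z. z \<noteq> 0 \<longrightarrow> \<psi> z = a * z")
    case False
    then have inv: "\<psi> z = a / z" if "z \<noteq> 0" for z using a(2) that by blast
    define \<rho> where "\<rho> z = max (norm z) (norm a / norm z)" for z :: complex
    \<comment> \<open>above 1 + norm a, every x satisfies norm a / x \<le> x, so x is a level of rho\<close>
    define s t where "s = 1 + norm a" and "t = 2 + norm a"
    have st: "0 < s" "s < t" by (auto simp: s_def t_def add_pos_nonneg)
    have "continuous_on (- {0}) \<rho>" unfolding \<rho>_def by (intro continuous_intros) auto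
    moreover have "\<rho> (\<psi> z) = \<rho> z" if "z \<in> - {0}" for z
      using that a(1) inv[of z] by (simp add: \<rho>_def norm_divide max.commute)
    moreover have "compact {z \<in> - {0}. s \<le> \<rho> z \<and> \<rho> z \<le> t}"
    proof -
      have "{z \<in> - {0}. s \<le> \<rho> z \<and> \<rho> z \<le> t}
          = {z \<in> cball 0 t - ball 0 (norm a / t). s \<le> \<rho> z}"
      proof (intro equalityI subsetI)
        fix z assume "z \<in> {z \<in> - {0}. s \<le> \<rho> z \<and> \<rho> z \<le> t}"
        then have "norm z \<le> t" "norm a / norm z \<le> t" "s \<le> \<rho> z" "z \<noteq> 0" by (auto simp: \<rho>_def)
        then show "z \<in> {z \<in> cball 0 t - ball 0 (norm a / t). s \<le> \<rho> z}"
          using st by (auto simp: field_simps)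
      next
        fix z assume z: "z \<in> {z \<in> cball 0 t - ball 0 (norm a / t). s \<le> \<rho> z}"
        have "0 < norm a / t" using a(1) st by simp
        then have "0 < norm z" using z by auto
        then show "z \<in> {z \<in> - {0}. s \<le> \<rho> z \<and> \<rho> z \<le> t}"
          using z st by (auto simp: \<rho>_def field_simps)
      qed
      moreover have "compact {z \<in> cball 0 t - ball 0 (norm a / t). s \<le> \<rho> z}"
      proof -
        have K: "compact (cball 0 t - ball (0::complex) (norm a / t))"
          by (intro compact_diff) auto
        have "0 < norm a / t" using a(1) st by simp
        then have "continuous_on (cball 0 t - ball 0 (norm a / t)) \<rho>"
          by (intro continuous_on_subset[OF \<open>continuous_on (- {0}) \<rho>\<close>]) auto
        from continuous_closed_preimage[OF this compact_imp_closed[OF K] closed_atLeast[of s]]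
        have "compact ((cball 0 t - ball 0 (norm a / t)) \<inter> ((cball 0 t - ball 0 (norm a / t)) \<inter> \<rho> -` {s..}))"
          by (rule compact_Int_closed[OF K])
        moreover have "(cball 0 t - ball 0 (norm a / t)) \<inter> ((cball 0 t - ball 0 (norm a / t)) \<inter> \<rho> -` {s..})
            = {z \<in> cball 0 t - ball 0 (norm a / t). s \<le> \<rho> z}"
          by blast
        ultimately show ?thesis by simp
      qed
      ultimately show ?thesis by simp
    qed
    moreover have "{s<..<t} \<subseteq> \<rho> ` (- {0})"
    proof
      fix x assume "x \<in> {s<..<t}"
      then have x: "1 < x" "norm a < x" by (auto simp: s_def add_nonneg_pos order_le_less_trans[rotated])
      have "norm a * 1 \<le> x * x" using x by (intro mult_mono) auto
      then have "norm a / x \<le> x" using x by (simp add: field_simps)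
      then have "\<rho> (of_real x) = x" using x by (simp add: \<rho>_def)
      then show "x \<in> \<rho> ` (- {0})" using x by (intro image_eqI[of _ _ "of_real x"]) auto
    qed
    ultimately show ?thesis using no_invariant[of \<rho> s t] st(2) by blast
  next
    case True
    then have lin: "\<psi> z = a * z" if "z \<noteq> 0" for z using that by blast
    have "norm a \<noteq> 1"
    proof
      assume a1: "norm a = 1"
      have "compact {z \<in> - {0::complex}. 1 \<le> norm z \<and> norm z \<le> 2}"
      proof -
        have "{z \<in> - {0::complex}. 1 \<le> norm z \<and> norm z \<le> 2} = cball 0 2 - ball 0 1" by auto
        then show ?thesis by (simp add: compact_diff)
      qed
      moreover have "{1<..<2} \<subseteq> norm ` (- {0::complex})"
      proof
        fix x :: real assume "x \<in> {1<..<2}"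
        then show "x \<in> norm ` (- {0::complex})" by (intro image_eqI[of _ _ "of_real x"]) auto
      qed
      moreover have "norm (\<psi> z) = norm z" if "z \<in> - {0}" for z
        using lin that a1 by (simp add: norm_mult)
      moreover have "continuous_on (- {0::complex}) norm" by (intro continuous_intros)
      ultimately show False using no_invariant[of norm 1 2] by simp
    qed
    obtain k :: int and c u where c: "c \<noteq> 0" and u: "u holomorphic_on - {0}" "\<forall>z. u z \<noteq> 0"
      and uk: "\<forall>z. z \<noteq> 0 \<longrightarrow> \<omega> z * u (a * z) = c * z powi k * u z"
      by (rule punctured_plane_weight_normal_form[OF \<omega> \<omega>0 a(1) \<open>norm a \<noteq> 1\<close>])
    have inv_u: "(\<lambda>z. inverse (u z)) holomorphic_on - {0}"
      using u by (intro holomorphic_on_inverse) auto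
    have "inverse (u z) * \<omega> z = c * z powi k * inverse (u (a * z))" if "z \<noteq> 0" for z
      using uk[rule_format, OF that] u(2) by (simp add: field_simps)
    then have "supercyclic (holo_topology (- {0})) fscale
        (weighted_comp (- {0}) (\<lambda>z. c * z powi k) (\<lambda>z. a * z))"
      by (intro weighted_comp_transfer(1)[OF U(1) \<omega> \<psi> U(1) holomorphic_on_ident holomorphic_on_ident _ _ inv_u _ _ super])
        (use a(1) u(2) lin in auto)
    then have "norm (a powi k) < 1"
      by (rule supercyclic_monomial_weight_imp[OF a(1) \<open>norm a \<noteq> 1\<close> c])
    then have "frequent_hypercyclicity_criterion (holo_topology (- {0}))
        (weighted_comp (- {0}) (\<lambda>z. c * z powi k) (\<lambda>z. a * z))"
      by (rule monomial_weight_frequent_hypercyclicity_criterion[OF a(1) c])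
    then show ?thesis
      by (rule weighted_comp_transfer(2)[OF U(1) monomial_weight_holomorphic dilation_holo_Aut[OF a(1)] U(1)
            holomorphic_on_ident holomorphic_on_ident _ _ u(1), rotated -1])
        (use a(1) u(2) lin uk in \<open>auto simp: mult_ac\<close>)
  qed
qed

lemma punctured_disc_not_supercyclic:
  assumes \<psi>: "\<psi> \<in> holo_Aut (ball 0 1 - {0})" and \<omega>: "\<omega> holomorphic_on ball 0 1 - {0}"
  shows "\<not> supercyclic (holo_topology (ball 0 1 - {0})) fscale (weighted_comp (ball 0 1 - {0}) \<omega> \<psi>)"
proof (rule not_supercyclic_if_invariant[OF _ _ \<omega> \<psi>])
  show "open (ball 0 1 - {0::complex})" by auto
  show "connected (ball 0 1 - {0::complex})" by (rule connected_punctured_ball) simp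
  show "continuous_on (ball 0 1 - {0::complex}) norm" by (intro continuous_intros)
  show "norm (\<psi> z) = norm z" if "z \<in> ball 0 1 - {0}" for z
    by (rule punctured_disc_Aut_norm[OF \<psi> that])
  show "1/3 < (2/3::real)" by simp
  have "{z \<in> ball 0 1 - {0::complex}. 1/3 \<le> norm z \<and> norm z \<le> 2/3} = cball 0 (2/3) - ball 0 (1/3)" by auto
  then show "compact {z \<in> ball 0 1 - {0::complex}. 1/3 \<le> norm z \<and> norm z \<le> 2/3}"
    by (simp add: compact_diff)
  show "{1/3<..<2/3} \<subseteq> norm ` (ball 0 1 - {0::complex})"
  proof
    fix x :: real assume "x \<in> {1/3<..<2/3}"
    then show "x \<in> norm ` (ball 0 1 - {0::complex})" by (intro image_eqI[of _ _ "of_real x"]) auto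
  qed
qed

lemma holo_Aut_conjugate:
  assumes "\<psi> \<in> holo_Aut U"
    and \<phi>: "\<phi> holomorphic_on V" "\<phi>' holomorphic_on U" "\<And>z. z \<in> V \<Longrightarrow> \<phi> z \<in> U \<and> \<phi>' (\<phi> z) = z"
      "\<And>z. z \<in> U \<Longrightarrow> \<phi>' z \<in> V \<and> \<phi> (\<phi>' z) = z"
  shows "(\<lambda>z. \<phi>' (\<psi> (\<phi> z))) \<in> holo_Aut V"
proof -
  have \<psi>: "\<psi> holomorphic_on U" "bij_betw \<psi> U U" using assms(1) by (auto simp: holo_Aut_def)
  have \<psi>U: "\<psi> ` U \<subseteq> U" using \<psi>(2) by (auto simp: bij_betw_def)
  have "bij_betw \<phi> V U" by (rule bij_betw_byWitness[where f' = \<phi>']) (use \<phi> in auto)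
  moreover have "bij_betw \<phi>' U V" by (rule bij_betw_byWitness[where f' = \<phi>]) (use \<phi> in auto)
  ultimately have "bij_betw (\<phi>' \<circ> (\<psi> \<circ> \<phi>)) V V" using \<psi>(2) bij_betw_trans by blast
  moreover have "(\<psi> \<circ> \<phi>) holomorphic_on V"
    by (rule holomorphic_on_compose_gen[OF \<phi>(1) \<psi>(1)]) (use \<phi>(3) in auto)
  then have "(\<phi>' \<circ> (\<psi> \<circ> \<phi>)) holomorphic_on V"
    by (rule holomorphic_on_compose_gen[OF _ \<phi>(2)]) (use \<phi>(3) \<psi>U in auto)
  ultimately show ?thesis by (simp add: holo_Aut_def o_def)
qed

lemma pointed_riemann_map:
  assumes "open \<Omega>" "simply_connected \<Omega>" "\<Omega> \<noteq> UNIV" "z\<^sub>0 \<in> \<Omega>"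
  obtains f g where "f holomorphic_on \<Omega>" "g holomorphic_on ball 0 1" "f z\<^sub>0 = 0" "g 0 = z\<^sub>0"
    "\<forall>z\<in>\<Omega>. f z \<in> ball 0 1 \<and> g (f z) = z" "\<forall>z\<in>ball 0 1. g z \<in> \<Omega> \<and> f (g z) = z"
proof -
  have "\<exists>f g. f holomorphic_on \<Omega> \<and> g holomorphic_on ball 0 1 \<and>
      (\<forall>z\<in>\<Omega>. f z \<in> ball 0 1 \<and> g (f z) = z) \<and> (\<forall>z\<in>ball 0 1. g z \<in> \<Omega> \<and> f (g z) = z)"
    using Riemann_mapping_theorem[of \<Omega>] assms by blast
  then obtain F G where FG: "F holomorphic_on \<Omega>" "G holomorphic_on ball 0 1"
    "\<forall>z\<in>\<Omega>. F z \<in> ball 0 1 \<and> G (F z) = z" "\<forall>z\<in>ball 0 1. G z \<in> \<Omega> \<and> F (G z) = z"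
    by (elim exE conjE)
  have "F z\<^sub>0 \<in> ball 0 1" using FG(3) assms(4) by blast
  then obtain m l where ml: "m (F z\<^sub>0) = 0" "m holomorphic_on ball 0 1" "m ` ball 0 1 \<subseteq> ball 0 1"
    "l holomorphic_on ball 0 1" "l ` ball 0 1 \<subseteq> ball 0 1"
    and ml1: "\<And>z. z \<in> ball 0 1 \<Longrightarrow> m (l z) = z" and ml2: "\<And>z. z \<in> ball 0 1 \<Longrightarrow> l (m z) = z"
    by (rule ball_biholomorphism_exists) blast
  have "(m \<circ> F) holomorphic_on \<Omega>"
    by (rule holomorphic_on_compose_gen[OF FG(1) ml(2)]) (use FG(3) in auto)
  moreover have "(G \<circ> l) holomorphic_on ball 0 1"
    by (rule holomorphic_on_compose_gen[OF ml(4) FG(2)]) (use ml(5) in auto)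
  moreover have "(m \<circ> F) z\<^sub>0 = 0" using ml(1) by simp
  moreover have 1: "\<forall>z\<in>\<Omega>. (m \<circ> F) z \<in> ball 0 1 \<and> (G \<circ> l) ((m \<circ> F) z) = z"
  proof
    fix z assume "z \<in> \<Omega>"
    then have z: "F z \<in> ball 0 1" "G (F z) = z" using FG(3) by auto
    have "m (F z) \<in> ball 0 1" using ml(3) z(1) by (rule image_subset_iff[THEN iffD1, rule_format])
    then show "(m \<circ> F) z \<in> ball 0 1 \<and> (G \<circ> l) ((m \<circ> F) z) = z" using ml2[OF z(1)] z(2) by simp
  qed
  moreover have "\<forall>z\<in>ball 0 1. (G \<circ> l) z \<in> \<Omega> \<and> (m \<circ> F) ((G \<circ> l) z) = z"
  proof
    fix z :: complex assume z: "z \<in> ball 0 1"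
    have lz: "l z \<in> ball 0 1" using ml(5) z by (rule image_subset_iff[THEN iffD1, rule_format])
    have "G (l z) \<in> \<Omega>" "F (G (l z)) = l z" using FG(4) lz by auto
    then show "(G \<circ> l) z \<in> \<Omega> \<and> (m \<circ> F) ((G \<circ> l) z) = z" using ml1[OF z] by simp
  qed
  moreover have "(G \<circ> l) 0 = z\<^sub>0" using 1 assms(4) ml(1) by force
  ultimately show thesis by (intro that[of "m \<circ> F" "G \<circ> l"])
qed

theorem corollary3p3:
  fixes \<Omega> :: "complex set" and z\<^sub>0 :: complex and \<psi> \<omega> :: "complex \<Rightarrow> complex"
  assumes "open \<Omega>" and "connected \<Omega>"
    and simply_connected: "\<forall>K\<in>components (- \<Omega>). \<not> bounded K"
    and "z\<^sub>0 \<in> \<Omega>"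
    and "\<psi> \<in> holo_Aut (\<Omega> - {z\<^sub>0})"
    and "\<omega> holomorphic_on (\<Omega> - {z\<^sub>0})"
  shows "supercyclic (holo_topology (\<Omega> - {z\<^sub>0})) fscale (weighted_comp (\<Omega> - {z\<^sub>0}) \<omega> \<psi>)
    \<longleftrightarrow> frequent_hypercyclicity_criterion (holo_topology (\<Omega> - {z\<^sub>0}))
          (weighted_comp (\<Omega> - {z\<^sub>0}) \<omega> \<psi>)"
proof
  have U: "open (\<Omega> - {z\<^sub>0})" using assms(1) by auto
  {
    assume "frequent_hypercyclicity_criterion (holo_topology (\<Omega> - {z\<^sub>0}))
          (weighted_comp (\<Omega> - {z\<^sub>0}) \<omega> \<psi>)"
    then show "supercyclic (holo_topology (\<Omega> - {z\<^sub>0})) fscale (weighted_comp (\<Omega> - {z\<^sub>0}) \<omega> \<psi>)"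
      by (rule frequent_hypercyclicity_criterion_imp_supercyclic[OF U assms(6,5)])
  }
  assume super: "supercyclic (holo_topology (\<Omega> - {z\<^sub>0})) fscale (weighted_comp (\<Omega> - {z\<^sub>0}) \<omega> \<psi>)"
  have \<psi>U: "\<psi> z \<in> \<Omega> - {z\<^sub>0}" if "z \<in> \<Omega> - {z\<^sub>0}" for z
    using assms(5) that by (auto simp: holo_Aut_def bij_betw_def)
  show "frequent_hypercyclicity_criterion (holo_topology (\<Omega> - {z\<^sub>0})) (weighted_comp (\<Omega> - {z\<^sub>0}) \<omega> \<psi>)"
  proof (cases "\<Omega> = UNIV")
    case True
    define \<phi> \<phi>' where "\<phi> z = z + z\<^sub>0" and "\<phi>' z = z - z\<^sub>0" for z
    have V: "open (- {0::complex})" by auto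
    have \<phi>: "\<phi> holomorphic_on - {0}" "\<phi>' holomorphic_on \<Omega> - {z\<^sub>0}"
      unfolding \<phi>_def \<phi>'_def by (intro holomorphic_intros)+
    have \<phi>1: "\<phi> z \<in> \<Omega> - {z\<^sub>0} \<and> \<phi>' (\<phi> z) = z" if "z \<in> - {0}" for z
      using that True by (auto simp: \<phi>_def \<phi>'_def)
    have \<phi>2: "\<phi>' z \<in> - {0} \<and> \<phi> (\<phi>' z) = z" if "z \<in> \<Omega> - {z\<^sub>0}" for z
      using that by (auto simp: \<phi>_def \<phi>'_def)
    define \<psi>' \<omega>' where "\<psi>' z = \<phi>' (\<psi> (\<phi> z))" and "\<omega>' z = \<omega> (\<phi> z)" for z
    have \<psi>': "\<psi>' \<in> holo_Aut (- {0})"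
      unfolding \<psi>'_def by (rule holo_Aut_conjugate[OF assms(5) \<phi> \<phi>1 \<phi>2])
    have \<omega>': "\<omega>' holomorphic_on - {0}"
      unfolding \<omega>'_def by (rule holomorphic_on_compose_gen[OF \<phi>(1) assms(6), unfolded o_def]) (use \<phi>1 in auto)
    have "supercyclic (holo_topology (- {0})) fscale (weighted_comp (- {0}) \<omega>' \<psi>')"
    proof (rule weighted_comp_transfer(1)[OF U assms(6,5) V \<phi> \<phi>1 \<phi>2 holomorphic_on_const[of 1] _ _ super])
      fix z :: complex assume z: "z \<in> - {0}"
      from \<phi>2[OF \<psi>U] \<phi>1[OF z]
      show "\<psi>' z \<in> - {0} \<and> \<phi> (\<psi>' z) = \<psi> (\<phi> z) \<and> 1 * \<omega> (\<phi> z) = \<omega>' z * 1"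
        by (simp add: \<psi>'_def \<omega>'_def)
    qed auto
    from punctured_plane_supercyclic_imp_criterion[OF \<psi>' \<omega>' this]
    show ?thesis
    proof (rule weighted_comp_transfer(2)[OF V \<omega>' \<psi>' U \<phi>(2,1) \<phi>2 \<phi>1 holomorphic_on_const[of 1], rotated -1])
      fix z assume z: "z \<in> \<Omega> - {z\<^sub>0}"
      show "\<psi> z \<in> \<Omega> - {z\<^sub>0} \<and> \<phi>' (\<psi> z) = \<psi>' (\<phi>' z) \<and> 1 * \<omega>' (\<phi>' z) = \<omega> z * 1"
        using \<psi>U[OF z] \<phi>2[OF z] by (simp add: \<psi>'_def \<omega>'_def)
    qed auto
  next
    case False
    have "simply_connected \<Omega>"
      using simply_connected_eq_unbounded_complement_components[OF assms(1)] assms(2) simply_connected by blast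
    then obtain f g where fg: "f holomorphic_on \<Omega>" "g holomorphic_on ball 0 1" "f z\<^sub>0 = 0" "g 0 = z\<^sub>0"
      "\<forall>z\<in>\<Omega>. f z \<in> ball 0 1 \<and> g (f z) = z" "\<forall>z\<in>ball 0 1. g z \<in> \<Omega> \<and> f (g z) = z"
      by (rule pointed_riemann_map[OF assms(1) _ False assms(4)])
    have V: "open (ball 0 1 - {0::complex})" by auto
    have hol: "g holomorphic_on ball 0 1 - {0}" "f holomorphic_on \<Omega> - {z\<^sub>0}"
      using fg(1,2) by (auto intro: holomorphic_on_subset)
    have g: "g z \<in> \<Omega> - {z\<^sub>0} \<and> f (g z) = z" if "z \<in> ball 0 1 - {0}" for z
      using fg(3,6) that by (metis Diff_iff singletonD singletonI)
    have f: "f z \<in> ball 0 1 - {0} \<and> g (f z) = z" if "z \<in> \<Omega> - {z\<^sub>0}" for z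
      using fg(4,5) that by (metis Diff_iff singletonD singletonI)
    define \<psi>' \<omega>' where "\<psi>' z = f (\<psi> (g z))" and "\<omega>' z = \<omega> (g z)" for z
    have \<psi>': "\<psi>' \<in> holo_Aut (ball 0 1 - {0})"
      unfolding \<psi>'_def by (rule holo_Aut_conjugate[OF assms(5) hol g f])
    have \<omega>': "\<omega>' holomorphic_on ball 0 1 - {0}"
      unfolding \<omega>'_def by (rule holomorphic_on_compose_gen[OF hol(1) assms(6), unfolded o_def]) (intro image_subsetI, use g in blast)
    have "supercyclic (holo_topology (ball 0 1 - {0})) fscale (weighted_comp (ball 0 1 - {0}) \<omega>' \<psi>')"
    proof (rule weighted_comp_transfer(1)[OF U assms(6,5) V hol g f holomorphic_on_const[of 1] _ _ super])
      fix z :: complex assume z: "z \<in> ball 0 1 - {0}"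
      from f[OF \<psi>U] g[OF z]
      show "\<psi>' z \<in> ball 0 1 - {0} \<and> g (\<psi>' z) = \<psi> (g z) \<and> 1 * \<omega> (g z) = \<omega>' z * 1"
        by (simp add: \<psi>'_def \<omega>'_def)
    qed auto
    with punctured_disc_not_supercyclic[OF \<psi>' \<omega>'] show ?thesis by blast
  qed
qed

end
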